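(* Let $p>2$ be a prime, $\mathbf{F}$ a field of characteristic $p$, and $M\in\mathbf{F}^{2\times4}$. If $\gamma_{1234}(M)\neq0$, $\gamma_{1235}(M)=\gamma_{1357}(M)=0$ and $\gamma_{1245}(M)\neq0$, then, with $\widehat{f_2},h_3,N_M(y),N_M(z)$ as defined in the context, the set $\mathcal B:=\{x,N_M(y),\widehat{f_2},h_3,N_M(z)\}$ is a SAGBI basis for $\mathbf{F}[V_M]^E$. Furthermore, $\mathbf{F}[V_M]^E$ is a complete intersection with relations coming from the subduction of the têtes-à-têtes $(\widehat{f_2}^p,N_M(y)^{p+1})$ and $(h_3^p,N_M(y)^{p^2-1}\widehat{f_2})$.
   Context: For $M=(c_{ij})\in\mathbf{F}^{2\times4}$, $E=\langle e_1,e_2,e_3,e_4\rangle\cong(\mathbf{Z}/p)^4$ acts on $\mathbf{F}[V_M]=\mathbf{F}[x,y,z]$ (on the right, by algebra automorphisms) by $x\cdot e_j=x$, $y\cdot e_j=y+c_{1j}x$, $z\cdot e_j=z+2c_{1j}y+(c_{1j}^2+c_{2j})x$; $\mathbf{F}[V_M]^E$ is the ring of invariants. For $f\in\mathbf{F}[V_M]$, $N_M(f)$ is the product of the distinct elements of the $E$-orbit of $f$. Minors: $\Gamma(M)$ is the $10\times4$ matrix whose row $2k+1$ is $(c_{11}^{p^k},\dots,c_{14}^{p^k})$ and whose row $2k+2$ is $(c_{21}^{p^k},\dots,c_{24}^{p^k})$, $k=0,\dots,4$; $\gamma_{ijk\ell}(M)$ is its $4\times4$ minor with rows $i,j,k,\ell$,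 written $\bar\gamma_{ijk\ell}$. Put $\delta:=y^2-xz$ and $$\bar f_1:=\bar\gamma_{1234}y^{p^2}+\bar\gamma_{1235}\delta^px^{p^2-2p}+\bar\gamma_{1245}x^{p^2-p}y^p+\bar\gamma_{1345}\delta x^{p^2-2}+\bar\gamma_{2345}x^{p^2-1}y,$$ $$\bar f_{12346}:=-\bar\gamma_{1234}\delta^{p^2}+\bar\gamma_{1236}\delta^px^{2p^2-2p}+\bar\gamma_{1246}x^{2p^2-p}y^p+\bar\gamma_{1346}\delta x^{2p^2-2}+\bar\gamma_{2346}x^{2p^2-1}y,$$ $$\bar f_2:=\frac{\bar f_1^{\,2}+\bar\gamma_{1234}\bar f_{12346}}{2x^{p^2-2p}},\qquad \widehat{f_2}:=\frac{\bar f_2}{\bar\gamma_{1234}\bar\gamma_{1245}x^p}.$$ Under the hypotheses of the claim, $\bar\gamma_{1345}=0$, $\bar\gamma_{2345}\ne0$ and $N_M(y)=\bar f_1/\bar\gamma_{1234}$, and one defines $$\widetilde{h_3}:=N_M(y)^{p+1}-\widehat{f_2}^p-\left(\frac{\bar\gamma_{1245}}{\bar\gamma_{1234}}-\frac{\bar\gamma_{2345}^p}{\bar\gamma_{1245}^p}\right)\widehat{f_2}N_M(y)^{p-1}x^{p^2-p},\qquad h_3:=\frac{\bar\gamma_{1245}^{p+1}}{x^{p^2-1}\bar\gamma_{2345}^{p+1}}\widetilde{h_3}.$$ The elements $N_M(y),\widehat{f_2},h_3$ lie in $\mathbf{F}[V_M]^E$ and have lead terms $y^{p^2}$, $y^{p^2+p}$,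 $y^{p^3+1}$ respectively. Conventions: graded reverse lexicographic order with $x<y<z$; $\mathrm{LM}$, $\mathrm{LT}$ denote lead monomial and lead term (with coefficient). A finite subset $\mathcal B=\{b_1,\dots,b_m\}$ of a subalgebra $A$ of a polynomial ring is a SAGBI basis for $A$ if the monomials $\mathrm{LM}(b_i)$ generate the algebra spanned by the lead monomials of the elements of $A$. A tête-à-tête is a pair $(b^I,b^J)$ of products of elements of $\mathcal B$ with $\mathrm{LM}(b^I)=\mathrm{LM}(b^J)$. Its subduction: choose a scalar $c$ with $\mathrm{LT}(b^I)=\mathrm{LT}(cb^J)$ and repeatedly cancel the lead term of $b^I-cb^J$ by scalar multiples of products of elements of $\mathcal B$; if this ends at zero, it expresses $b^I-cb^J$ as a polynomial in $\mathcal B$, giving a relation. "Relations coming from the subduction of" given têtes-à-têtes means that the kernel of the surjection from the polynomial ring on $m$ variables sending the variables to $b_1,\dots,b_m$ is generated by the relations so obtained. A complete intersection is an algebra having a presentation whose ideal of relations is generated by a regular sequence. *)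

theory Defs
  imports
    "HOL-Library.Poly_Mapping"
    "HOL-Algebra.Elementary_Groups"
    "HOL-Algebra.Product_Groups"
    "HOL-Computational_Algebra.Primes"
    "Jordan_Normal_Form.Determinant"
begin

section \<open>Multivariate polynomials\<close>

text \<open>Monomials are exponent vectors, polynomials are finitely supported coefficient functions;
  the ring structure is the one of \<^theory>\<open>HOL-Library.Poly_Mapping\<close>.\<close>

type_synonym 'v monomial = "'v \<Rightarrow>\<^sub>0 nat"
type_synonym ('v, 'a) mpoly = "('v \<Rightarrow>\<^sub>0 nat) \<Rightarrow>\<^sub>0 'a"

abbreviation coef :: "('v, 'a::zero) mpoly \<Rightarrow> 'v monomial \<Rightarrow> 'a" where
  "coef \<equiv> Poly_Mapping.lookup"

abbreviation expo :: "'v monomial \<Rightarrow> 'v \<Rightarrow> nat" where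
  "expo \<equiv> Poly_Mapping.lookup"

definition mconst :: "'a::zero \<Rightarrow> ('v, 'a) mpoly" where
  "mconst c = Poly_Mapping.single 0 c"

definition mvar :: "'v \<Rightarrow> ('v, 'a::comm_ring_1) mpoly" where
  "mvar v = Poly_Mapping.single (Poly_Mapping.single v 1) 1"

text \<open>The product \<open>b^K\<close> of a family \<open>b\<close> for an exponent vector \<open>K\<close>, and the algebra
  homomorphism which sends the variable \<open>v\<close> to \<open>b v\<close>.\<close>

definition mprod :: "('v \<Rightarrow> ('w, 'a::comm_ring_1) mpoly) \<Rightarrow> 'v monomial \<Rightarrow> ('w, 'a) mpoly" where
  "mprod b K = (\<Prod>v\<in>Poly_Mapping.keys K. b v ^ expo K v)"

definition msubst :: "('v \<Rightarrow> ('w, 'a::comm_ring_1) mpoly) \<Rightarrow> ('v, 'a) mpoly \<Rightarrow> ('w, 'a) mpoly" where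
  "msubst b f = (\<Sum>m\<in>Poly_Mapping.keys f. mconst (coef f m) * mprod b m)"

text \<open>The quotient \<open>f / g\<close> when it is a polynomial. It is unique for \<open>g \<noteq> 0\<close> over a field;
  nothing is known about the value if \<open>g\<close> does not divide \<open>f\<close>.\<close>

definition exact_quot :: "('v, 'a::comm_ring_1) mpoly \<Rightarrow> ('v, 'a) mpoly \<Rightarrow> ('v, 'a) mpoly" where
  "exact_quot f g = (THE q. g * q = f)"


section \<open>Lead terms\<close>

definition tdeg :: "'v monomial \<Rightarrow> nat" where
  "tdeg m = (\<Sum>v\<in>Poly_Mapping.keys m. expo m v)"

text \<open>Graded reverse lexicographic order, where the order of the variables is the one of the type
  \<open>'v\<close>: among monomials of equal degree, the one with the larger exponent at the smallest
  variable where they differ is the smaller one.\<close>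

definition grevlex_less :: "'v::linorder monomial \<Rightarrow> 'v monomial \<Rightarrow> bool" where
  "grevlex_less m n \<longleftrightarrow> tdeg m < tdeg n \<or>
     (tdeg m = tdeg n \<and> (\<exists>v. expo n v < expo m v \<and> (\<forall>w<v. expo m w = expo n w)))"

text \<open>\<open>LM f\<close> is meaningful for \<open>f \<noteq> 0\<close> only; \<open>LT 0 = 0\<close>.\<close>

definition LM :: "('v::linorder, 'a::comm_ring_1) mpoly \<Rightarrow> 'v monomial" where
  "LM f = (THE m. m \<in> Poly_Mapping.keys f \<and>
             (\<forall>n\<in>Poly_Mapping.keys f. n \<noteq> m \<longrightarrow> grevlex_less n m))"

definition LT :: "('v::linorder, 'a::comm_ring_1) mpoly \<Rightarrow> ('v, 'a) mpoly" where
  "LT f = Poly_Mapping.single (LM f) (coef f (LM f))"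


section \<open>SAGBI bases\<close>

definition subalgebra :: "('v, 'a::comm_ring_1) mpoly set \<Rightarrow> bool" where
  "subalgebra A \<longleftrightarrow> (\<forall>c. mconst c \<in> A) \<and> (\<forall>f\<in>A. \<forall>g\<in>A. f + g \<in> A \<and> f * g \<in> A)"

definition lin_span :: "('v, 'a::comm_ring_1) mpoly set \<Rightarrow> ('v, 'a) mpoly set" where
  "lin_span = Modules.module.span (\<lambda>c f. mconst c * f)"

definition lead_monomials :: "('v::linorder, 'a::comm_ring_1) mpoly set \<Rightarrow> ('v, 'a) mpoly set" where
  "lead_monomials A = {Poly_Mapping.single (LM f) 1 | f. f \<in> A \<and> f \<noteq> 0}"

definition sagbi_basis ::
    "('v::linorder, 'a::comm_ring_1) mpoly set \<Rightarrow> ('v, 'a) mpoly set \<Rightarrow> bool" where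
  "sagbi_basis A B \<longleftrightarrow> subalgebra A \<and> finite B \<and> B \<subseteq> A \<and> 0 \<notin> B \<and>
     subalgebra hull (lead_monomials B) = lin_span (lead_monomials A)"


section \<open>Presentations and complete intersections\<close>

text \<open>The polynomial ring in the \<open>n\<close> variables \<open>0, \<dots>, n - 1\<close>. Ideals and regular sequences are
  taken relative to this ring.\<close>

definition mpoly_ring :: "nat \<Rightarrow> (nat, 'a::comm_ring_1) mpoly set" where
  "mpoly_ring n = {P. \<forall>m\<in>Poly_Mapping.keys P. Poly_Mapping.keys m \<subseteq> {..<n}}"

definition ideal_gen :: "'b::comm_ring_1 set \<Rightarrow> 'b list \<Rightarrow> 'b set" where
  "ideal_gen R rs = {\<Sum>i<length rs. q i * rs ! i | q. \<forall>i<length rs. q i \<in> R}"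

definition regular_sequence :: "'b::comm_ring_1 set \<Rightarrow> 'b list \<Rightarrow> bool" where
  "regular_sequence R rs \<longleftrightarrow> set rs \<subseteq> R \<and> ideal_gen R rs \<noteq> R \<and>
     (\<forall>i<length rs. \<forall>q\<in>R. rs ! i * q \<in> ideal_gen R (take i rs) \<longrightarrow> q \<in> ideal_gen R (take i rs))"

definition presents :: "('v, 'a::comm_ring_1) mpoly list \<Rightarrow> ('v, 'a) mpoly set \<Rightarrow> bool" where
  "presents bs A \<longleftrightarrow> msubst ((!) bs) ` mpoly_ring (length bs) = A"

definition relation_ideal :: "('v, 'a::comm_ring_1) mpoly list \<Rightarrow> (nat, 'a) mpoly set" where
  "relation_ideal bs = {P \<in> mpoly_ring (length bs). msubst ((!) bs) P = 0}"

definition complete_intersection :: "('v, 'a::comm_ring_1) mpoly set \<Rightarrow> bool" where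
  "complete_intersection A \<longleftrightarrow> (\<exists>bs rs. presents bs A \<and>
     regular_sequence (mpoly_ring (length bs)) rs \<and>
     relation_ideal bs = ideal_gen (mpoly_ring (length bs)) rs)"


section \<open>Tete-a-tetes and subduction\<close>

text \<open>A tete-a-tete \<open>(b^I, b^J)\<close> is given by its pair \<open>(I, J)\<close> of exponent vectors.\<close>

definition tete_a_tete ::
    "('v::linorder, 'a::comm_ring_1) mpoly list \<Rightarrow> nat monomial \<Rightarrow> nat monomial \<Rightarrow> bool" where
  "tete_a_tete bs I J \<longleftrightarrow>
     Poly_Mapping.keys I \<subseteq> {..<length bs} \<and> Poly_Mapping.keys J \<subseteq> {..<length bs} \<and>
     LM (mprod ((!) bs) I) = LM (mprod ((!) bs) J)"

text \<open>\<open>subducts bs f Q\<close>: some way of repeatedly cancelling lead terms reduces \<open>f\<close> to zero, and \<open>Q\<close>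
  is the sum of all the terms \<open>c t^K\<close> such that \<open>c b^K\<close> was subtracted on the way.\<close>

inductive subducts ::
    "('v::linorder, 'a::comm_ring_1) mpoly list \<Rightarrow> ('v, 'a) mpoly \<Rightarrow> (nat, 'a) mpoly \<Rightarrow> bool"
    for bs where
  zero: "subducts bs 0 0"
| step: "f \<noteq> 0 \<Longrightarrow> Poly_Mapping.keys K \<subseteq> {..<length bs} \<Longrightarrow>
     LT f = LT (mconst c * mprod ((!) bs) K) \<Longrightarrow>
     subducts bs (f - mconst c * mprod ((!) bs) K) Q \<Longrightarrow>
     subducts bs f (Poly_Mapping.single K c + Q)"

definition subduction_relation ::
    "('v::linorder, 'a::comm_ring_1) mpoly list \<Rightarrow> nat monomial \<times> nat monomial \<Rightarrow>
     (nat, 'a) mpoly \<Rightarrow> bool" where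
  "subduction_relation bs = (\<lambda>(I, J) r. tete_a_tete bs I J \<and>
     (\<exists>c Q. LT (mprod ((!) bs) I) = LT (mconst c * mprod ((!) bs) J) \<and>
            subducts bs (mprod ((!) bs) I - mconst c * mprod ((!) bs) J) Q \<and>
            r = Poly_Mapping.single I 1 - Poly_Mapping.single J c - Q))"

text \<open>Subduction involves choices. It is required that each of the given tete-a-tetes can be
  subducted to zero, and that the resulting relations generate all relations, and form a regular
  sequence, whatever the choices were.\<close>

definition complete_intersection_by_subduction ::
    "('v::linorder, 'a::comm_ring_1) mpoly set \<Rightarrow> ('v, 'a) mpoly list \<Rightarrow>
     (nat monomial \<times> nat monomial) list \<Rightarrow> bool" where
  "complete_intersection_by_subduction A bs ts \<longleftrightarrow> presents bs A \<and>
     (\<forall>t\<in>set ts. \<exists>r. subduction_relation bs t r) \<and>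
     (\<forall>rs. list_all2 (subduction_relation bs) ts rs \<longrightarrow>
        regular_sequence (mpoly_ring (length bs)) rs \<and>
        relation_ideal bs = ideal_gen (mpoly_ring (length bs)) rs)"


section \<open>The representation\<close>

datatype xyz = X | Y | Z

instantiation xyz :: linorder
begin

fun xyz_rank :: "xyz \<Rightarrow> nat" where
  "xyz_rank X = 0" | "xyz_rank Y = 1" | "xyz_rank Z = 2"

definition less_eq_xyz :: "xyz \<Rightarrow> xyz \<Rightarrow> bool" where
  "u \<le> v \<longleftrightarrow> xyz_rank u \<le> xyz_rank v"

definition less_xyz :: "xyz \<Rightarrow> xyz \<Rightarrow> bool" where
  "u < v \<longleftrightarrow> xyz_rank u < xyz_rank v"

instance
proof
  fix u v :: xyz
  show "u \<le> v \<Longrightarrow> v \<le> u \<Longrightarrow> u = v"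
    by (cases u; cases v) (simp_all add: less_eq_xyz_def)
qed (auto simp: less_eq_xyz_def less_xyz_def)

end

type_synonym 'a pol = "(xyz, 'a) mpoly"

abbreviation px :: "'a::comm_ring_1 pol" where "px \<equiv> mvar X"
abbreviation py :: "'a::comm_ring_1 pol" where "py \<equiv> mvar Y"
abbreviation pz :: "'a::comm_ring_1 pol" where "pz \<equiv> mvar Z"

text \<open>Matrix indices start at 0, so \<open>c\<^sub>i\<^sub>j\<close> is \<open>M $$ (i - 1, j - 1)\<close>, and the generators
  \<open>e\<^sub>1, \<dots>, e\<^sub>4\<close> have the numbers \<open>0, \<dots>, 3\<close>.\<close>

definition gen_act :: "'a::comm_ring_1 mat \<Rightarrow> nat \<Rightarrow> 'a pol \<Rightarrow> 'a pol" where
  "gen_act M j = msubst (\<lambda>v. case v of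
       X \<Rightarrow> px
     | Y \<Rightarrow> py + mconst (M $$ (0, j)) * px
     | Z \<Rightarrow> pz + 2 * mconst (M $$ (0, j)) * py + mconst ((M $$ (0, j))^2 + M $$ (1, j)) * px)"

definition E :: "nat \<Rightarrow> (nat \<Rightarrow> int) monoid" where
  "E p = product_group {0..<4} (\<lambda>_. integer_mod_group p)"

text \<open>The element \<open>e\<^sub>1^(g 0) \<cdots> e\<^sub>4^(g 3)\<close> acts on the right.\<close>

definition E_act :: "'a::comm_ring_1 mat \<Rightarrow> (nat \<Rightarrow> int) \<Rightarrow> 'a pol \<Rightarrow> 'a pol" where
  "E_act M g = (gen_act M 3 ^^ nat (g 3)) \<circ> (gen_act M 2 ^^ nat (g 2)) \<circ>
               (gen_act M 1 ^^ nat (g 1)) \<circ> (gen_act M 0 ^^ nat (g 0))"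

definition invariants :: "nat \<Rightarrow> 'a::comm_ring_1 mat \<Rightarrow> 'a pol set" where
  "invariants p M = {f. \<forall>g\<in>carrier (E p). E_act M g f = f}"

definition orbit_norm :: "nat \<Rightarrow> 'a::comm_ring_1 mat \<Rightarrow> 'a pol \<Rightarrow> 'a pol" where
  "orbit_norm p M f = \<Prod>((\<lambda>g. E_act M g f) ` carrier (E p))"


section \<open>The minors and the invariants\<close>

text \<open>Row \<open>r\<close> of \<open>Gamma\<close>, counted from 0, is the row usually numbered \<open>r + 1\<close>; the minors \<open>gam\<close> use
  the numbers \<open>1, \<dots>, 10\<close>.\<close>

definition Gamma :: "nat \<Rightarrow> 'a::comm_ring_1 mat \<Rightarrow> 'a mat" where
  "Gamma p M = mat 10 4 (\<lambda>(r, j). (M $$ (r mod 2, j)) ^ (p ^ (r div 2)))"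

definition gam :: "nat \<Rightarrow> 'a::comm_ring_1 mat \<Rightarrow> nat \<Rightarrow> nat \<Rightarrow> nat \<Rightarrow> nat \<Rightarrow> 'a" where
  "gam p M i j k l = det (mat_of_rows 4 (map (\<lambda>r. row (Gamma p M) (r - 1)) [i, j, k, l]))"

definition delta :: "'a::comm_ring_1 pol" where
  "delta = py^2 - px * pz"

definition f1bar :: "nat \<Rightarrow> 'a::field mat \<Rightarrow> 'a pol" where
  "f1bar p M =
     mconst (gam p M 1 2 3 4) * py^(p^2)
   + mconst (gam p M 1 2 3 5) * delta^p * px^(p^2 - 2*p)
   + mconst (gam p M 1 2 4 5) * px^(p^2 - p) * py^p
   + mconst (gam p M 1 3 4 5) * delta * px^(p^2 - 2)
   + mconst (gam p M 2 3 4 5) * px^(p^2 - 1) * py"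

definition f12346bar :: "nat \<Rightarrow> 'a::field mat \<Rightarrow> 'a pol" where
  "f12346bar p M =
   - mconst (gam p M 1 2 3 4) * delta^(p^2)
   + mconst (gam p M 1 2 3 6) * delta^p * px^(2*p^2 - 2*p)
   + mconst (gam p M 1 2 4 6) * px^(2*p^2 - p) * py^p
   + mconst (gam p M 1 3 4 6) * delta * px^(2*p^2 - 2)
   + mconst (gam p M 2 3 4 6) * px^(2*p^2 - 1) * py"

definition f2bar :: "nat \<Rightarrow> 'a::field mat \<Rightarrow> 'a pol" where
  "f2bar p M = exact_quot ((f1bar p M)^2 + mconst (gam p M 1 2 3 4) * f12346bar p M)
                          (2 * px^(p^2 - 2*p))"

definition f2hat :: "nat \<Rightarrow> 'a::field mat \<Rightarrow> 'a pol" where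
  "f2hat p M = exact_quot (f2bar p M) (mconst (gam p M 1 2 3 4 * gam p M 1 2 4 5) * px^p)"

definition h3tilde :: "nat \<Rightarrow> 'a::field mat \<Rightarrow> 'a pol" where
  "h3tilde p M = (orbit_norm p M py)^(p + 1) - (f2hat p M)^p
     - mconst (gam p M 1 2 4 5 / gam p M 1 2 3 4 - (gam p M 2 3 4 5)^p / (gam p M 1 2 4 5)^p)
       * f2hat p M * (orbit_norm p M py)^(p - 1) * px^(p^2 - p)"

definition h3 :: "nat \<Rightarrow> 'a::field mat \<Rightarrow> 'a pol" where
  "h3 p M = exact_quot (mconst ((gam p M 1 2 4 5)^(p + 1)) * h3tilde p M)
                       (px^(p^2 - 1) * mconst ((gam p M 2 3 4 5)^(p + 1)))"

end

theory Submission
  imports Defs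
begin

text \<open>
  The group acts through the translations \<open>y \<mapsto> y + a x\<close>, \<open>\<delta> \<mapsto> \<delta> - b x\<^sup>2\<close> with \<open>\<delta> = y\<^sup>2 - x z\<close>,
  where \<open>(a, b)\<close> runs through the \<open>\<F>\<^sub>p\<close>-span \<open>W\<close> of the columns of \<open>M\<close>. The condition
  \<open>\<gamma>\<^sub>1\<^sub>2\<^sub>3\<^sub>4 \<noteq> 0\<close> makes \<open>W\<close> a set of \<open>p\<^sup>4\<close> elements. The two vanishing minors say that row five of
  \<open>\<Gamma>\<close> is a combination \<open>\<eta> r\<^sub>3 + \<alpha> r\<^sub>1\<close>, so that every \<open>a\<close> satisfies \<open>a\<^bsup>p\<^sup>2\<^esup> = \<eta> a\<^bsup>p\<^esup> + \<alpha> a\<close>;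
  row six gives an equation of degree \<open>p\<^sup>2\<close> for \<open>b\<close>. Counting \<open>W\<close>, each of these equations has its
  maximal number \<open>p\<^sup>2\<close> of solutions (\<open>row_relations\<close>, \<open>translation_counts\<close>). Hence \<open>N(y)\<close> is the
  homogenized equation of \<open>a\<close>, and the homogenized equation of \<open>b\<close> gives a second invariant \<open>D\<close>,
  of degree \<open>p\<^sup>2\<close> in \<open>\<delta>\<close>. The polynomials \<open>f\<close> (that is, \<open>f2hat\<close>) and \<open>h\<close> (that is, \<open>h3\<close>) are
  obtained from \<open>N\<close> and \<open>D\<close> by dividing combinations of known invariants by powers of \<open>x\<close>;
  expanding modulo small powers of \<open>x\<close> shows what is left (\<open>f_equation\<close>, \<open>h_exists\<close>). The same
  method yields an invariant \<open>k\<close> with lead monomial \<open>z\<^bsup>p\<^sup>4\<^esup>\<close> and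
  \<open>x\<^bsup>p\<^esup> k = h\<^bsup>p\<^esup> - N\<^bsup>p\<^sup>2 - 1\<^esup> f + (\<alpha>/\<eta>) x\<^bsup>p - 1\<^esup> N\<^bsup>p\<^sup>2 - p\<^esup> h\<close> (\<open>k_exists\<close>).

  To see that \<open>C = F[x, N, f, h, k]\<close> is the whole ring of invariants, two facts are combined.
  First, for every invariant \<open>g\<close> some \<open>x\<^bsup>n\<^esup> g\<close> lies in \<open>C\<close>: it is a polynomial in \<open>y\<close> and \<open>\<delta>\<close>
  of degrees below \<open>p\<^sup>2\<close> over \<open>C\<close>, and a polynomial of such degrees which is constant on the orbit
  of \<open>(y, \<delta>)\<close> is constant (\<open>inv_ring_localized\<close>). Second, an element of \<open>C\<close> divisible by \<open>x\<close> is
  \<open>x\<close> times an element of \<open>C\<close> (\<open>divide_by_x\<close>): the relations for \<open>f\<^bsup>p\<^esup>\<close> and \<open>h\<^bsup>p\<^esup>\<close> reduce every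
  element to a combination of monomials in the generators whose exponents of \<open>f\<close> and \<open>h\<close> are
  below \<open>p\<close>, and these have pairwise different lead monomials. The same reduction shows that the
  lead monomials of the invariants are generated by those of \<open>x\<close>, \<open>N\<close>, \<open>f\<close>, \<open>h\<close> and \<open>k\<close>. As
  \<open>N(z)\<close> has the lead monomial of \<open>k\<close>, it can replace \<open>k\<close>, and \<open>\<B>\<close> is a SAGBI basis.

  Finally, let \<open>r\<close> and \<open>s\<close> be any relations from subductions of the two tete-a-tetes. Whatever is
  subtracted in a subduction has a lead monomial below the power of \<open>y\<close> at its start, hence smaller
  degree or a factor \<open>x\<close>. So in a suitable linear order of monomials (\<open>gen_order\<close>) the top
  monomials of \<open>r\<close> and \<open>s\<close> are \<open>t\<^sub>2\<^bsup>p\<^esup>\<close> and \<open>t\<^sub>3\<^bsup>p\<^esup>\<close>. Division by them leaves normal forms, which are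
  linearly independent as elements of the ring of invariants: \<open>r\<close> and \<open>s\<close> generate all relations
  (\<open>relation_ideal_eq\<close>). Since the top monomials are coprime, \<open>r, s\<close> is a regular sequence
  (\<open>regular_sequence_coprime_leads\<close>).
\<close>

abbreviation keys :: "('b \<Rightarrow>\<^sub>0 'c::zero) \<Rightarrow> 'b set" where
  "keys \<equiv> Poly_Mapping.keys"

abbreviation single :: "'b \<Rightarrow> 'c \<Rightarrow> ('b \<Rightarrow>\<^sub>0 'c::zero)" where
  "single \<equiv> Poly_Mapping.single"

section \<open>Substitution homomorphisms\<close>

lemma mconst_0 [simp]: "mconst 0 = 0" and mconst_1 [simp]: "mconst 1 = 1"
  by (simp_all add: mconst_def)

lemma mconst_add: "mconst (a + b) = mconst a + mconst b"
  and mconst_diff: "mconst (c - d) = mconst c - (mconst d :: ('v, 'a::comm_ring_1) mpoly)"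
  and mconst_uminus: "mconst (- c) = - (mconst c :: ('v, 'a) mpoly)"
  and mconst_mult: "mconst (c * d) = mconst c * (mconst d :: ('v, 'a) mpoly)"
  by (simp_all add: mconst_def single_add single_diff single_uminus mult_single)

lemma mconst_power: "mconst (c ^ n) = (mconst c :: ('v, 'a::comm_ring_1) mpoly) ^ n"
  by (induction n) (simp_all add: mconst_mult)

lemma mconst_numeral: "mconst (numeral n) = (numeral n :: ('v, 'a::comm_ring_1) mpoly)"
  by (simp add: mconst_def)

lemma mconst_eq_0_iff [simp]: "mconst c = 0 \<longleftrightarrow> c = 0"
  by (metis lookup_single_eq lookup_zero mconst_0 mconst_def)

lemma coef_single_mult: "coef (single m c * f) (m + n) = c * coef f n"
  for f :: "('v, 'a::comm_ring_1) mpoly"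
  by (simp add: lookup_mult lookup_single when_mult)

lemma coef_mconst_mult: "coef (mconst c * f) m = c * coef f m"
  for f :: "('v, 'a::comm_ring_1) mpoly"
  using coef_single_mult[of 0 c f m] by (simp add: mconst_def)

lemma poly_mapping_sum_singles: "f = (\<Sum>k\<in>keys f. single k (Poly_Mapping.lookup f k))"
  for f :: "'b \<Rightarrow>\<^sub>0 'c::comm_monoid_add"
proof (rule poly_mapping_eqI)
  fix k
  have "Poly_Mapping.lookup (\<Sum>k\<in>keys f. single k (Poly_Mapping.lookup f k)) k =
     (\<Sum>m\<in>keys f. if k = m then Poly_Mapping.lookup f m else 0)"
    unfolding lookup_sum by (rule sum.cong) (auto simp: lookup_single when_def)
  then show "Poly_Mapping.lookup f k =
      Poly_Mapping.lookup (\<Sum>k\<in>keys f. single k (Poly_Mapping.lookup f k)) k"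
    by (simp add: in_keys_iff)
qed

lemma mpoly_induct [case_names single add]:
  fixes f :: "('v, 'a::comm_ring_1) mpoly"
  assumes "\<And>m c. P (single m c)" and "\<And>f g. P f \<Longrightarrow> P g \<Longrightarrow> P (f + g)"
  shows "P f"
proof -
  have "P (\<Sum>m\<in>S. single m (coef f m))" if "finite S" for S
    using that
  proof induction
    case empty
    show ?case using assms(1)[of 0 0] by simp
  next
    case (insert m S)
    then show ?case using assms(2)[OF assms(1)] by simp
  qed
  then have "P (\<Sum>m\<in>keys f. single m (coef f m))" by simp
  then show ?thesis unfolding poly_mapping_sum_singles[of f, symmetric] .
qed

lemma mprod_0 [simp]: "mprod b 0 = 1"
  by (simp add: mprod_def)

lemma mprod_superset:
  assumes "finite S" "keys K \<subseteq> S"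
  shows "mprod b K = (\<Prod>v\<in>S. b v ^ expo K v)"
  unfolding mprod_def by (rule prod.mono_neutral_left) (use assms in \<open>auto simp: in_keys_iff\<close>)

lemma mprod_add: "mprod b (K + L) = mprod b K * mprod b L"
proof -
  let ?S = "keys K \<union> keys L"
  have "mprod b (K + L) = (\<Prod>v\<in>?S. b v ^ expo (K + L) v)"
    by (rule mprod_superset) (auto dest!: subsetD[OF Poly_Mapping.keys_add])
  also have "\<dots> = (\<Prod>v\<in>?S. b v ^ expo K v) * (\<Prod>v\<in>?S. b v ^ expo L v)"
    by (simp add: lookup_add power_add prod.distrib)
  also have "(\<Prod>v\<in>?S. b v ^ expo K v) = mprod b K"
    by (rule mprod_superset[symmetric]) auto
  also have "(\<Prod>v\<in>?S. b v ^ expo L v) = mprod b L"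
    by (rule mprod_superset[symmetric]) auto
  finally show ?thesis .
qed

lemma mprod_single [simp]: "mprod b (single v n) = b v ^ n"
  by (subst mprod_superset[of "{v}"]) auto

lemma mprod_mvar: "mprod mvar m = (single m 1 :: ('v, 'a::comm_ring_1) mpoly)"
proof -
  have pow: "mvar v ^ n = (single (single v n) 1 :: ('v, 'a) mpoly)"
    for v n
    by (induction n) (simp_all add: mvar_def mult_single flip: single_add)
  have "(\<Prod>v\<in>S. mvar v ^ expo m v) =
     (single (\<Sum>v\<in>S. single v (expo m v)) 1 :: ('v, 'a) mpoly)"
    if "finite S" for S
    using that by induction (simp_all add: pow mult_single)
  then show ?thesis
    using poly_mapping_sum_singles[of m] by (simp add: mprod_def)
qed

lemma single_eq_mprod: "single m c = mconst c * mprod mvar m"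
  for c :: "'a::comm_ring_1"
  by (simp add: mprod_mvar mconst_def mult_single)

lemma msubst_superset:
  assumes "finite S" "keys f \<subseteq> S"
  shows "msubst b f = (\<Sum>m\<in>S. mconst (coef f m) * mprod b m)"
  unfolding msubst_def by (rule sum.mono_neutral_left) (use assms in \<open>auto simp: in_keys_iff\<close>)

lemma msubst_single [simp]: "msubst b (single m c) = mconst c * mprod b m"
  by (subst msubst_superset[of "{m}"]) auto

lemma msubst_0 [simp]: "msubst b 0 = 0"
  by (simp add: msubst_def)

lemma msubst_add: "msubst b (f + g) = msubst b f + msubst b g"
proof -
  let ?S = "keys f \<union> keys g"
  have "msubst b (f + g) = (\<Sum>m\<in>?S. mconst (coef (f + g) m) * mprod b m)"
    by (rule msubst_superset) (auto dest!: subsetD[OF Poly_Mapping.keys_add])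
  also have "\<dots> = (\<Sum>m\<in>?S. mconst (coef f m) * mprod b m) + (\<Sum>m\<in>?S. mconst (coef g m) * mprod b m)"
    by (simp add: lookup_add mconst_add distrib_right sum.distrib)
  also have "(\<Sum>m\<in>?S. mconst (coef f m) * mprod b m) = msubst b f"
    by (rule msubst_superset[symmetric]) auto
  also have "(\<Sum>m\<in>?S. mconst (coef g m) * mprod b m) = msubst b g"
    by (rule msubst_superset[symmetric]) auto
  finally show ?thesis .
qed

lemma msubst_mult: "msubst b (f * g) = msubst b f * msubst b g"
proof (induction f rule: mpoly_induct)
  case (single m c)
  show ?case
  proof (induction g rule: mpoly_induct)
    case (single n d)
    show ?case by (simp add: mult_single mconst_mult mprod_add mult_ac)
  qed (simp add: algebra_simps msubst_add)
qed (simp add: algebra_simps msubst_add)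

lemma msubst_uminus: "msubst b (- f) = - msubst b f"
  using msubst_add[of b f "-f"] by (simp add: eq_neg_iff_add_eq_0 add.commute)

lemma msubst_diff: "msubst b (f - g) = msubst b f - msubst b g"
  using msubst_add[of b f "- g"] by (simp add: msubst_uminus)

lemma msubst_mconst [simp]: "msubst b (mconst c) = mconst c"
  using msubst_single[of b 0 c] by (simp add: mconst_def[symmetric])

lemma msubst_1 [simp]: "msubst b 1 = 1"
  using msubst_mconst[of b 1] by simp

lemma msubst_numeral [simp]: "msubst b (numeral n) = numeral n"
  using msubst_mconst[of b "numeral n"] unfolding mconst_numeral .

lemma msubst_mvar [simp]: "msubst b (mvar v) = b v"
  by (simp add: mvar_def)

lemma msubst_power: "msubst b (f ^ n) = msubst b f ^ n"
  by (induction n) (simp_all add: msubst_mult)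

lemma msubst_sum: "msubst b (sum f S) = (\<Sum>i\<in>S. msubst b (f i))"
  by (induction S rule: infinite_finite_induct) (simp_all add: msubst_add)

lemma msubst_prod: "msubst b (prod f S) = (\<Prod>i\<in>S. msubst b (f i))"
  by (induction S rule: infinite_finite_induct) (simp_all add: msubst_mult)

lemmas msubst_hom = msubst_add msubst_diff msubst_uminus msubst_mult msubst_power

lemma msubst_mprod: "msubst b (mprod c m) = mprod (\<lambda>v. msubst b (c v)) m"
  by (simp add: mprod_def msubst_prod msubst_power)

lemma msubst_msubst: "msubst b (msubst c f) = msubst (\<lambda>v. msubst b (c v)) f"
  by (induction f rule: mpoly_induct) (simp_all add: msubst_add msubst_mult msubst_mprod)

lemma msubst_mvar_id [simp]: "msubst mvar f = f"
  by (induction f rule: mpoly_induct) (simp add: mprod_mvar mconst_def mult_single, simp add: msubst_add)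

lemma mpoly_ring_single: "single K c \<in> mpoly_ring n"
  if "keys K \<subseteq> {..<n}"
  using that by (simp add: mpoly_ring_def)

lemma mpoly_ring_0: "0 \<in> mpoly_ring n"
  by (simp add: mpoly_ring_def)

lemma mpoly_ring_1: "1 \<in> mpoly_ring n"
  by (simp add: mpoly_ring_def)

lemma mpoly_ring_mconst: "mconst c \<in> mpoly_ring n"
  by (simp add: mpoly_ring_def mconst_def)

lemma mpoly_ring_add: "f \<in> mpoly_ring n \<Longrightarrow> g \<in> mpoly_ring n \<Longrightarrow> f + g \<in> mpoly_ring n"
  unfolding mpoly_ring_def using Poly_Mapping.keys_add[of f g] by blast

lemma mpoly_ring_diff: "f \<in> mpoly_ring n \<Longrightarrow> g \<in> mpoly_ring n \<Longrightarrow> f - g \<in> mpoly_ring n"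
  unfolding mpoly_ring_def using keys_diff[of f g] by blast

lemma mpoly_ring_mult: "f \<in> mpoly_ring n \<Longrightarrow> g \<in> mpoly_ring n \<Longrightarrow> f * g \<in> mpoly_ring n"
  unfolding mpoly_ring_def
proof (intro CollectI ballI)
  fix m assume fg: "f \<in> {P. \<forall>m\<in>keys P. keys m \<subseteq> {..<n}}"
    "g \<in> {P. \<forall>m\<in>keys P. keys m \<subseteq> {..<n}}"
    and "m \<in> keys (f * g)"
  then obtain a b where "m = a + b" "a \<in> keys f" "b \<in> keys g"
    using keys_mult[of f g] by blast
  then show "keys m \<subseteq> {..<n}"
    using fg Poly_Mapping.keys_add[of a b] by blast
qed

lemma mpoly_ring_mvar: "i < n \<Longrightarrow> mvar i \<in> mpoly_ring n"
  by (simp add: mpoly_ring_def mvar_def)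

lemma exact_quotI: "exact_quot f g = q" if "g * q = f" "g \<noteq> 0"
  for f :: "('v::linorder, 'a::idom) mpoly"
  unfolding exact_quot_def using that by (intro the_equality) auto

lemma subalgebra_0: "subalgebra A \<Longrightarrow> 0 \<in> A"
  using mconst_0 unfolding subalgebra_def by metis

lemma subalgebra_uminus: "- f \<in> A" if "subalgebra A" "f \<in> A"
proof -
  have "mconst (-1) * f \<in> A" using that by (auto simp: subalgebra_def)
  then show ?thesis by (simp add: mconst_uminus)
qed

lemma subalgebra_closed:
  assumes "subalgebra A"
  shows "mconst c \<in> A" "0 \<in> A" "1 \<in> A"
    and "f \<in> A \<Longrightarrow> g \<in> A \<Longrightarrow> f + g \<in> A" "f \<in> A \<Longrightarrow> g \<in> A \<Longrightarrow> f * g \<in> A"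
    and "f \<in> A \<Longrightarrow> - f \<in> A" "f \<in> A \<Longrightarrow> g \<in> A \<Longrightarrow> f - g \<in> A"
    and "f \<in> A \<Longrightarrow> f ^ n \<in> A"
proof -
  show "1 \<in> A" using mconst_1 assms unfolding subalgebra_def by metis
  then show "f \<in> A \<Longrightarrow> f ^ n \<in> A"
    using assms by (induction n) (auto simp: subalgebra_def)
  show "f \<in> A \<Longrightarrow> g \<in> A \<Longrightarrow> f - g \<in> A"
    using subalgebra_uminus[OF assms, of g] assms unfolding subalgebra_def
    by (metis add_uminus_conv_diff)
  show "mconst c \<in> A" "f \<in> A \<Longrightarrow> g \<in> A \<Longrightarrow> f + g \<in> A" "f \<in> A \<Longrightarrow> g \<in> A \<Longrightarrow> f * g \<in> A"
    using assms by (auto simp: subalgebra_def)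
  show "0 \<in> A" by (rule subalgebra_0[OF assms])
  show "f \<in> A \<Longrightarrow> - f \<in> A" by (rule subalgebra_uminus[OF assms])
qed

lemma subalgebra_sum: "subalgebra A \<Longrightarrow> (\<And>i. i \<in> S \<Longrightarrow> f i \<in> A) \<Longrightarrow> sum f S \<in> A"
  by (induction S rule: infinite_finite_induct) (auto simp: subalgebra_closed)

lemma subalgebra_prod: "subalgebra A \<Longrightarrow> (\<And>i. i \<in> S \<Longrightarrow> f i \<in> A) \<Longrightarrow> prod f S \<in> A"
  by (induction S rule: infinite_finite_induct) (auto simp: subalgebra_closed)

lemma subalgebra_mprod:
  "subalgebra A \<Longrightarrow> (\<And>v. v \<in> keys K \<Longrightarrow> b v \<in> A) \<Longrightarrow> mprod b K \<in> A"
  unfolding mprod_def by (intro subalgebra_prod) (auto simp: subalgebra_closed)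

lemma subalgebra_msubst:
  "subalgebra A \<Longrightarrow> P \<in> mpoly_ring n \<Longrightarrow> (\<And>i. i < n \<Longrightarrow> b i \<in> A) \<Longrightarrow> msubst b P \<in> A"
  unfolding msubst_def
  by (intro subalgebra_sum subalgebra_closed(5) subalgebra_mprod subalgebra_closed(1))
     (auto simp: mpoly_ring_def)

lemma subalgebra_msubst_image: "subalgebra (msubst b ` mpoly_ring n)"
  unfolding subalgebra_def
proof (intro conjI allI ballI)
  fix c show "mconst c \<in> msubst b ` mpoly_ring n"
    by (rule image_eqI[of _ _ "mconst c"]) (simp_all add: mpoly_ring_mconst)
next
  fix f g assume "f \<in> msubst b ` mpoly_ring n" "g \<in> msubst b ` mpoly_ring n"
  then show "f + g \<in> msubst b ` mpoly_ring n" "f * g \<in> msubst b ` mpoly_ring n"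
    by (auto simp flip: msubst_add msubst_mult intro!: imageI mpoly_ring_add mpoly_ring_mult)
qed

section \<open>Lead monomials in three variables\<close>

abbreviation xyz_mono :: "nat \<Rightarrow> nat \<Rightarrow> nat \<Rightarrow> xyz monomial" where
  "xyz_mono i j k \<equiv> single X i + single Y j + single Z k"

lemma UNIV_xyz: "(UNIV :: xyz set) = {X, Y, Z}"
proof -
  have "v \<in> {X, Y, Z}" for v :: xyz by (cases v) auto
  then show ?thesis by blast
qed

lemma xyz_less_simps [simp]:
  "X < Y" "Y < Z" "X < Z" "\<not> w < X" "w < Y \<longleftrightarrow> w = X" "w < Z \<longleftrightarrow> w = X \<or> w = Y"
  by (simp_all add: less_xyz_def) (cases w; simp)+

lemma xyz_ex: "(\<exists>v :: xyz. P v) \<longleftrightarrow> P X \<or> P Y \<or> P Z"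
proof
  assume "\<exists>v. P v"
  then obtain v where "P v" by blast
  then show "P X \<or> P Y \<or> P Z" by (cases v) auto
qed blast

lemma xyz_monomial_eq_iff: "m = n \<longleftrightarrow> expo m X = expo n X \<and> expo m Y = expo n Y \<and> expo m Z = expo n Z"
  for m n :: "xyz monomial"
proof (intro iffI poly_mapping_eqI)
  fix v assume "expo m X = expo n X \<and> expo m Y = expo n Y \<and> expo m Z = expo n Z"
  then show "expo m v = expo n v" by (cases v) auto
qed auto

lemma expo_xyz_mono [simp]:
  "expo (xyz_mono i j k) X = i" "expo (xyz_mono i j k) Y = j" "expo (xyz_mono i j k) Z = k"
  by (simp_all add: lookup_add lookup_single)

lemma tdeg_xyz: "tdeg m = expo m X + expo m Y + expo m Z"
proof -
  have fin: "finite (UNIV :: xyz set)" unfolding UNIV_xyz by simp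
  have "tdeg m = (\<Sum>v\<in>UNIV. expo m v)"
    unfolding tdeg_def
    by (rule sum.mono_neutral_left) (auto simp: in_keys_iff fin)
  then show ?thesis by (simp add: UNIV_xyz add.assoc)
qed

lemma tdeg_xyz_add [simp]: "tdeg (m + n) = tdeg m + tdeg n" for m n :: "xyz monomial"
  by (simp add: tdeg_xyz lookup_add)

lemma grevlex_xyz:
  "grevlex_less m n \<longleftrightarrow> tdeg m < tdeg n \<or> tdeg m = tdeg n \<and>
     (expo n X < expo m X \<or> expo n X = expo m X \<and> expo n Y < expo m Y)"
  unfolding grevlex_less_def xyz_ex by (auto simp: tdeg_xyz)

lemma grevlex_irrefl: "\<not> grevlex_less m m" for m :: "xyz monomial"
  by (simp add: grevlex_xyz)

lemma grevlex_trans: "grevlex_less l m \<Longrightarrow> grevlex_less m n \<Longrightarrow> grevlex_less l n"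
  for m :: "xyz monomial"
  by (auto simp: grevlex_xyz)

lemma grevlex_total: "m \<noteq> n \<Longrightarrow> grevlex_less m n \<or> grevlex_less n m"
  for m n :: "xyz monomial"
  by (auto simp: grevlex_xyz xyz_monomial_eq_iff tdeg_xyz)

lemma grevlex_add_right: "grevlex_less m n \<Longrightarrow> grevlex_less (m + l) (n + l)"
  for m :: "xyz monomial"
  by (auto simp: grevlex_xyz lookup_add)

lemma grevlex_add_left: "grevlex_less m n \<Longrightarrow> grevlex_less (l + m) (l + n)"
  for m :: "xyz monomial"
  by (auto simp: grevlex_xyz lookup_add)

text \<open>The order compares degree, then the number of factors other than \<open>x\<close>, then the number of
  factors \<open>z\<close>: a lexicographic order on triples of natural numbers.\<close>

lemma wf_grevlex: "wf {(m, n :: xyz monomial). grevlex_less m n}"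
proof (rule wf_subset)
  let ?f = "\<lambda>m :: xyz monomial. (tdeg m, expo m Y + expo m Z, expo m Z)"
  show "wf (inv_image (less_than <*lex*> less_than <*lex*> less_than) ?f)"
    by (intro wf_inv_image wf_lex_prod wf_less_than)
  show "{(m, n). grevlex_less m n} \<subseteq> inv_image (less_than <*lex*> less_than <*lex*> less_than) ?f"
    by (auto simp: grevlex_xyz tdeg_xyz)
qed

text \<open>\<open>LM\<close> and \<open>LT\<close> are meaningful for nonzero polynomials only. This relation includes \<open>f \<noteq> 0\<close> and
  determines both.\<close>

definition leads :: "'a::idom pol \<Rightarrow> xyz monomial \<Rightarrow> 'a \<Rightarrow> bool" where
  "leads f m c \<longleftrightarrow> c \<noteq> 0 \<and> coef f m = c \<and>
     (\<forall>n\<in>keys f. n \<noteq> m \<longrightarrow> grevlex_less n m)"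

lemma leads_nonzero: "leads f m c \<Longrightarrow> f \<noteq> 0"
  by (auto simp: leads_def)

lemma leads_LM: "LM f = m" if "leads f m c"
  unfolding LM_def
proof (rule the_equality)
  show m: "m \<in> keys f \<and> (\<forall>n\<in>keys f. n \<noteq> m \<longrightarrow> grevlex_less n m)"
    using that by (auto simp: leads_def in_keys_iff)
  show "m' = m" if m': "m' \<in> keys f \<and> (\<forall>n\<in>keys f. n \<noteq> m' \<longrightarrow> grevlex_less n m')"
    for m'
  proof (rule ccontr)
    assume "m' \<noteq> m"
    with m m' have "grevlex_less m m'" "grevlex_less m' m" by auto
    then show False using grevlex_irrefl grevlex_trans by blast
  qed
qed

lemma leads_LT: "leads f m c \<Longrightarrow> LT f = single m c"
  by (auto simp: LT_def leads_LM leads_def)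

lemma leads_single: "c \<noteq> 0 \<Longrightarrow> leads (single m c) m c"
  by (simp add: leads_def)

lemma leads_mconst: "c \<noteq> 0 \<Longrightarrow> leads (mconst c) 0 c"
  by (simp add: leads_single mconst_def)

lemma finite_grevlex_max:
  fixes S :: "xyz monomial set"
  assumes "finite S" "S \<noteq> {}"
  obtains m where "m \<in> S" "\<And>n. n \<in> S \<Longrightarrow> n \<noteq> m \<Longrightarrow> grevlex_less n m"
  using assms
proof (induction arbitrary: thesis rule: finite_ne_induct)
  case (insert s S)
  obtain m where m: "m \<in> S" "\<And>n. n \<in> S \<Longrightarrow> n \<noteq> m \<Longrightarrow> grevlex_less n m"
    using insert.IH by blast
  have "s \<noteq> m" using m insert by auto
  then consider "grevlex_less s m" | "grevlex_less m s" using grevlex_total by blast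
  then show ?case
  proof cases
    case 1
    then show ?thesis using m by (intro insert.prems[of m]) auto
  next
    case 2
    have "grevlex_less n s" if "n \<in> S" for n
      using m(2)[OF that] 2 grevlex_trans[of n m s] by blast
    then show ?thesis by (intro insert.prems[of s]) auto
  qed
qed auto

lemma leads_exists: assumes "f \<noteq> 0" obtains m c where "leads f m c"
proof -
  obtain m where "m \<in> keys f"
    "\<And>n. n \<in> keys f \<Longrightarrow> n \<noteq> m \<Longrightarrow> grevlex_less n m"
    using finite_grevlex_max[of "keys f"] assms by auto
  then show thesis by (intro that[of m "coef f m"]) (auto simp: leads_def in_keys_iff)
qed

lemma leads_of_nonzero: "f \<noteq> 0 \<Longrightarrow> leads f (LM f) (coef f (LM f))"
proof -
  assume "f \<noteq> 0"
  then obtain m c where "leads f m c" by (rule leads_exists)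
  then show ?thesis using leads_LM[of f m c] by (simp add: leads_def)
qed

lemma leads_mult:
  assumes "leads f m c" "leads g n d"
  shows "leads (f * g) (m + n) (c * d)"
proof -
  have key: "k = m + n \<or> grevlex_less k (m + n)" if k: "k \<in> keys (f * g)" for k
  proof -
    obtain a b where "k = a + b" "a \<in> keys f" "b \<in> keys g"
      using subsetD[OF keys_mult k] by blast
    then have "a = m \<or> grevlex_less a m" "b = n \<or> grevlex_less b n"
      using assms by (auto simp: leads_def)
    then show ?thesis
      using \<open>k = a + b\<close> grevlex_add_left[of b n] grevlex_add_right[of a m]
        grevlex_trans[of "a + b" "a + n" "m + n"] by blast
  qed
  define f' where "f' = f - single m c"
  have f': "grevlex_less a m" if "a \<in> keys f'" for a
    using that assms by (auto simp: f'_def leads_def in_keys_iff lookup_minus lookup_single when_def split: if_splits)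
  have "m + n \<notin> keys (f' * g)"
  proof
    assume "m + n \<in> keys (f' * g)"
    then obtain a b where "m + n = a + b" "a \<in> keys f'" "b \<in> keys g"
      using subsetD[OF keys_mult] by blast
    then have "grevlex_less a m" "b = n \<or> grevlex_less b n"
      using assms(2) f' by (auto simp: leads_def)
    then show False
      using \<open>m + n = a + b\<close> grevlex_add_left[of b n a] grevlex_add_right[of a m n]
        grevlex_trans[of "a + b" "a + n" "m + n"] grevlex_irrefl[of "m + n"] by auto
  qed
  moreover have "f * g = single m c * g + f' * g"
    by (simp add: f'_def algebra_simps)
  ultimately have "coef (f * g) (m + n) = c * d"
    using assms(2) by (simp add: lookup_add coef_single_mult in_keys_iff leads_def)
  then show ?thesis using key assms by (auto simp: leads_def)
qed

lemma leads_mconst_mult: "leads f m d \<Longrightarrow> c \<noteq> 0 \<Longrightarrow> leads (mconst c * f) m (c * d)"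
  using leads_mult[OF leads_mconst] by fastforce

text \<open>The step that makes subduction terminate.\<close>

lemma leads_diff_less:
  assumes "leads f m c" "leads g m c" "f - g \<noteq> 0"
  shows "grevlex_less (LM (f - g)) m"
proof -
  let ?n = "LM (f - g)"
  have n: "?n \<in> keys (f - g)"
    using leads_of_nonzero[OF assms(3)] by (auto simp: leads_def in_keys_iff)
  then have "?n \<in> keys f \<union> keys g" "?n \<noteq> m"
    using assms keys_diff[of f g] by (auto simp: leads_def in_keys_iff lookup_minus)
  then show ?thesis using assms by (auto simp: leads_def)
qed

text \<open>Terms with different lead monomials cannot cancel: the largest one survives.\<close>

lemma leads_sum_distinct:
  fixes g :: "'i \<Rightarrow> 'a::idom pol"
  assumes "finite S" "S \<noteq> {}" "inj_on l S" "\<And>i. i \<in> S \<Longrightarrow> leads (g i) (l i) (c i)"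
  obtains i where "i \<in> S" "leads (\<Sum>i\<in>S. g i) (l i) (c i)"
proof -
  obtain i where i: "i \<in> S" "\<And>j. j \<in> S \<Longrightarrow> l j \<noteq> l i \<Longrightarrow> grevlex_less (l j) (l i)"
  proof -
    have "finite (l ` S)" "l ` S \<noteq> {}" using assms(1,2) by simp_all
    then obtain m where m: "m \<in> l ` S" "\<And>n. n \<in> l ` S \<Longrightarrow> n \<noteq> m \<Longrightarrow> grevlex_less n m"
      by (rule finite_grevlex_max) blast
    then obtain i where "i \<in> S" "m = l i" by blast
    then show thesis using m(2) by (intro that[of i]) auto
  qed
  have lt: "grevlex_less (l j) (l i)" if "j \<in> S - {i}" for j
  proof -
    have "l j \<noteq> l i" using inj_onD[OF assms(3), of j i] that i(1) by blast
    then show ?thesis using that i(2)[of j] by blast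
  qed
  have other: "grevlex_less n (l i)" if "n \<in> keys (g j)" "j \<in> S - {i}" for n j
  proof (cases "n = l j")
    case False
    then have "grevlex_less n (l j)" using assms(4)[of j] that by (simp add: leads_def)
    then show ?thesis using lt[OF that(2)] grevlex_trans by blast
  qed (use lt[OF that(2)] in simp)
  have split: "(\<Sum>i\<in>S. g i) = g i + (\<Sum>j\<in>S-{i}. g j)"
    using assms(1) i(1) by (simp add: sum.remove)
  have "leads (\<Sum>i\<in>S. g i) (l i) (c i)"
    unfolding leads_def
  proof (intro conjI ballI impI)
    show "c i \<noteq> 0" using assms(4) i(1) by (simp add: leads_def)
    have "coef (\<Sum>j\<in>S-{i}. g j) (l i) = 0"
      unfolding lookup_sum using other grevlex_irrefl
      by (intro sum.neutral) (auto simp: in_keys_iff)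
    then show "coef (\<Sum>i\<in>S. g i) (l i) = c i"
      using assms(4) i(1) by (simp add: split lookup_add leads_def)
    fix n assume n: "n \<in> keys (\<Sum>i\<in>S. g i)" "n \<noteq> l i"
    then obtain j where "j \<in> S" "n \<in> keys (g j)"
      using keys_sum[of g S] by blast
    then show "grevlex_less n (l i)"
      using other[of n j] n(2) assms(4)[of i] by (cases "j = i") (auto simp: leads_def)
  qed
  then show thesis using that i(1) by blast
qed

section \<open>Homogeneous polynomials\<close>

definition homog :: "nat \<Rightarrow> 'a::idom pol \<Rightarrow> bool" where
  "homog d f \<longleftrightarrow> (\<forall>m\<in>keys f. tdeg m = d)"

lemma homog_mconst: "homog 0 (mconst c)"
  by (simp add: homog_def mconst_def tdeg_xyz)

lemma homog_mvar: "homog 1 (mvar v)"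
  by (cases v) (simp_all add: homog_def mvar_def tdeg_xyz lookup_single)

lemma homog_add: "homog d f \<Longrightarrow> homog d g \<Longrightarrow> homog d (f + g)"
  using Poly_Mapping.keys_add[of f g] by (auto simp: homog_def)

lemma homog_diff: "homog d f \<Longrightarrow> homog d g \<Longrightarrow> homog d (f - g)"
  using keys_diff[of f g] by (auto simp: homog_def)

lemma homog_mult: "homog d f \<Longrightarrow> homog e g \<Longrightarrow> homog (d + e) (f * g)"
  using keys_mult[of f g] by (fastforce simp: homog_def)

lemma homog_mconst_mult: "homog d f \<Longrightarrow> homog d (mconst c * f)"
  using homog_mult[OF homog_mconst] by fastforce

lemma homog_power: "homog d f \<Longrightarrow> homog (n * d) (f ^ n)"
proof (induction n)
  case 0
  show ?case using homog_mconst[of 1] by simp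
qed (use homog_mult in auto)

lemma homog_prod: "(\<And>i. i \<in> S \<Longrightarrow> homog 1 (f i)) \<Longrightarrow> homog (card S) (prod f S)"
proof (induction S rule: infinite_finite_induct)
  case (insert i S)
  then show ?case using homog_mult[of 1 "f i" "card S" "prod f S"] by simp
qed (use homog_mconst[of 1] in simp_all)

lemma px_power_single: "px ^ n = (single (single X n) 1 :: 'a::idom pol)"
  and py_power_single: "py ^ n = (single (single Y n) 1 :: 'a::idom pol)"
  and pz_power_single: "pz ^ n = (single (single Z n) 1 :: 'a::idom pol)"
proof -
  have "mvar v ^ n = (single (single v n) 1 :: 'a::idom pol)" for v
    by (induction n) (simp_all add: mvar_def mult_single flip: single_add)
  then show "px ^ n = (single (single X n) 1 :: 'a::idom pol)"
    "py ^ n = (single (single Y n) 1 :: 'a::idom pol)"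
    "pz ^ n = (single (single Z n) 1 :: 'a::idom pol)" by blast+
qed

lemma homog_cancel_px:
  assumes "homog (n + d) (px ^ n * f)"
  shows "homog d f"
  unfolding homog_def
proof
  fix m assume "m \<in> keys f"
  then have "single X n + m \<in> keys (px ^ n * f)"
    unfolding px_power_single in_keys_iff coef_single_mult by simp
  then show "tdeg m = d"
    using assms by (auto simp: homog_def tdeg_xyz lookup_add lookup_single)
qed

lemma keys_mvar_mult:
  assumes "m \<in> keys (mvar v * f)"
  shows "expo m v > 0"
  using assms keys_mult[of "mvar v" f] by (auto simp: mvar_def lookup_add lookup_single)

text \<open>A homogeneous polynomial has a lead monomial without \<open>x\<close> if it has any such monomial, and
  the lead monomial is then found modulo \<open>x\<close>.\<close>

lemma leads_y_power:
  assumes "homog d f" "f = py ^ d + px * A"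
  shows "leads f (single Y d) 1"
  unfolding leads_def
proof (intro conjI ballI impI)
  have "single Y d \<notin> keys (px * A)"
    using keys_mvar_mult by (fastforce simp: lookup_single)
  then show "coef f (single Y d) = 1"
    using assms(2) by (simp add: lookup_add py_power_single in_keys_iff)
next
  fix n assume n: "n \<in> keys f" "n \<noteq> single Y d"
  then have "n \<in> keys (px * A)"
    using Poly_Mapping.keys_add[of "py ^ d" "px * A"] assms(2)
    by (auto simp: py_power_single split: if_splits)
  then have "expo n X > 0" by (rule keys_mvar_mult)
  then show "grevlex_less n (single Y d)"
    using n(1) assms(1) by (simp add: homog_def grevlex_xyz tdeg_xyz lookup_single)
qed simp

lemma leads_z_power:
  assumes "homog d f" "f = mconst c * pz ^ d + px * A + py * B" "c \<noteq> 0"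
  shows "leads f (single Z d) c"
  unfolding leads_def
proof (intro conjI ballI impI)
  have "single Z d \<notin> keys (px * A)"
    "single Z d \<notin> keys (py * B)"
    using keys_mvar_mult by (fastforce simp: lookup_single)+
  then show "coef f (single Z d) = c"
    using assms(2) by (simp add: lookup_add pz_power_single in_keys_iff coef_mconst_mult)
next
  fix n assume n: "n \<in> keys f" "n \<noteq> single Z d"
  then have "expo n X > 0 \<or> expo n Y > 0"
    using n(1) assms(1) by (auto simp: homog_def xyz_monomial_eq_iff tdeg_xyz lookup_single)
  then show "grevlex_less n (single Z d)"
    using n(1) assms(1) by (auto simp: homog_def grevlex_xyz tdeg_xyz lookup_single)
qed (rule assms(3))

section \<open>Normal forms and regular sequences\<close>

text \<open>The degree of \<open>b\<^sup>K\<close> without its power of \<open>x\<close>, for generators \<open>b\<close> of the degrees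
  \<open>1, p\<^sup>2, p\<^sup>2 + p, p\<^sup>3 + 1, p\<^sup>4\<close>.\<close>

definition gen_weight :: "nat \<Rightarrow> nat monomial \<Rightarrow> nat" where
  "gen_weight p K = p^2 * expo K 1 + (p^2 + p) * expo K 2 + (p^3 + 1) * expo K 3 + p^4 * expo K 4"

text \<open>The lead monomial of \<open>b\<^sup>K\<close> for generators \<open>b\<close> with the lead monomials
  \<open>x, y\<^bsup>p\<^sup>2\<^esup>, \<dots>\<close>.\<close>

definition gen_LM :: "nat \<Rightarrow> nat monomial \<Rightarrow> xyz monomial" where
  "gen_LM p K = xyz_mono (expo K 0)
     (p^2 * expo K 1 + (p^2 + p) * expo K 2 + (p^3 + 1) * expo K 3) (p^4 * expo K 4)"

text \<open>A linear form on exponent vectors which plays the part of a monomial order; having natural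
  numbers as values, it also is a termination measure. The weight dominates: it drops when a term
  is replaced by one of smaller degree or by one of the same degree with more factors \<open>x\<close>. The last
  two summands decide between the two sides of a tete-a-tete, which have the same weight. The
  factor \<open>p\<^sup>4 + p + 1\<close> exceeds them for all monomials in the relations, whose degree is at most
  \<open>p\<^sup>4 + p\<close>.\<close>

definition gen_order :: "nat \<Rightarrow> nat monomial \<Rightarrow> nat" where
  "gen_order p K = (p^4 + p + 1) * gen_weight p K + expo K 2 + 2 * expo K 3"

lemma gen_LM_add: "gen_LM p (K + L) = gen_LM p K + gen_LM p L"
  by (simp add: gen_LM_def xyz_monomial_eq_iff lookup_add lookup_single algebra_simps)

lemma gen_order_add: "gen_order p (K + L) = gen_order p K + gen_order p L"
  by (simp add: gen_order_def gen_weight_def lookup_add algebra_simps)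

text \<open>A monomial below \<open>y\<^sup>d\<close> has smaller degree than \<open>y\<^sup>d\<close> or contains \<open>x\<close>; in both cases the
  weight is below \<open>d\<close>.\<close>

lemma gen_order_less:
  assumes "grevlex_less (gen_LM p K) (single Y d)" "d \<le> p^4 + p" "p > 0"
  shows "gen_order p K < (p^4 + p + 1) * d"
proof -
  have "expo K 0 + gen_weight p K < d \<or> expo K 0 + gen_weight p K = d \<and> 0 < expo K 0"
    using assms(1) by (auto simp: grevlex_xyz tdeg_xyz gen_LM_def lookup_add lookup_single gen_weight_def)
  then have w: "gen_weight p K < d" by linarith
  have a: "1 * expo K 2 \<le> (p^2 + p) * expo K 2"
    using assms(3) by (intro mult_right_mono) auto
  have "p^3 > 0" using assms(3) by simp
  then have "2 * expo K 3 \<le> (p^3 + 1) * expo K 3"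
    by (intro mult_right_mono) linarith+
  with a have "expo K 2 + 2 * expo K 3 \<le> gen_weight p K"
    unfolding gen_weight_def by linarith
  then have "expo K 2 + 2 * expo K 3 < p^4 + p + 1" using w assms(2) by linarith
  then have "gen_order p K < (p^4 + p + 1) * gen_weight p K + (p^4 + p + 1)"
    by (simp add: gen_order_def)
  also have "\<dots> = (p^4 + p + 1) * Suc (gen_weight p K)"
    by (simp only: mult_Suc_right add.commute)
  also have "\<dots> \<le> (p^4 + p + 1) * d"
    using w by (intro mult_left_mono) auto
  finally show ?thesis .
qed

definition gen_leads :: "nat \<Rightarrow> (nat, 'a::idom) mpoly \<Rightarrow> nat monomial \<Rightarrow> bool" where
  "gen_leads p r L \<longleftrightarrow> coef r L = 1 \<and>
     (\<forall>K\<in>keys r. K \<noteq> L \<longrightarrow> gen_order p K < gen_order p L)"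

definition ideal_in :: "'b::comm_ring_1 set \<Rightarrow> 'b set \<Rightarrow> bool" where
  "ideal_in R J \<longleftrightarrow> 0 \<in> J \<and> (\<forall>f\<in>J. \<forall>g\<in>J. f + g \<in> J) \<and> (\<forall>q\<in>R. \<forall>f\<in>J. q * f \<in> J)"

text \<open>Division with remainder: every monomial outside \<open>G\<close> is a multiple of the top monomial of an
  element of the ideal \<open>J\<close>, and subtracting a multiple of that element replaces the monomial by
  smaller ones.\<close>

lemma normal_form_exists:
  fixes J :: "(nat, 'a::idom) mpoly set"
  assumes J: "ideal_in (mpoly_ring n) J"
    and red: "\<And>K. keys K \<subseteq> {..<n} \<Longrightarrow> K \<notin> G \<Longrightarrow>
       \<exists>r\<in>J \<inter> mpoly_ring n. \<exists>L K'. K = K' + L \<and> gen_leads p r L"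
    and P: "P \<in> mpoly_ring n"
  shows "\<exists>j\<in>J. \<exists>f\<in>mpoly_ring n. keys f \<subseteq> G \<and> P = j + f"
proof -
  define S where "S = {P. \<exists>j\<in>J. \<exists>f\<in>mpoly_ring n. keys f \<subseteq> G \<and> P = j + f}"
  have S_add: "f + g \<in> S" if fg: "f \<in> S" "g \<in> S" for f g
  proof -
    obtain j1 f1 where 1: "j1 \<in> J" "f1 \<in> mpoly_ring n" "keys f1 \<subseteq> G" "f = j1 + f1"
      using fg(1) unfolding S_def by blast
    obtain j2 f2 where 2: "j2 \<in> J" "f2 \<in> mpoly_ring n" "keys f2 \<subseteq> G" "g = j2 + f2"
      using fg(2) unfolding S_def by blast
    have "j1 + j2 \<in> J" using J 1 2 unfolding ideal_in_def by blast
    moreover have "f1 + f2 \<in> mpoly_ring n" using 1 2 mpoly_ring_add by blast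
    moreover have "keys (f1 + f2) \<subseteq> G"
      using 1 2 Poly_Mapping.keys_add[of f1 f2] by blast
    moreover have "f + g = (j1 + j2) + (f1 + f2)" using 1 2 by simp
    ultimately show ?thesis unfolding S_def by blast
  qed
  have S_J: "j \<in> S" if "j \<in> J" for j
    using that mpoly_ring_0[of n] unfolding S_def by force
  have S_0: "0 \<in> S" using S_J J by (simp add: ideal_in_def)
  have S_sum: "sum f I \<in> S" if "\<And>i. i \<in> I \<Longrightarrow> f i \<in> S" for f and I :: "nat monomial set"
    using that by (induction I rule: infinite_finite_induct) (auto simp: S_0 S_add)
  have single: "single K c \<in> S" if "keys K \<subseteq> {..<n}" for K c
    using that
  proof (induction "gen_order p K" arbitrary: K c rule: less_induct)
    case less
    show ?case
    proof (cases "K \<in> G")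
      case True
      have "0 \<in> J" using J by (simp add: ideal_in_def)
      moreover have "single K c \<in> mpoly_ring n"
        by (rule mpoly_ring_single[OF less.prems])
      moreover have "keys (single K c) \<subseteq> G" using True by simp
      moreover have "single K c = 0 + single K c" by simp
      ultimately show ?thesis unfolding S_def by blast
    next
      case False
      then obtain r L K' where r: "r \<in> J" "r \<in> mpoly_ring n" "K = K' + L" "gen_leads p r L"
        using red less.prems by blast
      define t where "t = r - single L 1"
      have K': "keys K' \<subseteq> {..<n}"
        using less.prems r(3) by (auto simp: in_keys_iff lookup_add subset_iff)
      let ?u = "single K' (- c) * t"
      have lower: "keys N \<subseteq> {..<n} \<and> gen_order p N < gen_order p K"
        if N: "N \<in> keys ?u" for N
      proof -
        obtain a where a: "N = K' + a" "a \<in> keys t"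
          using subsetD[OF keys_mult N] by (auto split: if_splits)
        then have "a \<in> keys r" "a \<noteq> L"
          using r(4) by (auto simp: t_def gen_leads_def in_keys_iff lookup_minus lookup_single
              when_def split: if_splits)
        then have "gen_order p a < gen_order p L" "keys a \<subseteq> {..<n}"
          using r by (auto simp: gen_leads_def mpoly_ring_def)
        then show ?thesis
          using a r(3) K' Poly_Mapping.keys_add[of K' a] by (auto simp: gen_order_add)
      qed
      have "?u = (\<Sum>N\<in>keys ?u. single N (coef ?u N))"
        by (rule poly_mapping_sum_singles)
      moreover have "\<dots> \<in> S"
        using lower less.hyps by (intro S_sum) blast
      ultimately have "?u \<in> S" by metis
      moreover have "single K' c * r \<in> S"
        using J r(1) K' by (intro S_J) (auto simp: ideal_in_def mpoly_ring_single)
      moreover have "single K c = single K' c * r + ?u"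
        by (simp add: t_def algebra_simps mult_single r(3) single_uminus)
      ultimately show ?thesis using S_add by metis
    qed
  qed
  have "(\<Sum>m\<in>keys P. single m (coef P m)) \<in> S"
    using P single by (intro S_sum) (auto simp: mpoly_ring_def)
  then have "P \<in> S" unfolding poly_mapping_sum_singles[of P, symmetric] .
  then show ?thesis unfolding S_def by blast
qed

lemma ideal_gen_1: "ideal_gen R [r] = {q * r | q. q \<in> R}" for r :: "'a::comm_ring_1"
proof -
  have "(\<exists>q :: nat \<Rightarrow> 'a. x = q 0 * r \<and> q 0 \<in> R) \<longleftrightarrow> (\<exists>q. x = q * r \<and> q \<in> R)" for x
  proof
    assume "\<exists>q. x = q * r \<and> q \<in> R"
    then obtain q where "x = q * r \<and> q \<in> R" by blast
    then show "\<exists>q :: nat \<Rightarrow> 'a. x = q 0 * r \<and> q 0 \<in> R"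
      by (rule exI[of "\<lambda>q. x = q 0 * r \<and> q 0 \<in> R" "\<lambda>_ :: nat. q"])
  qed blast
  then show ?thesis by (simp add: ideal_gen_def)
qed

lemma ideal_gen_2: "ideal_gen R [r, s] = {q * r + q' * s | q q'. q \<in> R \<and> q' \<in> R}"
proof
  show "ideal_gen R [r, s] \<subseteq> {q * r + q' * s | q q'. q \<in> R \<and> q' \<in> R}"
  proof
    fix x assume "x \<in> ideal_gen R [r, s]"
    then obtain q where "\<forall>i<2. q i \<in> R" "x = (\<Sum>i<2. q i * [r, s] ! i)"
      by (auto simp: ideal_gen_def numeral_2_eq_2)
    then have "x = q 0 * r + q 1 * s" "q 0 \<in> R" "q 1 \<in> R"
      by (auto simp: numeral_2_eq_2)
    then show "x \<in> {q * r + q' * s | q q'. q \<in> R \<and> q' \<in> R}" by blast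
  qed
  have "q * r + q' * s \<in> ideal_gen R [r, s]" if "q \<in> R" "q' \<in> R" for q q'
    using that unfolding ideal_gen_def
    by (intro CollectI exI[of _ "\<lambda>i. if i = 0 then q else q'"]) (auto simp: less_Suc_eq)
  then show "{q * r + q' * s | q q'. q \<in> R \<and> q' \<in> R} \<subseteq> ideal_gen R [r, s]" by blast
qed

lemma ideal_in_ideal_gen:
  fixes rs :: "(nat, 'a::idom) mpoly list"
  shows "ideal_in (mpoly_ring n) (ideal_gen (mpoly_ring n) rs)"
  unfolding ideal_in_def
proof (intro conjI ballI)
  show "0 \<in> ideal_gen (mpoly_ring n) rs"
    unfolding ideal_gen_def by (intro CollectI exI[of _ "\<lambda>_. 0"]) (simp add: mpoly_ring_0)
next
  fix f g assume "f \<in> ideal_gen (mpoly_ring n) rs" "g \<in> ideal_gen (mpoly_ring n) rs"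
  then obtain q q' where "f = (\<Sum>i<length rs. q i * rs ! i)" "g = (\<Sum>i<length rs. q' i * rs ! i)"
    "\<forall>i<length rs. q i \<in> mpoly_ring n" "\<forall>i<length rs. q' i \<in> mpoly_ring n"
    unfolding ideal_gen_def by blast
  then show "f + g \<in> ideal_gen (mpoly_ring n) rs"
    unfolding ideal_gen_def by (intro CollectI exI[of _ "\<lambda>i. q i + q' i"])
      (simp add: distrib_right sum.distrib mpoly_ring_add)
next
  fix a f :: "(nat, 'a) mpoly" assume a: "a \<in> mpoly_ring n" and "f \<in> ideal_gen (mpoly_ring n) rs"
  then obtain q where "f = (\<Sum>i<length rs. q i * rs ! i)" "\<forall>i<length rs. q i \<in> mpoly_ring n"
    unfolding ideal_gen_def by blast
  then show "a * f \<in> ideal_gen (mpoly_ring n) rs"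
    unfolding ideal_gen_def using a by (intro CollectI exI[of _ "\<lambda>i. a * q i"])
      (simp add: sum_distrib_left mult.assoc mpoly_ring_mult)
qed

lemma keys_add_subset:
  "keys K \<subseteq> S \<Longrightarrow> keys L \<subseteq> S \<Longrightarrow> keys (K + L) \<subseteq> S"
  for K L :: "nat monomial"
  using Poly_Mapping.keys_add[of K L] by blast

lemma keys_single_subset: "i \<in> S \<Longrightarrow> keys (single i c) \<subseteq> S"
  by simp

lemma exponent_split: "\<exists>K'. K = K' + single v n" if "n \<le> expo K v"
  for K :: "nat monomial"
proof -
  have "K = (K - single v n) + single v n"
    by (rule poly_mapping_eqI) (use that in \<open>auto simp: lookup_add lookup_minus lookup_single when_def\<close>)
  then show ?thesis by blast
qed

lemma gen_leads_nonzero: "gen_leads p r L \<Longrightarrow> r \<noteq> 0"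
  by (auto simp: gen_leads_def)

text \<open>The top part of a product is the product of the top parts: for a single top monomial \<open>L\<close>
  of \<open>r\<close>, nothing can cancel \<open>L + K\<close> when \<open>K\<close> is a top monomial of \<open>f\<close>.\<close>

lemma gen_leads_mult_key:
  fixes r f :: "(nat, 'a::idom) mpoly"
  assumes r: "gen_leads p r L" and K: "K \<in> keys f"
    and max: "\<And>N. N \<in> keys f \<Longrightarrow> gen_order p N \<le> gen_order p K"
  shows "L + K \<in> keys (r * f)"
proof -
  define t where "t = r - single L 1"
  have "L + K \<notin> keys (t * f)"
  proof
    assume "L + K \<in> keys (t * f)"
    then obtain a b where ab: "L + K = a + b" "a \<in> keys t" "b \<in> keys f"
      using subsetD[OF keys_mult] by blast
    then have "a \<in> keys r" "a \<noteq> L"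
      using r by (auto simp: t_def gen_leads_def in_keys_iff lookup_minus lookup_single
          when_def split: if_splits)
    then have "gen_order p a < gen_order p L"
      using r by (auto simp: gen_leads_def)
    moreover have "gen_order p a + gen_order p b = gen_order p L + gen_order p K"
      using ab(1) by (metis gen_order_add)
    ultimately show False using max[OF ab(3)] by linarith
  qed
  moreover have "r * f = single L 1 * f + t * f"
    by (simp add: t_def algebra_simps)
  ultimately show ?thesis
    using K by (simp add: in_keys_iff lookup_add coef_single_mult)
qed

lemma gen_order_max_key:
  fixes f :: "(nat, 'a::idom) mpoly"
  assumes "f \<noteq> 0"
  obtains K where "K \<in> keys f"
    "\<And>N. N \<in> keys f \<Longrightarrow> gen_order p N \<le> gen_order p K"
proof -
  let ?S = "gen_order p ` keys f"
  have fin: "finite ?S" "?S \<noteq> {}" using assms by simp_all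
  then obtain K where "K \<in> keys f" "gen_order p K = Max ?S"
    using Max_in[OF fin] by (metis imageE)
  then show thesis using that[of K] Max_ge[OF fin(1)] by auto
qed

text \<open>The lead monomials of the two relations are coprime. If \<open>s q\<close> is a multiple of \<open>r\<close>, then so is
  \<open>s f\<close> for the remainder \<open>f\<close> of \<open>q\<close> modulo \<open>r\<close>; but the top monomials of \<open>s f\<close> are not divisible
  by the one of \<open>r\<close>, unless \<open>f = 0\<close>.\<close>

lemma regular_sequence_coprime_leads:
  fixes r s :: "(nat, 'a::idom) mpoly"
  assumes r: "r \<in> mpoly_ring n" "gen_leads p r (single u d)"
    and s: "s \<in> mpoly_ring n" "gen_leads p s (single v e)"
    and uv: "u \<noteq> v"
    and proper: "1 \<notin> ideal_gen (mpoly_ring n) [r, s]"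
  shows "regular_sequence (mpoly_ring n) [r, s]"
proof -
  have second: "q \<in> ideal_gen (mpoly_ring n) [r]"
    if q: "q \<in> mpoly_ring n" "s * q \<in> ideal_gen (mpoly_ring n) [r]" for q
  proof -
    have "r \<in> ideal_gen (mpoly_ring n) [r]"
      unfolding ideal_gen_1 using mpoly_ring_1[of n] by force
    then have "\<exists>r'\<in>ideal_gen (mpoly_ring n) [r] \<inter> mpoly_ring n. \<exists>L K'. K = K' + L \<and> gen_leads p r' L"
      if "K \<notin> {K. expo K u < d}" for K
      using r exponent_split[of d K u] that by (auto simp: not_less)
    then obtain j f where jf: "j \<in> ideal_gen (mpoly_ring n) [r]" "f \<in> mpoly_ring n"
      "keys f \<subseteq> {K. expo K u < d}" "q = j + f"
      using normal_form_exists[OF ideal_in_ideal_gen _ q(1), of "{K. expo K u < d}" "[r]" p] by blast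
    obtain a j' where a: "s * q = a * r" and j': "j = j' * r"
      using q(2) jf(1) unfolding ideal_gen_1 by blast
    have eq: "s * f = r * (a - s * j')"
      using a jf(4) j' by (simp add: algebra_simps)
    have "f = 0"
    proof (rule ccontr)
      assume f: "f \<noteq> 0"
      obtain K where K: "K \<in> keys f"
        "\<And>N. N \<in> keys f \<Longrightarrow> gen_order p N \<le> gen_order p K"
        by (rule gen_order_max_key[OF f, of p]) blast
      have "a - s * j' \<noteq> 0"
        using eq f gen_leads_nonzero[OF s(2)] by auto
      then obtain N where N: "N \<in> keys (a - s * j')"
        "\<And>N'. N' \<in> keys (a - s * j') \<Longrightarrow> gen_order p N' \<le> gen_order p N"
        by (rule gen_order_max_key[of _ p]) blast
      have 1: "single v e + K \<in> keys (r * (a - s * j'))"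
        using gen_leads_mult_key[OF s(2) K] eq by simp
      have 2: "single u d + N \<in> keys (s * f)"
        using gen_leads_mult_key[OF r(2) N] eq by simp
      have bound_r: "gen_order p a' \<le> gen_order p (single u d)"
        if "a' \<in> keys r" for a'
        using r(2) that by (cases "a' = single u d") (auto simp: gen_leads_def less_imp_le)
      have bound_s: "gen_order p a' < gen_order p (single v e)"
        if "a' \<in> keys s" "a' \<noteq> single v e" for a'
        using s(2) that by (auto simp: gen_leads_def)
      obtain a1 b1 where 3: "single v e + K = a1 + b1" "a1 \<in> keys r"
        "b1 \<in> keys (a - s * j')"
        using subsetD[OF keys_mult 1] by blast
      obtain a2 b2 where 4: "single u d + N = a2 + b2" "a2 \<in> keys s"
        "b2 \<in> keys f"
        using subsetD[OF keys_mult 2] by blast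
      have le1: "gen_order p (single v e) + gen_order p K
          \<le> gen_order p (single u d) + gen_order p N"
        using 3 bound_r[of a1] N(2)[of b1] by (metis add_mono gen_order_add)
      have "a2 = single v e"
      proof (rule ccontr)
        assume "a2 \<noteq> single v e"
        then have "gen_order p a2 < gen_order p (single v e)"
          using bound_s 4(2) by blast
        moreover have "gen_order p (single u d) + gen_order p N = gen_order p a2 + gen_order p b2"
          using 4(1) by (metis gen_order_add)
        ultimately show False using le1 K(2)[OF 4(3)] by linarith
      qed
      then have "expo (single u d + N) u = expo b2 u"
        using 4(1) uv by (simp add: lookup_add lookup_single)
      then show False using jf(3) 4(3) by (auto simp: lookup_add)
    qed
    then show ?thesis using jf by simp
  qed
  have first: "q \<in> ideal_gen (mpoly_ring n) []" if "r * q \<in> ideal_gen (mpoly_ring n) []" for q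
    using that gen_leads_nonzero[OF r(2)] by (auto simp: ideal_gen_def)
  have "ideal_gen (mpoly_ring n) [r, s] \<noteq> mpoly_ring n"
    using proper mpoly_ring_1 by metis
  then show ?thesis
    unfolding regular_sequence_def using r(1) s(1) first second
    by (auto simp: less_Suc_eq)
qed

section \<open>Five generators with given lead monomials\<close>

text \<open>The remainders modulo two relations with the top monomials \<open>t\<^sub>2\<^bsup>p\<^esup>\<close> and \<open>t\<^sub>3\<^bsup>p\<^esup>\<close> are the
  combinations of these monomials.\<close>

definition nf_monomials :: "nat \<Rightarrow> nat monomial set" where
  "nf_monomials p = {K. keys K \<subseteq> {..<5} \<and> expo K 2 < p \<and> expo K 3 < p}"

lemma nat_monomial_eqI:
  fixes K L :: "nat monomial"
  assumes "keys K \<subseteq> {..<5}" "keys L \<subseteq> {..<5}"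
    and "expo K 0 = expo L 0" "expo K 1 = expo L 1" "expo K 2 = expo L 2"
      "expo K 3 = expo L 3" "expo K 4 = expo L 4"
  shows "K = L"
proof (rule poly_mapping_eqI)
  fix i
  show "expo K i = expo L i"
  proof (cases "i < 5")
    case True
    then have "i = 0 \<or> i = 1 \<or> i = 2 \<or> i = 3 \<or> i = 4" by auto
    then show ?thesis using assms by auto
  next
    case False
    then have "i \<notin> keys K" "i \<notin> keys L" using assms(1,2) by auto
    then show ?thesis by (simp add: in_keys_iff)
  qed
qed

text \<open>The exponent of \<open>y\<close> determines the exponents of a normal monomial, like digits to the
  base \<open>p\<close>.\<close>

lemma gen_LM_inj:
  assumes "p > 0"
  shows "inj_on (gen_LM p) (nf_monomials p)"
proof (rule inj_onI)
  fix K L assume K: "K \<in> nf_monomials p" and L: "L \<in> nf_monomials p" and eq: "gen_LM p K = gen_LM p L"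
  have digits: "p^2 * a + (p^2 + p) * b + (p^3 + 1) * c = p * (p * (a + b + p * c) + b) + c" for a b c
    by (simp add: power2_eq_square power3_eq_cube algebra_simps)
  have e: "expo K 0 = expo L 0" "p^4 * expo K 4 = p^4 * expo L 4"
    "p * (p * (expo K 1 + expo K 2 + p * expo K 3) + expo K 2) + expo K 3 =
     p * (p * (expo L 1 + expo L 2 + p * expo L 3) + expo L 2) + expo L 3"
    using eq unfolding xyz_monomial_eq_iff gen_LM_def expo_xyz_mono digits by auto
  have digit: "u = u' \<and> d = d'" if "p * u + d = p * u' + d'" "d < p" "d' < p" for u d u' d'
  proof -
    have "(p * u + d) div p = u" "(p * u' + d') div p = u'" using that(2,3) by auto
    then show ?thesis using that(1) by auto
  qed
  have "expo K 3 = expo L 3"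
    "p * (expo K 1 + expo K 2 + p * expo K 3) + expo K 2 = p * (expo L 1 + expo L 2 + p * expo L 3) + expo L 2"
    using digit[OF e(3)] K L by (auto simp: nf_monomials_def)
  moreover from this have "expo K 2 = expo L 2"
    "expo K 1 + expo K 2 + p * expo K 3 = expo L 1 + expo L 2 + p * expo L 3"
    using digit[of "expo K 1 + expo K 2 + p * expo K 3" "expo K 2" "expo L 1 + expo L 2 + p * expo L 3"
        "expo L 2"] K L by (auto simp: nf_monomials_def)
  ultimately have "expo K 3 = expo L 3" "expo K 2 = expo L 2" "expo K 1 = expo L 1" by auto
  then show "K = L"
    using e(1,2) K L assms by (intro nat_monomial_eqI) (auto simp: nf_monomials_def)
qed

locale five_generators =
  fixes p :: nat and bs :: "'a::field pol list"
  assumes p: "p > 2" and length_bs: "length bs = 5"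
    and bs_leads: "\<And>i. i < 5 \<Longrightarrow> leads (bs ! i) (gen_LM p (single i 1)) 1"
begin

abbreviation "eval \<equiv> msubst ((!) bs)"
abbreviation "bpow \<equiv> mprod ((!) bs)"
abbreviation "R \<equiv> (mpoly_ring 5 :: (nat, 'a) mpoly set)"

lemma mprod_leads:
  assumes "keys K \<subseteq> {..<5}"
  shows "leads (bpow K) (gen_LM p K) 1"
  using assms
proof (induction "\<Sum>i<5. expo K i" arbitrary: K rule: less_induct)
  case less
  show ?case
  proof (cases "K = 0")
    case True
    have "gen_LM p 0 = 0" by (simp add: gen_LM_def)
    then show ?thesis using leads_mconst[of "1 :: 'a"] by (simp add: True)
  next
    case False
    then have "keys K \<noteq> {}" by simp
    then obtain v where v: "v \<in> keys K" by blast
    then obtain K' where K': "K = K' + single v 1"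
      using exponent_split[of 1 K v] by (auto simp: in_keys_iff)
    have v5: "v < 5" using v less.prems by auto
    have "(\<Sum>i<5. expo K' i) < (\<Sum>i<5. expo K i)"
      using v5 by (simp add: K' lookup_add sum.distrib lookup_single when_def)
    moreover have "keys K' \<subseteq> {..<5}"
      using less.prems by (auto simp: K' in_keys_iff lookup_add subset_iff)
    ultimately have "leads (bpow K') (gen_LM p K') 1" using less.hyps by blast
    from leads_mult[OF this bs_leads[OF v5]] show ?thesis
      by (simp add: K' mprod_add gen_LM_add)
  qed
qed

lemma term_leads:
  "keys K \<subseteq> {..<5} \<Longrightarrow> c \<noteq> 0 \<Longrightarrow> leads (mconst c * bpow K) (gen_LM p K) c"
  using leads_mconst_mult[OF mprod_leads, of K c] by simp

text \<open>This contains the linear independence of the values of the normal monomials.\<close>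

lemma eval_nf_leads:
  assumes "keys f \<subseteq> nf_monomials p" "f \<noteq> 0"
  obtains K where "K \<in> keys f" "leads (eval f) (gen_LM p K) (coef f K)"
proof -
  have inj: "inj_on (gen_LM p) (keys f)"
    by (rule inj_on_subset[OF gen_LM_inj assms(1)]) (use p in simp)
  have "leads (mconst (coef f K) * bpow K) (gen_LM p K) (coef f K)"
    if "K \<in> keys f" for K
    using that assms(1) by (intro term_leads) (auto simp: nf_monomials_def in_keys_iff)
  from leads_sum_distinct[OF finite_keys _ inj this] assms(2) that
  show thesis by (auto simp: msubst_def)
qed

lemma normal_form:
  assumes r: "r \<in> R" "gen_leads p r (single 2 p)"
    and s: "s \<in> R" "gen_leads p s (single 3 p)" and P: "P \<in> R"
  obtains j f where "j \<in> ideal_gen R [r, s]" "f \<in> R" "keys f \<subseteq> nf_monomials p" "P = j + f"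
proof -
  have in_ideal: "r \<in> ideal_gen R [r, s]" "s \<in> ideal_gen R [r, s]"
    unfolding ideal_gen_2
    using mpoly_ring_0 mpoly_ring_1 by (force intro: exI[of _ 0] exI[of _ 1])+
  have "\<exists>r'\<in>ideal_gen R [r, s] \<inter> R. \<exists>L K'. K = K' + L \<and> gen_leads p r' L"
    if K: "keys K \<subseteq> {..<5}" "K \<notin> nf_monomials p" for K
  proof -
    consider "p \<le> expo K 2" | "p \<le> expo K 3" using K by (force simp: nf_monomials_def)
    then show ?thesis
      by cases (use in_ideal r s exponent_split in blast)+
  qed
  from normal_form_exists[OF ideal_in_ideal_gen this P] that show thesis by blast
qed

lemma eval_ideal:
  assumes "eval r = 0" "eval s = 0" "j \<in> ideal_gen R [r, s]"
  shows "eval j = 0"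
  using assms by (auto simp: ideal_gen_2 msubst_hom)

text \<open>The remainder of a relation modulo \<open>r\<close> and \<open>s\<close> is a normal form with value \<open>0\<close>, so it is
  \<open>0\<close>.\<close>

lemma relation_ideal_eq:
  assumes r: "r \<in> R" "gen_leads p r (single 2 p)" "eval r = 0"
    and s: "s \<in> R" "gen_leads p s (single 3 p)" "eval s = 0"
  shows "relation_ideal bs = ideal_gen R [r, s]"
proof
  show "relation_ideal bs \<subseteq> ideal_gen R [r, s]"
  proof
    fix P assume "P \<in> relation_ideal bs"
    then have P: "P \<in> R" "eval P = 0" by (auto simp: relation_ideal_def length_bs)
    obtain j f where jf: "j \<in> ideal_gen R [r, s]" "f \<in> R"
      "keys f \<subseteq> nf_monomials p" "P = j + f"
      by (rule normal_form[OF r(1,2) s(1,2) P(1)])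
    have "eval f = 0" using P(2) jf(4) eval_ideal[OF r(3) s(3) jf(1)] by (simp add: msubst_add)
    then have "f = 0" using eval_nf_leads[OF jf(3)] leads_nonzero by blast
    then show "P \<in> ideal_gen R [r, s]" using jf by simp
  qed
  show "ideal_gen R [r, s] \<subseteq> relation_ideal bs"
  proof
    fix j assume j: "j \<in> ideal_gen R [r, s]"
    then have "j \<in> R"
      using r(1) s(1) by (auto simp: ideal_gen_2 intro!: mpoly_ring_add mpoly_ring_mult)
    then show "j \<in> relation_ideal bs"
      using eval_ideal[OF r(3) s(3) j] by (simp add: relation_ideal_def length_bs)
  qed
qed

lemma relations_regular:
  assumes r: "r \<in> R" "gen_leads p r (single 2 p)" "eval r = 0"
    and s: "s \<in> R" "gen_leads p s (single 3 p)" "eval s = 0"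
  shows "regular_sequence R [r, s]"
proof (rule regular_sequence_coprime_leads[OF r(1,2) s(1,2)])
  show "1 \<notin> ideal_gen R [r, s]" using eval_ideal[OF r(3) s(3), of 1] by auto
qed simp

text \<open>The part without \<open>x\<close> of a normal form has a lead monomial without \<open>x\<close>, if it is not \<open>0\<close>; so it
  is \<open>0\<close> if the value is divisible by \<open>x\<close>.\<close>

lemma divide_by_x:
  assumes r: "r \<in> R" "gen_leads p r (single 2 p)" "eval r = 0"
    and s: "s \<in> R" "gen_leads p s (single 3 p)" "eval s = 0"
    and px: "bs ! 0 = px" and g: "px * g \<in> eval ` R"
  shows "g \<in> eval ` R"
proof -
  obtain P where P: "P \<in> R" "eval P = px * g" using g by auto
  obtain j f where jf: "j \<in> ideal_gen R [r, s]" "f \<in> R"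
    "keys f \<subseteq> nf_monomials p" "P = j + f"
    by (rule normal_form[OF r(1,2) s(1,2) P(1)])
  have f: "eval f = px * g"
    using P(2) jf(4) eval_ideal[OF r(3) s(3) jf(1)] by (simp add: msubst_add)
  let ?K0 = "{K\<in>keys f. expo K 0 = 0}" and ?K1 = "{K\<in>keys f. expo K 0 \<noteq> 0}"
  let ?one = "single (0::nat) (1::nat)"
  \<comment> \<open>\<open>f0\<close> collects the terms of \<open>f\<close> without the first variable; the others are \<open>mvar 0 * f1\<close>.\<close>
  define f0 where "f0 = (\<Sum>K\<in>?K0. single K (coef f K))"
  define f1 where "f1 = (\<Sum>K\<in>?K1.
      single (K - ?one) (coef f K))"
  have shift: "?one + (K - ?one) = K" if "expo K 0 \<noteq> 0" for K :: "nat monomial"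
    by (rule poly_mapping_eqI) (use that in \<open>auto simp: lookup_add lookup_minus lookup_single when_def\<close>)
  have "mvar 0 * f1 = (\<Sum>K\<in>?K1. single K (coef f K))"
    unfolding f1_def sum_distrib_left mvar_def
    by (intro sum.cong) (use shift in \<open>auto simp: mult_single\<close>)
  moreover have "(\<Sum>K\<in>?K0. single K (coef f K)) +
      (\<Sum>K\<in>?K1. single K (coef f K)) =
      (\<Sum>K\<in>keys f. single K (coef f K))"
    by (subst sum.union_disjoint[symmetric]) (auto intro!: sum.cong)
  ultimately have split: "f = f0 + mvar 0 * f1"
    unfolding f0_def poly_mapping_sum_singles[of f, symmetric] by simp
  have f1: "f1 \<in> R"
    unfolding mpoly_ring_def
  proof (intro CollectI ballI)
    fix m assume "m \<in> keys f1"
    then obtain K where "K \<in> keys f" "m = K - ?one"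
      using subsetD[OF keys_sum] unfolding f1_def by (fastforce split: if_splits)
    then show "keys m \<subseteq> {..<5}"
      using jf(2) by (auto simp: mpoly_ring_def in_keys_iff lookup_minus subset_iff)
  qed
  have keys_f0: "K \<in> keys f \<and> expo K 0 = 0" if "K \<in> keys f0" for K
    using subsetD[OF keys_sum that[unfolded f0_def]] by (auto split: if_splits)
  have ev: "eval f0 = px * (g - eval f1)"
    using f px by (simp add: split msubst_add msubst_mult algebra_simps)
  have "f0 = 0"
  proof (rule ccontr)
    assume "f0 \<noteq> 0"
    then obtain K where K: "K \<in> keys f0" "leads (eval f0) (gen_LM p K) (coef f0 K)"
      using eval_nf_leads[of f0] keys_f0 jf(3) by blast
    then have "gen_LM p K \<in> keys (px * (g - eval f1))"
      by (auto simp: ev leads_def in_keys_iff)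
    then have "expo (gen_LM p K) X > 0" by (rule keys_mvar_mult)
    then show False using keys_f0[OF K(1)] unfolding gen_LM_def expo_xyz_mono by simp
  qed
  then have "px * (g - eval f1) = 0" using ev by simp
  moreover have "px \<noteq> (0 :: 'a pol)" using bs_leads[of 0] px leads_nonzero by force
  ultimately have "g = eval f1" by simp
  then show ?thesis using f1 by blast
qed

lemma image_leads:
  assumes r: "r \<in> R" "gen_leads p r (single 2 p)" "eval r = 0"
    and s: "s \<in> R" "gen_leads p s (single 3 p)" "eval s = 0"
    and f: "f \<in> eval ` R" "f \<noteq> 0"
  shows "\<exists>K. keys K \<subseteq> {..<5} \<and> LM f = gen_LM p K"
proof -
  obtain P where P: "P \<in> R" "f = eval P" using f by auto
  obtain j g where jg: "j \<in> ideal_gen R [r, s]" "g \<in> R"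
    "keys g \<subseteq> nf_monomials p" "P = j + g"
    by (rule normal_form[OF r(1,2) s(1,2) P(1)])
  have "f = eval g" using P(2) jg(4) eval_ideal[OF r(3) s(3) jg(1)] by (simp add: msubst_add)
  then have "g \<noteq> 0" using f(2) by auto
  then obtain K where K: "K \<in> keys g" "leads (eval g) (gen_LM p K) (coef g K)"
    by (rule eval_nf_leads[OF jg(3)])
  have "LM f = gen_LM p K" using leads_LM[OF K(2)] \<open>f = eval g\<close> by simp
  moreover have "keys K \<subseteq> {..<5}"
    using K(1) jg(3) by (auto simp: nf_monomials_def)
  ultimately show ?thesis by blast
qed

end

section \<open>From lead monomials to SAGBI bases and presentations\<close>

lemma sum_in_hull:
  assumes "finite S" "\<And>m. m \<in> S \<Longrightarrow> single m 1 \<in> H" "subalgebra H"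
  shows "(\<Sum>m\<in>S. single m (c m)) \<in> H"
proof (rule subalgebra_sum[OF assms(3)])
  fix m assume "m \<in> S"
  then have "mconst (c m) * single m 1 \<in> H"
    using assms by (intro subalgebra_closed) auto
  then show "single m (c m) \<in> H" by (simp add: mconst_def mult_single)
qed

lemma subalgebra_hull: "subalgebra (subalgebra hull S)"
proof -
  have *: "subalgebra (\<Inter>T)" if "\<And>t. t \<in> T \<Longrightarrow> subalgebra t" for T :: "('a, 'b) mpoly set set"
    using that by (simp add: subalgebra_def)
  show ?thesis unfolding hull_def by (rule *) simp
qed

lemma subalgebra_support:
  fixes G :: "'v monomial set"
  assumes "0 \<in> G" "\<And>m n. m \<in> G \<Longrightarrow> n \<in> G \<Longrightarrow> m + n \<in> G"
  shows "subalgebra {f :: ('v, 'a::comm_ring_1) mpoly. keys f \<subseteq> G}"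
  unfolding subalgebra_def
proof (intro conjI allI ballI)
  show "mconst c \<in> {f :: ('v, 'a) mpoly. keys f \<subseteq> G}" for c
    using assms(1) by (simp add: mconst_def)
  fix f g :: "('v, 'a) mpoly"
  assume f: "f \<in> {f. keys f \<subseteq> G}" and g: "g \<in> {f. keys f \<subseteq> G}"
  show "f + g \<in> {f. keys f \<subseteq> G}"
    using f g Poly_Mapping.keys_add[of f g] by blast
  show "f * g \<in> {f. keys f \<subseteq> G}"
  proof (intro CollectI subsetI)
    fix m assume "m \<in> keys (f * g)"
    then obtain a b where "m = a + b" "a \<in> keys f" "b \<in> keys g"
      using subsetD[OF keys_mult] by blast
    then show "m \<in> G" using f g assms(2) by auto
  qed
qed

lemma mconst_module: "Modules.module (\<lambda>c f :: ('v, 'a::comm_ring_1) mpoly. mconst c * f)"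
  by unfold_locales (simp_all add: distrib_left distrib_right mconst_add mconst_mult mult.assoc)

lemma lin_span_monomials:
  "lin_span {single m (1::'a::comm_ring_1) | m. m \<in> G} = {f. keys f \<subseteq> G}"
  (is "_ = ?V")
proof -
  interpret M: Modules.module "\<lambda>c f :: ('b, 'a) mpoly. mconst c * f" by (rule mconst_module)
  let ?T = "{single m (1::'a) | m. m \<in> G}"
  have "M.span ?T = ?V"
  proof
    show "M.span ?T \<subseteq> ?V"
    proof (rule M.span_minimal)
      have "keys (x + y) \<subseteq> G"
        if "keys x \<subseteq> G" "keys y \<subseteq> G" for x y :: "('b, 'a) mpoly"
        using that Poly_Mapping.keys_add[of x y] by blast
      moreover have "keys (mconst c * x) \<subseteq> G"
        if "keys x \<subseteq> G" for c and x :: "('b, 'a) mpoly"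
        using that by (force simp: in_keys_iff coef_mconst_mult)
      ultimately show "M.subspace ?V" unfolding M.subspace_def by auto
    qed (auto split: if_splits)
    show "?V \<subseteq> M.span ?T"
    proof
      fix f :: "('b, 'a) mpoly" assume f: "f \<in> ?V"
      have "single m (coef f m) \<in> M.span ?T" if "m \<in> keys f" for m
      proof -
        have "mconst (coef f m) * single m 1 \<in> M.span ?T"
          using f that by (intro M.span_scale M.span_base) auto
        then show ?thesis by (simp add: mconst_def mult_single)
      qed
      then have "(\<Sum>m\<in>keys f. single m (coef f m)) \<in> M.span ?T"
        by (intro M.span_sum)
      then show "f \<in> M.span ?T" unfolding poly_mapping_sum_singles[of f, symmetric] .
    qed
  qed
  then show ?thesis unfolding lin_span_def .
qed

context five_generators
begin

definition gen_monoid :: "xyz monomial set" where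
  "gen_monoid = gen_LM p ` {K. keys K \<subseteq> {..<5}}"

lemma set_bs: "set bs = {bs ! i | i. i < 5}"
  by (simp add: set_conv_nth length_bs)

lemma bs_nonzero: "0 \<notin> set bs"
proof
  assume "0 \<in> set bs"
  then obtain i where "i < 5" "bs ! i = 0" unfolding set_bs by auto
  then show False using leads_nonzero[OF bs_leads] by blast
qed

lemma monomials_in_hull:
  assumes "m \<in> gen_monoid"
  shows "single m 1 \<in> subalgebra hull (lead_monomials (set bs))"
proof -
  obtain K where K: "keys K \<subseteq> {..<5}" "m = gen_LM p K"
    using assms by (auto simp: gen_monoid_def)
  let ?H = "subalgebra hull (lead_monomials (set bs))"
  let ?s = "\<lambda>i. single (gen_LM p (single i 1)) (1::'a)"
  have s: "?s i \<in> ?H" if "i < 5" for i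
  proof -
    have "?s i \<in> lead_monomials (set bs)"
      unfolding lead_monomials_def using leads_LM[OF bs_leads[OF that]] leads_nonzero[OF bs_leads[OF that]] that
      by (auto simp: set_bs intro!: exI[of _ "bs ! i"])
    then show ?thesis by (rule hull_inc)
  qed
  have 1: "mprod ?s K \<in> ?H"
    using K(1) s by (intro subalgebra_mprod subalgebra_hull) auto
  \<comment> \<open>The lead monomials themselves are generators with these lead monomials.\<close>
  interpret S: five_generators p "map ?s [0..<5]"
    by unfold_locales (use p in \<open>auto simp: leads_single\<close>)
  have "mprod ?s K = mprod ((!) (map ?s [0..<5])) K"
    unfolding mprod_def by (rule prod.cong) (use K(1) in \<open>auto simp: subset_iff\<close>)
  then have "leads (mprod ?s K) m 1" using S.mprod_leads[OF K(1)] K(2) by simp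
  moreover have "\<exists>n. mprod ?s K = single n 1"
    using finite_keys[of K] unfolding mprod_def
  proof (induction rule: finite_induct)
    case empty
    show ?case by (auto intro!: exI[of _ 0])
  next
    case (insert i T)
    have "\<exists>n. ?s i ^ e = single n 1" for e
    proof (induction e)
      case 0
      show ?case by (auto intro!: exI[of _ 0])
    qed (auto simp: mult_single)
    then obtain n1 where "?s i ^ expo K i = single n1 1" by blast
    then show ?case using insert by (auto simp: mult_single)
  qed
  ultimately have "mprod ?s K = single m 1"
    by (auto simp: leads_def in_keys_iff lookup_single when_def split: if_splits)
  then show ?thesis using 1 by simp
qed

context
  fixes A :: "'a pol set"
  assumes A: "subalgebra A" and bs_A: "\<And>i. i < 5 \<Longrightarrow> bs ! i \<in> A"
    and A_leads: "\<And>f. f \<in> A \<Longrightarrow> f \<noteq> 0 \<Longrightarrow> \<exists>K. keys K \<subseteq> {..<5} \<and> LM f = gen_LM p K"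
begin

lemma mprod_in_A: "keys K \<subseteq> {..<5} \<Longrightarrow> bpow K \<in> A"
proof (rule subalgebra_mprod[OF A])
  fix v assume "keys K \<subseteq> {..<5}" "v \<in> keys K"
  then have "v < 5" by auto
  then show "bs ! v \<in> A" by (rule bs_A)
qed

lemma lead_monomials_A: "lead_monomials A = {single m 1 | m. m \<in> gen_monoid}"
proof
  show "lead_monomials A \<subseteq> {single m 1 | m. m \<in> gen_monoid}"
  proof
    fix t assume "t \<in> lead_monomials A"
    then obtain f where f: "t = single (LM f) 1" "f \<in> A" "f \<noteq> 0"
      unfolding lead_monomials_def by blast
    then have "LM f \<in> gen_monoid" using A_leads[OF f(2,3)] unfolding gen_monoid_def by blast
    then show "t \<in> {single m 1 | m. m \<in> gen_monoid}" using f(1) by blast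
  qed
  show "{single m 1 | m. m \<in> gen_monoid} \<subseteq> lead_monomials A"
  proof
    fix t :: "'a pol" assume "t \<in> {single m 1 | m. m \<in> gen_monoid}"
    then obtain K where K: "keys K \<subseteq> {..<5}" "t = single (gen_LM p K) 1"
      by (auto simp: gen_monoid_def)
    then show "t \<in> lead_monomials A"
      unfolding lead_monomials_def
      using mprod_in_A[OF K(1)] leads_LM[OF mprod_leads[OF K(1)]] leads_nonzero[OF mprod_leads[OF K(1)]]
      by (intro CollectI exI[of _ "bpow K"]) auto
  qed
qed

lemma sagbi: "sagbi_basis A (set bs)"
  unfolding sagbi_basis_def
proof (intro conjI)
  show "subalgebra A" by (rule A)
  show "finite (set bs)" by simp
  show sub: "set bs \<subseteq> A" using bs_A by (auto simp: set_bs)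
  show "0 \<notin> set bs" by (rule bs_nonzero)
  have span: "lin_span (lead_monomials A) = {f. keys f \<subseteq> gen_monoid}"
    unfolding lead_monomials_A by (rule lin_span_monomials)
  show "subalgebra hull (lead_monomials (set bs)) = lin_span (lead_monomials A)"
    unfolding span
  proof
    have "0 \<in> gen_monoid"
      unfolding gen_monoid_def by (rule image_eqI[of _ _ 0]) (simp_all add: gen_LM_def)
    moreover have "m + n \<in> gen_monoid" if mn: "m \<in> gen_monoid" "n \<in> gen_monoid" for m n
    proof -
      obtain K L where "keys K \<subseteq> {..<5}" "keys L \<subseteq> {..<5}"
        "m = gen_LM p K" "n = gen_LM p L"
        using mn by (auto simp: gen_monoid_def)
      then show ?thesis
        unfolding gen_monoid_def using Poly_Mapping.keys_add[of K L]
        by (intro image_eqI[of _ _ "K + L"]) (auto simp: gen_LM_add)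
    qed
    ultimately have "subalgebra {f :: 'a pol. keys f \<subseteq> gen_monoid}"
      by (rule subalgebra_support)
    moreover have "lead_monomials (set bs) \<subseteq> {f. keys f \<subseteq> gen_monoid}"
    proof -
      have "lead_monomials (set bs) \<subseteq> lead_monomials A"
        unfolding lead_monomials_def using sub by blast
      also have "\<dots> \<subseteq> {f. keys f \<subseteq> gen_monoid}"
        unfolding lead_monomials_A by auto
      finally show ?thesis .
    qed
    ultimately show "subalgebra hull (lead_monomials (set bs)) \<subseteq> {f. keys f \<subseteq> gen_monoid}"
      by (intro hull_minimal)
    show "{f. keys f \<subseteq> gen_monoid} \<subseteq> subalgebra hull (lead_monomials (set bs))"
    proof
      fix f :: "'a pol" assume f: "f \<in> {f. keys f \<subseteq> gen_monoid}"
      have "(\<Sum>m\<in>keys f. single m (coef f m)) \<in> subalgebra hull (lead_monomials (set bs))"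
        using f monomials_in_hull by (intro sum_in_hull subalgebra_hull) auto
      then show "f \<in> subalgebra hull (lead_monomials (set bs))"
        unfolding poly_mapping_sum_singles[of f, symmetric] .
    qed
  qed
qed

lemma subducts_exists: "f \<in> A \<Longrightarrow> \<exists>Q. subducts bs f Q"
proof (induction "LM f" arbitrary: f rule: wf_induct_rule[OF wf_grevlex])
  case 1
  show ?case
  proof (cases "f = 0")
    case True
    then show ?thesis by (intro exI[of _ 0]) (simp add: subducts.zero)
  next
    case False
    obtain K where K: "keys K \<subseteq> {..<5}" "LM f = gen_LM p K"
      using A_leads[OF "1.prems" False] by blast
    define c where "c = coef f (LM f)"
    have f: "leads f (gen_LM p K) c"
      using leads_of_nonzero[OF False] K(2) by (simp add: c_def)
    have t: "leads (mconst c * bpow K) (gen_LM p K) c"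
      by (rule term_leads[OF K(1)]) (use f in \<open>simp add: leads_def\<close>)
    let ?g = "f - mconst c * bpow K"
    have gA: "?g \<in> A"
      using subalgebra_closed(5)[OF A subalgebra_closed(1)[OF A] mprod_in_A[OF K(1)]]
        subalgebra_closed(7)[OF A "1.prems"] by blast
    have "\<exists>Q. subducts bs ?g Q"
    proof (cases "?g = 0")
      case True
      then show ?thesis by (intro exI[of _ 0]) (simp only: subducts.zero)
    next
      case g: False
      have "grevlex_less (LM ?g) (LM f)"
        using leads_diff_less[OF f t g] K(2) by simp
      then show ?thesis by (intro "1.hyps"[OF _ gA]) simp
    qed
    then obtain Q where "subducts bs ?g Q" by blast
    then have "subducts bs f (single K c + Q)"
      using False K(1) leads_LT[OF f] leads_LT[OF t]
      by (intro subducts.step) (simp_all add: length_bs)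
    then show ?thesis by blast
  qed
qed

end

text \<open>Lead monomials strictly decrease during a subduction, so all terms \<open>b\<^sup>K\<close> subtracted stay at or
  below the lead monomial of the start.\<close>

lemma subducts_properties:
  assumes "subducts bs f Q"
  shows "Q \<in> R \<and> eval Q = f \<and>
    (\<forall>K\<in>keys Q. f \<noteq> 0 \<and> (gen_LM p K = LM f \<or> grevlex_less (gen_LM p K) (LM f)))"
  using assms
proof induction
  case zero
  show ?case by (simp add: mpoly_ring_0)
next
  case (step f K c Q)
  have K: "keys K \<subseteq> {..<5}" using step.hyps(2) by (simp add: length_bs)
  let ?t = "mconst c * bpow K"
  have ft: "leads f (LM f) (coef f (LM f))" by (rule leads_of_nonzero[OF step.hyps(1)])
  have c: "c \<noteq> 0"
  proof
    assume "c = 0"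
    then have "LT f = 0" using step.hyps(3) by (simp add: LT_def)
    then have "coef (LT f) (LM f) = 0" by simp
    then show False using ft by (simp add: LT_def leads_def)
  qed
  have t: "leads ?t (gen_LM p K) c" by (rule term_leads[OF K c])
  have "single (LM f) (coef f (LM f)) = single (gen_LM p K) c"
    using step.hyps(3) leads_LT[OF t] by (simp add: LT_def)
  then have "coef (single (LM f) (coef f (LM f))) (gen_LM p K) = c"
    by simp
  then have LM: "LM f = gen_LM p K" and "coef f (LM f) = c"
    using c by (auto simp: lookup_single when_def split: if_splits)
  then have f: "leads f (gen_LM p K) c" using ft by simp
  have lower: "gen_LM p L = LM f \<or> grevlex_less (gen_LM p L) (LM f)" if L: "L \<in> keys Q" for L
  proof -
    have "f - ?t \<noteq> 0" "gen_LM p L = LM (f - ?t) \<or> grevlex_less (gen_LM p L) (LM (f - ?t))"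
      using step.IH L by auto
    then have "grevlex_less (LM (f - ?t)) (LM f)"
      using leads_diff_less[OF f t] LM by simp
    then show ?thesis
      using \<open>gen_LM p L = LM (f - ?t) \<or> _\<close> grevlex_trans by metis
  qed
  have keys: "L = K \<or> L \<in> keys Q"
    if "L \<in> keys (single K c + Q)" for L
    using subsetD[OF Poly_Mapping.keys_add that] by (auto split: if_splits)
  show ?case
  proof (intro conjI ballI)
    show "single K c + Q \<in> R"
      using step.IH K by (auto intro: mpoly_ring_add mpoly_ring_single)
    show "eval (single K c + Q) = f"
      using step.IH by (simp add: msubst_add)
    show "f \<noteq> 0" by (rule step.hyps(1))
    fix L assume "L \<in> keys (single K c + Q)"
    then show "gen_LM p L = LM f \<or> grevlex_less (gen_LM p L) (LM f)"
      using keys lower LM by auto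
  qed
qed

text \<open>Every term \<open>b\<^sup>K\<close> that is subtracted in a subduction of \<open>(b\<^sup>I, b\<^sup>J)\<close> has a lead monomial below
  the common lead monomial \<open>y\<^sup>d\<close> of \<open>b\<^sup>I\<close> and \<open>b\<^sup>J\<close>, which has cancelled before. So \<open>K\<close> is below \<open>I\<close>,
  whatever the choices were.\<close>

lemma subduction_relation_leads:
  assumes I: "keys I \<subseteq> {..<5}" and J: "keys J \<subseteq> {..<5}"
    and d: "gen_LM p I = single Y d" "gen_LM p J = single Y d" "d \<le> p^4 + p"
    and order: "gen_order p J < gen_order p I" "(p^4 + p + 1) * d \<le> gen_order p I"
    and r: "subduction_relation bs (I, J) r"
  shows "r \<in> R \<and> gen_leads p r I \<and> eval r = 0"
proof -
  obtain c Q where c: "LT (bpow I) = LT (mconst c * bpow J)"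
    and Q: "subducts bs (bpow I - mconst c * bpow J) Q"
    and r: "r = single I 1 - single J c - Q"
    using r by (auto simp: subduction_relation_def)
  let ?f = "bpow I - mconst c * bpow J"
  have lI: "leads (bpow I) (single Y d) 1"
    using mprod_leads[OF I] d by simp
  have "c \<noteq> 0"
  proof
    assume "c = 0"
    then have "coef (single (single Y d) (1::'a)) (single Y d) = 0"
      using c leads_LT[OF lI] by (simp add: LT_def)
    then show False by simp
  qed
  then have lJ: "leads (mconst c * bpow J) (single Y d) c"
    using term_leads[OF J] d by simp
  have "coef (single (single Y d) (1::'a)) (single Y d) =
      coef (single (single Y d) c) (single Y d)"
    using c leads_LT[OF lI] leads_LT[OF lJ] by simp
  then have c1: "c = 1" by simp
  note Qp = subducts_properties[OF Q]
  have lower: "gen_order p K < gen_order p I" if K: "K \<in> keys Q" for K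
  proof -
    have f: "?f \<noteq> 0" using Qp K by blast
    have "grevlex_less (LM ?f) (single Y d)"
      using leads_diff_less[OF lI _ f] lJ c1 by simp
    then have "grevlex_less (gen_LM p K) (single Y d)"
      using Qp K grevlex_trans by metis
    then show ?thesis using gen_order_less[OF _ d(3)] order(2) p by fastforce
  qed
  have "r \<in> R"
    using Qp I J by (simp add: r mpoly_ring_diff mpoly_ring_single)
  moreover have "eval r = 0"
    using Qp by (simp add: r msubst_diff)
  moreover have "gen_leads p r I"
    unfolding gen_leads_def
  proof (intro conjI ballI impI)
    have "I \<notin> keys Q" "I \<noteq> J" using lower order(1) by auto
    then show "coef r I = 1" by (simp add: r lookup_minus lookup_single in_keys_iff)
    fix K assume "K \<in> keys r" "K \<noteq> I"
    then have "K = J \<or> K \<in> keys Q"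
      by (auto simp: r lookup_minus lookup_single in_keys_iff when_def split: if_splits)
    then show "gen_order p K < gen_order p I" using order(1) lower by blast
  qed
  ultimately show ?thesis by blast
qed

abbreviation "tete1 \<equiv> (single 2 p, single 1 (p + 1)) :: nat monomial \<times> nat monomial"
abbreviation "tete2 \<equiv> (single 3 p, single 1 (p^2 - 1) + single 2 1)
  :: nat monomial \<times> nat monomial"

lemma tete1_LM:
  "gen_LM p (single 2 p) = single Y (p^3 + p^2)"
  "gen_LM p (single 1 (p + 1)) = single Y (p^3 + p^2)"
  by (simp_all add: gen_LM_def lookup_single power2_eq_square power3_eq_cube algebra_simps)

lemma tete2_LM:
  "gen_LM p (single 3 p) = single Y (p^4 + p)"
  "gen_LM p (single 1 (p^2 - 1) + single 2 1) = single Y (p^4 + p)"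
proof -
  have "p^2 * (p^2 - 1) + (p^2 + p) = p^4 + p"
  proof -
    have "p^2 * (p^2 - 1) + p^2 = p^2 * p^2"
      using p by (simp add: diff_mult_distrib2 power2_eq_square)
    also have "\<dots> = p^4" by (simp flip: power_add)
    finally show ?thesis by linarith
  qed
  moreover have "gen_LM p (single 1 (p^2 - 1) + single 2 1) =
      single Y (p^2 * (p^2 - 1) + (p^2 + p))"
    by (simp add: gen_LM_def lookup_add lookup_single)
  ultimately show "gen_LM p (single 1 (p^2 - 1) + single 2 1) = single Y (p^4 + p)"
    by metis
  show "gen_LM p (single 3 p) = single Y (p^4 + p)"
    by (simp add: gen_LM_def lookup_single power_numeral_reduce algebra_simps)
qed

lemma tete1_leads:
  assumes "subduction_relation bs tete1 r"
  shows "r \<in> R \<and> gen_leads p r (single 2 p) \<and> eval r = 0"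
proof (rule subduction_relation_leads[OF _ _ tete1_LM _ _ _ assms])
  have "p^3 + p^2 = p^2 * (p + 1)" by (simp add: power2_eq_square power3_eq_cube)
  also have "p * 2 \<le> p * p" using p by (intro mult_left_mono) auto
  then have "p + 1 \<le> p^2" using p unfolding power2_eq_square by linarith
  then have "p^2 * (p + 1) \<le> p^2 * p^2" by (intro mult_left_mono) auto
  finally show "p^3 + p^2 \<le> p^4 + p" by (simp flip: power_add)
qed (use p in \<open>auto simp: gen_order_def gen_weight_def lookup_single power2_eq_square power3_eq_cube algebra_simps\<close>)

lemma tete2_leads:
  assumes "subduction_relation bs tete2 r"
  shows "r \<in> R \<and> gen_leads p r (single 3 p) \<and> eval r = 0"
proof (rule subduction_relation_leads[OF _ _ tete2_LM _ _ _ assms])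
  let ?J = "single 1 (p^2 - 1) + single 2 1 :: nat monomial"
  have w: "gen_weight p ?J = p^4 + p" "gen_weight p (single 3 p) = p^4 + p"
    using tete2_LM unfolding xyz_monomial_eq_iff
    by (auto simp: gen_LM_def gen_weight_def lookup_single lookup_add)
  show "gen_order p ?J < gen_order p (single 3 p)"
    "(p^4 + p + 1) * (p^4 + p) \<le> gen_order p (single 3 p)"
    unfolding gen_order_def w using p by (auto simp: lookup_single lookup_add)
  show "keys ?J \<subseteq> {..<5}"
    by (intro keys_add_subset keys_single_subset) simp_all
qed auto

text \<open>The lead monomials of \<open>A\<close> are all that has to be known: subduction shows that the generators
  generate, and any two relations from the tete-a-tetes have the required top monomials.\<close>

theorem complete_intersection_by_subduction:
  assumes A: "subalgebra A" "\<And>i. i < 5 \<Longrightarrow> bs ! i \<in> A"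
    "\<And>f. f \<in> A \<Longrightarrow> f \<noteq> 0 \<Longrightarrow> \<exists>K. keys K \<subseteq> {..<5} \<and> LM f = gen_LM p K"
  shows "complete_intersection A \<and> complete_intersection_by_subduction A bs [tete1, tete2]"
proof -
  have "eval ` R \<subseteq> A"
    using subalgebra_msubst[OF A(1)] A(2) by blast
  moreover have "A \<subseteq> eval ` R"
  proof
    fix f assume "f \<in> A"
    then obtain Q where "subducts bs f Q" using subducts_exists[OF A] by blast
    then show "f \<in> eval ` R" using subducts_properties by blast
  qed
  ultimately have pres: "presents bs A" unfolding presents_def length_bs by blast
  have rel: "regular_sequence (mpoly_ring (length bs)) rs \<and>
      relation_ideal bs = ideal_gen (mpoly_ring (length bs)) rs"
    if "list_all2 (subduction_relation bs) [tete1, tete2] rs" for rs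
  proof -
    obtain r s where rs: "rs = [r, s]" "subduction_relation bs tete1 r" "subduction_relation bs tete2 s"
      using \<open>list_all2 _ _ rs\<close> by (auto simp: list_all2_Cons1)
    show ?thesis
      unfolding rs(1) length_bs
      using relations_regular relation_ideal_eq tete1_leads[OF rs(2)] tete2_leads[OF rs(3)] by blast
  qed
  have ex: "\<exists>r. subduction_relation bs (I, J) r"
    if IJ: "keys I \<subseteq> {..<5}" "keys J \<subseteq> {..<5}" "gen_LM p I = gen_LM p J" for I J
  proof -
    have "bpow I - mconst 1 * bpow J \<in> A"
      using IJ A(1) mprod_in_A[OF A] by (intro subalgebra_closed)
    then obtain Q where "subducts bs (bpow I - mconst 1 * bpow J) Q"
      using subducts_exists[OF A] by blast
    moreover have "tete_a_tete bs I J"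
      using IJ leads_LM[OF mprod_leads] by (simp add: tete_a_tete_def length_bs)
    moreover have "LT (bpow I) = LT (mconst 1 * bpow J)"
      using IJ leads_LT[OF mprod_leads] by simp
    ultimately show ?thesis unfolding subduction_relation_def by blast
  qed
  have "\<exists>r. subduction_relation bs tete1 r"
    by (rule ex, simp, simp) (simp only: tete1_LM)
  moreover have "\<exists>r. subduction_relation bs tete2 r"
  proof (rule ex)
    show "keys (single 1 (p^2 - 1) + single 2 1 :: nat monomial) \<subseteq> {..<5}"
      by (intro keys_add_subset keys_single_subset) simp_all
    show "gen_LM p (single 3 p) =
       gen_LM p (single 1 (p^2 - 1) + single 2 1)"
      unfolding tete2_LM ..
  qed auto
  ultimately obtain r s where rs: "subduction_relation bs tete1 r" "subduction_relation bs tete2 s"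
    by blast
  have "complete_intersection A"
    unfolding complete_intersection_def using pres rel[of "[r, s]"] rs by (auto intro!: exI[of _ bs] exI[of _ "[r, s]"])
  moreover have "complete_intersection_by_subduction A bs [tete1, tete2]"
    unfolding complete_intersection_by_subduction_def using pres rel rs by auto
  ultimately show ?thesis by blast
qed

end

section \<open>Minors of the matrix of exponent rows\<close>

definition det3 :: "(nat \<Rightarrow> 'a::comm_ring_1) \<Rightarrow> (nat \<Rightarrow> 'a) \<Rightarrow> (nat \<Rightarrow> 'a) \<Rightarrow> nat \<Rightarrow> nat \<Rightarrow> nat \<Rightarrow> 'a" where
  "det3 b c d i j k =
     b i * (c j * d k - c k * d j) - b j * (c i * d k - c k * d i) + b k * (c i * d j - c j * d i)"

definition det4 :: "(nat \<Rightarrow> 'a::comm_ring_1) \<Rightarrow> (nat \<Rightarrow> 'a) \<Rightarrow> (nat \<Rightarrow> 'a) \<Rightarrow> (nat \<Rightarrow> 'a) \<Rightarrow> 'a" where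
  "det4 a b c d = a 0 * det3 b c d 1 2 3 - a 1 * det3 b c d 0 2 3 + a 2 * det3 b c d 0 1 3 - a 3 * det3 b c d 0 1 2"

lemma det_expand_first_row:
  fixes f :: "nat \<times> nat \<Rightarrow> 'a::comm_ring_1"
  shows "det (mat (Suc n) (Suc n) f) =
    (\<Sum>j<Suc n. f (0, j) * ((-1)^j * det (mat n n (\<lambda>(a, b). f (Suc a, if b < j then b else Suc b)))))"
    (is "det ?A = (\<Sum>j<Suc n. f (0, j) * ((-1)^j * det (?B j)))")
proof -
  have "det ?A = (\<Sum>j<Suc n. ?A $$ (0, j) * cofactor ?A 0 j)"
    by (rule laplace_expansion_row) auto
  also have "\<dots> = (\<Sum>j<Suc n. f (0, j) * ((-1)^j * det (?B j)))"
  proof (rule sum.cong[OF refl])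
    fix j assume "j \<in> {..<Suc n}"
    have "mat_delete ?A 0 j = ?B j"
      by (rule eq_matI) (auto simp: mat_delete_def)
    with \<open>j \<in> _\<close> show "?A $$ (0, j) * cofactor ?A 0 j = f (0, j) * ((-1)^j * det (?B j))"
      by (simp add: cofactor_def)
  qed
  finally show ?thesis .
qed

lemma det_mat_4: "det (mat 4 4 (\<lambda>(i, j). ([a, b, c, d] ! i) j)) = det4 a b c d"
proof -
  have three: "det (mat 3 3 f) = f (0, 0) * (f (1, 1) * f (2, 2) - f (1, 2) * f (2, 1))
      - f (0, 1) * (f (1, 0) * f (2, 2) - f (1, 2) * f (2, 0))
      + f (0, 2) * (f (1, 0) * f (2, 1) - f (1, 1) * f (2, 0))" for f :: "nat \<times> nat \<Rightarrow> 'a"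
    by (simp add: numeral_3_eq_3 numeral_2_eq_2 det_expand_first_row lessThan_Suc algebra_simps)
  have 4: "(4::nat) = Suc 3" by simp
  have "{..<Suc 3} = {0, 1, 2, 3 :: nat}" by auto
  then show ?thesis
    unfolding 4 det_expand_first_row three
    by (simp add: det4_def det3_def numeral_3_eq_3 numeral_2_eq_2 algebra_simps)
qed

definition gam_row :: "nat \<Rightarrow> 'a::comm_ring_1 mat \<Rightarrow> nat \<Rightarrow> nat \<Rightarrow> 'a" where
  "gam_row p M r j = M $$ ((r - 1) mod 2, j) ^ (p ^ ((r - 1) div 2))"

lemma gam_matrix:
  assumes "M \<in> carrier_mat 2 4" "{i, j, k, l} \<subseteq> {1..10}"
  shows "mat_of_rows 4 (map (\<lambda>r. row (Gamma p M) (r - 1)) [i, j, k, l]) =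
    mat 4 4 (\<lambda>(s, t). ([gam_row p M i, gam_row p M j, gam_row p M k, gam_row p M l] ! s) t)"
    (is "?A = ?B")
proof (rule eq_matI)
  fix s t assume "s < dim_row ?B" "t < dim_col ?B"
  then have st: "s < 4" "t < 4" by auto
  then have "s = 0 \<or> s = 1 \<or> s = 2 \<or> s = 3" by auto
  with st assms(2) show "?A $$ (s, t) = ?B $$ (s, t)"
    by (auto simp: mat_of_rows_def Gamma_def gam_row_def row_def)
qed (auto simp: mat_of_rows_def)

lemma gam_det4:
  assumes "M \<in> carrier_mat 2 4" "{i, j, k, l} \<subseteq> {1..10}"
  shows "gam p M i j k l = det4 (gam_row p M i) (gam_row p M j) (gam_row p M k) (gam_row p M l)"
  unfolding gam_def gam_matrix[OF assms] by (rule det_mat_4)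

text \<open>Five vectors in a space of dimension four: the determinant of the \<open>5 \<times> 5\<close> matrix with a
  repeated column vanishes.\<close>

lemma det4_plucker:
  assumes "j < 4"
  shows "det4 a b c d * e j =
    det4 a b c e * d j - det4 a b d e * c j + det4 a c d e * b j - det4 b c d e * a j"
proof -
  have "j = 0 \<or> j = 1 \<or> j = 2 \<or> j = 3" using assms by auto
  then show ?thesis
    by (elim disjE; simp add: det4_def det3_def algebra_simps)
qed

text \<open>This will be applied to the rows \<open>1, 2, 3, 4\<close> and \<open>5, 7\<close>, where the equation for row \<open>7\<close> is the
  \<open>p\<close>-th power of the one for row \<open>5\<close>.\<close>

lemma det4_eliminate:
  assumes "\<And>j. j < 4 \<Longrightarrow> e j = s * a j + t * c j + be * b j"
    "\<And>j. j < 4 \<Longrightarrow> f j = s' * c j + t' * e j + be' * d j"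
  shows "det4 a c e f = - be * be' * det4 a b c d"
proof -
  have "det4 a c e f = det4 a c e (\<lambda>j. be' * d j)"
    by (simp add: det4_def det3_def assms(2) algebra_simps)
  also have "\<dots> = - be * be' * det4 a b c d"
    by (simp add: det4_def det3_def assms(1) algebra_simps)
  finally show ?thesis .
qed

lemma det4_kernel:
  fixes a b c d :: "nat \<Rightarrow> 'a::field"
  assumes "det4 a b c d \<noteq> 0" "\<And>r. r \<in> {a, b, c, d} \<Longrightarrow> (\<Sum>j<4. v j * r j) = 0" "j < 4"
  shows "v j = 0"
proof (rule ccontr)
  assume vj: "v j \<noteq> 0"
  define A where "A = mat 4 4 (\<lambda>(i, j). ([a, b, c, d] ! i) j)"
  have A: "A \<in> carrier_mat 4 4" by (simp add: A_def)
  have "A *\<^sub>v vec 4 v = 0\<^sub>v 4"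
  proof (rule eq_vecI)
    fix i assume "i < dim_vec (0\<^sub>v 4 :: 'a vec)"
    then have i: "i < 4" by simp
    then have "[a, b, c, d] ! i \<in> set [a, b, c, d]" by (intro nth_mem) simp
    then have "(\<Sum>j<4. v j * ([a, b, c, d] ! i) j) = 0" using assms(2) by auto
    then show "(A *\<^sub>v vec 4 v) $ i = (0\<^sub>v 4) $ i"
      using i by (simp add: A_def scalar_prod_def mult.commute atLeast0LessThan)
  qed (simp add: A_def)
  moreover have "vec 4 v \<noteq> 0\<^sub>v 4"
    using vj assms(3) by (metis index_vec index_zero_vec(1))
  ultimately have "det A = 0"
    using det_0_iff_vec_prod_zero_field[OF A] by (metis vec_carrier)
  then show False using assms(1) det_mat_4[of a b c d] by (simp add: A_def)
qed

section \<open>The group as a group of translations\<close>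

text \<open>The elements of the group are translations \<open>y \<mapsto> y + a x\<close>, \<open>y\<^sup>2 - x z \<mapsto> y\<^sup>2 - x z - b x\<^sup>2\<close>.\<close>

definition shift :: "'a::comm_ring_1 \<Rightarrow> 'a \<Rightarrow> 'a pol \<Rightarrow> 'a pol" where
  "shift a b = msubst (\<lambda>v. case v of
       X \<Rightarrow> px
     | Y \<Rightarrow> py + mconst a * px
     | Z \<Rightarrow> pz + 2 * mconst a * py + mconst (a^2 + b) * px)"

lemma shift_simps [simp]:
  "shift a b px = px" "shift a b py = py + mconst a * px"
  "shift a b pz = pz + 2 * mconst a * py + mconst (a^2 + b) * px"
  "shift a b (mconst c) = mconst c" "shift a b 1 = 1" "shift a b 0 = 0"
  by (simp_all add: shift_def)

lemma shift_hom: "shift a b (f + g) = shift a b f + shift a b g"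
  "shift a b (f - g) = shift a b f - shift a b g"
  "shift a b (- f) = - shift a b f"
  "shift a b (f * g) = shift a b f * shift a b g"
  "shift a b (f ^ n) = shift a b f ^ n"
  by (simp_all add: shift_def msubst_hom)

lemma shift_sum: "shift a b (sum f S) = (\<Sum>i\<in>S. shift a b (f i))"
  and shift_prod: "shift a b (prod f S) = (\<Prod>i\<in>S. shift a b (f i))"
  by (simp_all add: shift_def msubst_sum msubst_prod)

lemma shift_delta: "shift a b delta = delta - mconst b * px^2"
  by (simp add: delta_def shift_hom mconst_add mconst_mult power2_eq_square algebra_simps)

lemma shift_shift: "shift a b (shift c d f) = shift (a + c) (b + d) f"
proof -
  show ?thesis
    unfolding shift_def msubst_msubst
    by (rule arg_cong2[where f = msubst, OF _ refl], rule ext)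
       (auto split: xyz.split simp: msubst_hom mconst_add mconst_mult mconst_numeral
         power2_eq_square algebra_simps)
qed

lemma shift_0 [simp]: "shift 0 0 f = f"
proof -
  have "shift 0 0 f = msubst mvar f"
    unfolding shift_def
    by (rule arg_cong2[where f = msubst, OF _ refl], rule ext) (simp split: xyz.split)
  then show ?thesis by simp
qed

lemma shift_funpow: "(shift a b ^^ n) f = shift (of_nat n * a) (of_nat n * b) f"
  by (induction n) (simp_all add: shift_shift algebra_simps)

definition lin :: "(nat \<Rightarrow> int) \<Rightarrow> (nat \<Rightarrow> 'a::comm_ring_1) \<Rightarrow> 'a" where
  "lin g v = (\<Sum>j<4. of_nat (nat (g j)) * v j)"

definition translation_set :: "nat \<Rightarrow> 'a::comm_ring_1 mat \<Rightarrow> ('a \<times> 'a) set" where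
  "translation_set p M = (\<lambda>g. (lin g (\<lambda>j. M $$ (0, j)), lin g (\<lambda>j. M $$ (1, j)))) ` carrier (E p)"

lemma gen_act_eq_shift: "gen_act M j = shift (M $$ (0, j)) (M $$ (1, j))"
  by (simp only: gen_act_def shift_def)

lemma E_act_eq_shift: "E_act M g f = shift (lin g (\<lambda>j. M $$ (0, j))) (lin g (\<lambda>j. M $$ (1, j))) f"
proof -
  have 4: "{..<4} = {0, 1, 2, 3 :: nat}" by auto
  show ?thesis
    by (simp add: E_act_def gen_act_eq_shift shift_funpow shift_shift lin_def 4 add_ac)
qed

lemma invariants_eq: "invariants p M = {f. \<forall>(a, b)\<in>translation_set p M. shift a b f = f}"
  by (auto simp: invariants_def translation_set_def E_act_eq_shift)

lemma orbit_eq: "(\<lambda>g. E_act M g f) ` carrier (E p) = (\<lambda>(a, b). shift a b f) ` translation_set p M"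
  by (auto simp: translation_set_def E_act_eq_shift image_image)

lemma coef_mvar: "coef (mvar v) (single w 1) = (if v = w then 1 else 0)"
  unfolding mvar_def lookup_single when_def
  by (metis One_nat_def keys_single one_neq_zero singleton_inject)

lemma mconst_px_eq_iff: "mconst a * px = mconst b * px \<longleftrightarrow> a = (b :: 'a::idom)"
proof
  assume "mconst a * px = mconst b * (px :: 'a pol)"
  then have "coef (mconst a * px :: 'a pol) (single X 1) = coef (mconst b * px) (single X 1)"
    by (rule arg_cong)
  then show "a = b" unfolding coef_mconst_mult coef_mvar by simp
qed simp

lemma orbit_norm_y:
  fixes M :: "'a::field mat"
  shows "orbit_norm p M py = (\<Prod>a\<in>fst ` translation_set p M. py + mconst a * px)"
proof -
  have "(\<lambda>(a, b). shift a b (py :: 'a pol)) ` translation_set p M =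
     (\<lambda>a. py + mconst a * px) ` fst ` translation_set p M"
    unfolding image_image by (rule image_cong) auto
  moreover have "inj_on (\<lambda>a. py + mconst a * px :: 'a pol) (fst ` translation_set p M)"
    by (rule inj_onI) (metis mconst_px_eq_iff add_left_cancel)
  ultimately show ?thesis
    unfolding orbit_norm_def orbit_eq by (simp add: prod.reindex)
qed

lemma shift_pz_inj:
  fixes a b c d :: "'a::field"
  assumes "(2 :: 'a) \<noteq> 0" "shift a b pz = shift c d pz"
  shows "a = c \<and> b = d"
proof -
  have c: "coef (shift a b pz :: 'a pol) (single Y 1) = 2 * a"
    "coef (shift a b pz :: 'a pol) (single X 1) = a^2 + b" for a b
  proof -
    have "shift a b pz = pz + mconst (2 * a) * py + mconst (a^2 + b) * (px :: 'a pol)"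
      by (simp add: mconst_mult mconst_numeral)
    then show "coef (shift a b pz :: 'a pol) (single Y 1) = 2 * a"
      "coef (shift a b pz :: 'a pol) (single X 1) = a^2 + b"
      by (simp_all only: lookup_add coef_mconst_mult coef_mvar) simp_all
  qed
  have "2 * a = 2 * c" "a^2 + b = c^2 + d" using c assms(2) by metis+
  then show ?thesis using assms(1) by simp
qed

lemma orbit_norm_z:
  fixes M :: "'a::field mat"
  assumes "(2 :: 'a) \<noteq> 0"
  shows "orbit_norm p M pz = (\<Prod>(a, b)\<in>translation_set p M. shift a b pz)"
proof -
  have "inj_on (\<lambda>(a, b). shift a b (pz :: 'a pol)) (translation_set p M)"
    by (rule inj_onI) (use shift_pz_inj[OF assms] in auto)
  then show ?thesis
    unfolding orbit_norm_def orbit_eq by (simp add: prod.reindex case_prod_unfold)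
qed

section \<open>Counting translations\<close>

lemma carrier_E: "p > 0 \<Longrightarrow> carrier (E p) = ({0..<4} \<rightarrow>\<^sub>E {0..<int p})"
  by (simp add: E_def carrier_integer_mod_group)

lemma frobenius_add: "(x + y) ^ p = x ^ p + y ^ p"
  if "prime p" "CHAR('a) = p" for x y :: "'a::comm_ring_1"
  by (rule freshmans_dream) (use that in auto)

lemma of_nat_frobenius: "of_nat n ^ p = (of_nat n :: 'a::comm_ring_1)" if "prime p" "CHAR('a) = p"
proof (induction n)
  case 0
  show ?case using zero_power[OF prime_gt_0_nat[OF that(1)], where ?'a = 'a] by simp
qed (simp add: frobenius_add[OF that])

lemma lin_frobenius:
  fixes v :: "nat \<Rightarrow> 'a::comm_ring_1"
  assumes "prime p" "CHAR('a) = p"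
  shows "lin g v ^ p = lin g (\<lambda>j. v j ^ p)"
proof -
  have "lin g v ^ p = (\<Sum>j<4. (of_nat (nat (g j)) * v j) ^ p)"
    unfolding lin_def by (rule freshmans_dream_sum) (use assms in auto)
  then show ?thesis
    by (simp only: lin_def power_mult_distrib of_nat_frobenius[OF assms])
qed

lemma lin_frobenius2:
  fixes v :: "nat \<Rightarrow> 'a::comm_ring_1"
  assumes "prime p" "CHAR('a) = p"
  shows "lin g v ^ (p^2) = lin g (\<lambda>j. v j ^ (p^2))"
  by (simp only: power2_eq_square power_mult lin_frobenius[OF assms])

lemma lin_add: "lin g (\<lambda>j. v j + w j) = lin g v + lin g w"
  by (simp add: lin_def algebra_simps sum.distrib)

lemma lin_mult: "lin g (\<lambda>j. c * v j) = c * lin g v"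
  by (simp add: lin_def sum_distrib_left algebra_simps)

lemma lin_cong: "(\<And>j. j < 4 \<Longrightarrow> v j = w j) \<Longrightarrow> lin g v = lin g w"
  by (simp add: lin_def)

lemma of_int_mod_char: "of_int (x mod int p) = (of_int x :: 'a::comm_ring_1)" if "CHAR('a) = p"
proof -
  have "of_int x = (of_int (x mod int p + int p * (x div int p)) :: 'a)"
    by (simp only: mod_mult_div_eq)
  also have "\<dots> = of_int (x mod int p) + of_nat p * of_int (x div int p)"
    by (simp only: of_int_add of_int_mult of_int_of_nat_eq)
  also have "of_nat p = (0 :: 'a)" unfolding that[symmetric] by (rule of_nat_CHAR)
  finally show ?thesis by simp
qed

lemma translation_set_add:
  fixes M :: "'a::field mat"
  assumes "p > 0" "CHAR('a) = p" "(a, b) \<in> translation_set p M" "(c, d) \<in> translation_set p M"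
  shows "(a + c, b + d) \<in> translation_set p M"
proof -
  obtain g where g: "g \<in> carrier (E p)" "a = lin g (\<lambda>j. M $$ (0, j))" "b = lin g (\<lambda>j. M $$ (1, j))"
    using assms(3) unfolding translation_set_def by (elim imageE Pair_inject) (rule that)
  obtain h where h: "h \<in> carrier (E p)" "c = lin h (\<lambda>j. M $$ (0, j))" "d = lin h (\<lambda>j. M $$ (1, j))"
    using assms(4) unfolding translation_set_def by (elim imageE Pair_inject) (rule that)
  define k where "k = (\<lambda>j\<in>{0..<4}. (g j + h j) mod int p)"
  have k: "k \<in> carrier (E p)" using assms(1) by (simp add: carrier_E k_def PiE_iff)
  have "lin k v = lin g v + lin h v" for v :: "nat \<Rightarrow> 'a"
  proof -
    have "of_nat (nat (k j)) = (of_nat (nat (g j)) + of_nat (nat (h j)) :: 'a)" if "j < 4" for j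
    proof -
      have "g j \<ge> 0" "h j \<ge> 0"
        using g(1) h(1) that assms(1) by (auto simp: carrier_E PiE_iff)
      then have "of_nat (nat (g j)) = (of_int (g j) :: 'a)" "of_nat (nat (h j)) = (of_int (h j) :: 'a)"
        by (simp_all add: of_nat_nat)
      moreover have "of_nat (nat (k j)) = (of_int (k j) :: 'a)"
        using that assms(1) by (simp add: k_def of_nat_nat)
      moreover have "of_int (k j) = (of_int (g j + h j) :: 'a)"
        using that of_int_mod_char[OF assms(2)] by (simp add: k_def)
      ultimately show ?thesis by simp
    qed
    then show ?thesis by (simp add: lin_def distrib_right sum.distrib)
  qed
  then show ?thesis
    unfolding translation_set_def using g h k by (intro image_eqI[of _ _ k]) auto
qed

lemma of_nat_inj_below_char:
  assumes "CHAR('a::comm_ring_1) = p" "of_nat m = (of_nat n :: 'a)" "m < p" "n < p"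
  shows "m = n"
proof -
  have le: "m = n" if "of_nat m = (of_nat n :: 'a)" "m \<le> n" "n < p" for m n
  proof -
    have "of_nat (n - m) = (0 :: 'a)" using that by (simp add: of_nat_diff)
    then have "p dvd n - m" using assms(1) by (simp add: of_nat_eq_0_iff_char_dvd)
    then show ?thesis using that by (auto dest: dvd_imp_le)
  qed
  show ?thesis using le[of m n] le[of n m] assms(2-4) by (cases "m \<le> n") auto
qed

lemma card_translation_set:
  fixes M :: "'a::field mat"
  assumes p: "prime p" "CHAR('a) = p" and M: "M \<in> carrier_mat 2 4" and gam: "gam p M 1 2 3 4 \<noteq> 0"
  shows "card (translation_set p M) = p^4"
proof -
  have p0: "p > 0" using p(1) by (rule prime_gt_0_nat)
  have "inj_on (\<lambda>g. (lin g (\<lambda>j. M $$ (0, j)), lin g (\<lambda>j. M $$ (1, j)))) (carrier (E p))"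
  proof (rule inj_onI)
    fix g h assume g: "g \<in> carrier (E p)" and h: "h \<in> carrier (E p)"
      and eq: "(lin g (\<lambda>j. M $$ (0, j)), lin g (\<lambda>j. M $$ (1, j))) =
        (lin h (\<lambda>j. M $$ (0, j)), lin h (\<lambda>j. M $$ (1, j)))"
    define v where "v j = (of_nat (nat (g j)) - of_nat (nat (h j)) :: 'a)" for j
    have v: "(\<Sum>j<4. v j * r j) = lin g r - lin h r" for r
      by (simp add: v_def lin_def left_diff_distrib sum_subtractf)
    have rows: "gam_row p M 1 = (\<lambda>j. M $$ (0, j))" "gam_row p M 2 = (\<lambda>j. M $$ (1, j))"
      "gam_row p M 3 = (\<lambda>j. M $$ (0, j) ^ p)" "gam_row p M 4 = (\<lambda>j. M $$ (1, j) ^ p)"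
      by (simp_all add: gam_row_def fun_eq_iff)
    have "det4 (gam_row p M 1) (gam_row p M 2) (gam_row p M 3) (gam_row p M 4) \<noteq> 0"
      using gam gam_det4[OF M, of 1 2 3 4 p] by simp
    moreover have "(\<Sum>j<4. v j * r j) = 0" if "r \<in> {gam_row p M 1, gam_row p M 2, gam_row p M 3, gam_row p M 4}" for r
      using that eq unfolding v rows by (auto simp flip: lin_frobenius[OF p])
    ultimately have v0: "v j = 0" if "j < 4" for j
      using that by (rule det4_kernel)
    show "g = h"
    proof (rule PiE_ext)
      show "g \<in> {0..<4} \<rightarrow>\<^sub>E {0..<int p}" "h \<in> {0..<4} \<rightarrow>\<^sub>E {0..<int p}"
        using g h carrier_E[OF p0] by auto
      fix j :: nat assume j: "j \<in> {0..<4}"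
      then have b: "0 \<le> g j" "g j < int p" "0 \<le> h j" "h j < int p"
        using g h by (auto simp: carrier_E[OF p0] PiE_iff)
      have "of_nat (nat (g j)) = (of_nat (nat (h j)) :: 'a)"
        using v0[of j] j by (simp add: v_def)
      moreover have "nat (g j) < p" "nat (h j) < p" using b by auto
      ultimately have "nat (g j) = nat (h j)"
        using of_nat_inj_below_char[OF p(2)] by blast
      then show "g j = h j" using b by simp
    qed
  qed
  then have "card (translation_set p M) = card (carrier (E p))"
    unfolding translation_set_def by (rule card_image)
  also have "\<dots> = p^4" by (simp add: carrier_E[OF p0] card_PiE)
  finally show ?thesis .
qed

lemma card_power_eq_poly:
  fixes q :: "'a::idom poly"
  assumes "degree q < n"
  shows "finite {t. t ^ n = poly q t}" "card {t. t ^ n = poly q t} \<le> n"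
proof -
  let ?P = "Polynomial.monom 1 n - q"
  have "coeff ?P n = 1" using assms by (simp add: coeff_eq_0)
  then have P: "?P \<noteq> 0" by auto
  have eq: "{t. t ^ n = poly q t} = {t. poly ?P t = 0}" by (auto simp: poly_monom)
  show "finite {t. t ^ n = poly q t}" unfolding eq by (rule poly_roots_finite[OF P])
  have "degree ?P \<le> n"
    using degree_diff_le[of "Polynomial.monom 1 n" n q] assms by (simp add: degree_monom_eq)
  then show "card {t. t ^ n = poly q t} \<le> n"
    unfolding eq using card_poly_roots_bound[OF P] by linarith
qed

text \<open>Rows \<open>5\<close> and \<open>6\<close> are combinations of the first four rows. In row \<open>5\<close> the coefficient of row
  \<open>4\<close> is \<open>\<gamma>\<^sub>1\<^sub>2\<^sub>3\<^sub>5 / \<gamma>\<^sub>1\<^sub>2\<^sub>3\<^sub>4 = 0\<close>. If \<open>\<beta>\<close> is the coefficient of row \<open>2\<close>, then \<open>\<beta>\<^bsup>p\<^esup>\<close> is the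
  coefficient of row \<open>4\<close> in row \<open>7\<close>, so \<open>\<gamma>\<^sub>1\<^sub>3\<^sub>5\<^sub>7 = - \<beta>\<^bsup>p + 1\<^esup> \<gamma>\<^sub>1\<^sub>2\<^sub>3\<^sub>4\<close> and \<open>\<beta> = 0\<close>.\<close>

lemma row_relations:
  fixes M :: "'a::field mat"
  assumes p: "prime p" "CHAR('a) = p" and M: "M \<in> carrier_mat 2 4"
    and g: "gam p M 1 2 3 4 \<noteq> 0" "gam p M 1 2 3 5 = 0" "gam p M 1 3 5 7 = 0"
  defines "c \<equiv> \<lambda>i j k l. gam p M i j k l / gam p M 1 2 3 4"
  shows "gam p M 1 3 4 5 = 0"
    and "j < 4 \<Longrightarrow> M $$ (0, j) ^ (p^2) = - c 1 2 4 5 * M $$ (0, j) ^ p - c 2 3 4 5 * M $$ (0, j)"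
    and "j < 4 \<Longrightarrow> M $$ (1, j) ^ (p^2) = c 1 2 3 6 * M $$ (1, j) ^ p - c 1 2 4 6 * M $$ (0, j) ^ p
      + c 1 3 4 6 * M $$ (1, j) - c 2 3 4 6 * M $$ (0, j)"
proof -
  let ?r = "gam_row p M"
  have rows: "?r 1 j = M $$ (0, j)" "?r 2 j = M $$ (1, j)" "?r 3 j = M $$ (0, j) ^ p" "?r 4 j = M $$ (1, j) ^ p"
    "?r 5 j = M $$ (0, j) ^ (p^2)" "?r 6 j = M $$ (1, j) ^ (p^2)" "?r 7 j = M $$ (0, j) ^ (p^3)" for j
    by (simp_all add: gam_row_def)
  have five: "?r e j = c 1 2 3 e * ?r 4 j - c 1 2 4 e * ?r 3 j + c 1 3 4 e * ?r 2 j - c 2 3 4 e * ?r 1 j"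
    if e: "e \<in> {1..10}" and j: "j < 4" for e j
  proof -
    have "gam p M 1 2 3 4 * ?r e j = gam p M 1 2 3 e * ?r 4 j - gam p M 1 2 4 e * ?r 3 j
        + gam p M 1 3 4 e * ?r 2 j - gam p M 2 3 4 e * ?r 1 j"
      using e det4_plucker[OF j, of "?r 1" "?r 2" "?r 3" "?r 4" "?r e"] by (simp add: gam_det4[OF M])
    then show ?thesis using g(1) by (simp add: c_def divide_simps) (simp add: algebra_simps)
  qed
  have r5: "?r 5 j = - c 2 3 4 5 * ?r 1 j + - c 1 2 4 5 * ?r 3 j + c 1 3 4 5 * ?r 2 j" if "j < 4" for j
    using five[of 5 j] that g(2) by (simp add: c_def)
  have p_odd: "(- x) ^ p = - (x ^ p :: 'a)" for x
  proof -
    have "(x + - x) ^ p = x ^ p + (- x) ^ p" by (rule frobenius_add[OF p])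
    moreover have "(0::'a) ^ p = 0" by (rule zero_power[OF prime_gt_0_nat[OF p(1)]])
    ultimately show ?thesis by (simp add: eq_neg_iff_add_eq_0 add.commute)
  qed
  have r7: "?r 7 j = - (c 2 3 4 5 ^ p) * ?r 3 j + - (c 1 2 4 5 ^ p) * ?r 5 j + c 1 3 4 5 ^ p * ?r 4 j"
    if "j < 4" for j
  proof -
    have "?r 7 j = ?r 5 j ^ p"
      unfolding rows by (simp flip: power_mult add: power2_eq_square power3_eq_cube)
    also have "\<dots> = (- c 2 3 4 5 * ?r 1 j) ^ p + (- c 1 2 4 5 * ?r 3 j) ^ p + (c 1 3 4 5 * ?r 2 j) ^ p"
      unfolding r5[OF that] frobenius_add[OF p] ..
    finally have 7: "?r 7 j = (- c 2 3 4 5 * ?r 1 j) ^ p + (- c 1 2 4 5 * ?r 3 j) ^ p + (c 1 3 4 5 * ?r 2 j) ^ p" .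
    have 35: "?r 3 j ^ p = ?r 5 j" "?r 1 j ^ p = ?r 3 j" "?r 2 j ^ p = ?r 4 j"
      unfolding rows by (simp_all flip: power_mult add: power2_eq_square)
    show ?thesis
      unfolding 7 power_mult_distrib p_odd 35 ..
  qed
  have "gam p M 1 3 5 7 = - c 1 3 4 5 * c 1 3 4 5 ^ p * gam p M 1 2 3 4"
    using det4_eliminate[OF r5 r7] by (simp add: gam_det4[OF M])
  then have be: "c 1 3 4 5 = 0" using g by auto
  then show "gam p M 1 3 4 5 = 0" using g(1) by (simp add: c_def)
  show "M $$ (0, j) ^ (p^2) = - c 1 2 4 5 * M $$ (0, j) ^ p - c 2 3 4 5 * M $$ (0, j)" if "j < 4"
    using r5[OF that] unfolding rows be by simp
  show "M $$ (1, j) ^ (p^2) = c 1 2 3 6 * M $$ (1, j) ^ p - c 1 2 4 6 * M $$ (0, j) ^ p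
      + c 1 3 4 6 * M $$ (1, j) - c 2 3 4 6 * M $$ (0, j)" if "j < 4"
    using five[of 6 j] that unfolding rows by simp
qed

text \<open>Both coordinates of a translation satisfy equations of degree \<open>p\<^sup>2\<close>, so \<open>p\<^sup>4\<close> translations
  are only possible if all of these equations have \<open>p\<^sup>2\<close> solutions.\<close>

lemma translation_counts:
  fixes W :: "('a::field \<times> 'a) set"
  assumes p: "p > 1" and W: "finite W" "card W = p^4"
    and a: "\<And>a b. (a, b) \<in> W \<Longrightarrow> a ^ (p^2) = et * a ^ p + al * a"
    and b: "\<And>a b. (a, b) \<in> W \<Longrightarrow> b ^ (p^2) = u1 * a + u2 * b + u3 * a ^ p + u4 * b ^ p"
  shows "card (fst ` W) = p^2" and "a \<in> fst ` W \<Longrightarrow> card {b. (a, b) \<in> W} = p^2"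
proof -
  have pp: "p < p^2" using p by (simp add: power2_eq_square)
  let ?A = "fst ` W" and ?B = "\<lambda>a. {b. (a, b) \<in> W}"
  have degA: "degree (Polynomial.monom et p + Polynomial.monom al 1) < p^2"
    using pp p by (intro le_less_trans[OF degree_add_le[of _ p]] order_trans[OF degree_monom_le]) auto
  have cA: "card ?A \<le> p^2"
  proof (rule order_trans[OF card_mono card_power_eq_poly(2)[OF degA]])
    show "finite {t. t ^ p\<^sup>2 = poly (Polynomial.monom et p + Polynomial.monom al 1) t}"
      by (rule card_power_eq_poly[OF degA])
    show "?A \<subseteq> {t. t ^ p\<^sup>2 = poly (Polynomial.monom et p + Polynomial.monom al 1) t}"
      using a by (auto simp: poly_monom)
  qed
  have cB: "finite (?B a) \<and> card (?B a) \<le> p^2" for a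
  proof -
    let ?q = "Polynomial.monom u4 p + [:u1 * a + u3 * a ^ p, u2:]"
    have deg: "degree ?q < p^2"
      using pp p by (intro le_less_trans[OF degree_add_le[of _ p]] degree_monom_le) auto
    have sub: "?B a \<subseteq> {t. t ^ p\<^sup>2 = poly ?q t}"
      using b by (auto simp: poly_monom algebra_simps)
    show ?thesis
      using finite_subset[OF sub card_power_eq_poly(1)[OF deg]]
        order_trans[OF card_mono[OF card_power_eq_poly(1)[OF deg] sub] card_power_eq_poly(2)[OF deg]] by blast
  qed
  have WS: "W = Sigma ?A ?B" by force
  have "card (Sigma ?A ?B) = (\<Sum>a\<in>?A. card (?B a))"
    by (rule card_SigmaI) (use W(1) cB in auto)
  then have sum: "card W = (\<Sum>a\<in>?A. card (?B a))"
    unfolding WS[symmetric] .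
  have le: "(\<Sum>a\<in>?A. card (?B a)) \<le> card ?A * p^2"
    using sum_bounded_above[of ?A "\<lambda>a. card (?B a)" "p^2"] cB by simp
  have p4: "p^4 = p^2 * p^2" by (simp flip: power_add)
  have "p^4 \<le> card ?A * p^2" using sum le W(2) by linarith
  then have "p^2 \<le> card ?A"
    unfolding p4 by (rule mult_right_le_imp_le) (use p in simp)
  then show A: "card ?A = p^2" using cA by simp
  show "card (?B a) = p^2" if "a \<in> ?A"
  proof (rule ccontr)
    assume "card (?B a) \<noteq> p^2"
    then have "card (?B a) < p^2" using cB[of a] by simp
    then have "(\<Sum>a\<in>?A. card (?B a)) < (\<Sum>a\<in>?A. p^2)"
      using that W(1) cB by (intro sum_strict_mono_ex1) auto
    then have "card W < p^2 * p^2" unfolding sum sum_constant A by simp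
    then show False unfolding W(2) p4 by simp
  qed
qed

text \<open>Otherwise the \<open>p\<^sup>2\<close> different \<open>p\<close>-th powers \<open>a\<^sup>p\<close> would satisfy an equation of degree \<open>p\<close>.\<close>

lemma linear_coefficient_nonzero:
  fixes A :: "'a::field set"
  assumes p: "prime p" "CHAR('a) = p" and A: "finite A" "card A = p^2"
    and a: "\<And>a. a \<in> A \<Longrightarrow> a ^ (p^2) = et * a ^ p + al * a"
  shows "al \<noteq> 0"
proof
  assume "al = 0"
  have p1: "p > 1" using p(1) by (rule prime_gt_1_nat)
  have deg: "degree (Polynomial.monom et 1) < p"
    using p1 degree_monom_le[of et 1] by linarith
  have "(\<lambda>a. a ^ p) ` A \<subseteq> {t. t ^ p = poly (Polynomial.monom et 1) t}"
    using a \<open>al = 0\<close> by (auto simp: poly_monom power2_eq_square power_mult)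
  then have "card ((\<lambda>a. a ^ p) ` A) \<le> p"
    using card_mono[OF card_power_eq_poly(1)[OF deg]] card_power_eq_poly(2)[OF deg] order_trans by blast
  moreover have "inj_on (\<lambda>a. a ^ p) A"
  proof (rule inj_onI)
    fix x y :: 'a assume "x ^ p = y ^ p"
    have "(y + (x - y)) ^ p = y ^ p + (x - y) ^ p" by (rule frobenius_add[OF p])
    then have "(x - y) ^ p = 0" using \<open>x ^ p = y ^ p\<close> by simp
    then show "x = y" by simp
  qed
  ultimately have "p^2 \<le> p" using A(2) by (simp add: card_image)
  then show False using p1 by (simp add: power2_eq_square)
qed

lemma translation_equations:
  fixes M :: "'a::field mat"
  assumes p: "prime p" "CHAR('a) = p"
    and r: "\<And>j. j < 4 \<Longrightarrow> M $$ (0, j) ^ (p^2) = et * M $$ (0, j) ^ p + al * M $$ (0, j)"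
      "\<And>j. j < 4 \<Longrightarrow> M $$ (1, j) ^ (p^2) =
         u1 * M $$ (0, j) + u2 * M $$ (1, j) + u3 * M $$ (0, j) ^ p + u4 * M $$ (1, j) ^ p"
    and ab: "(a, b) \<in> translation_set p M"
  shows "a ^ (p^2) = et * a ^ p + al * a"
    and "b ^ (p^2) = u1 * a + u2 * b + u3 * a ^ p + u4 * b ^ p"
proof -
  obtain g where g: "a = lin g (\<lambda>j. M $$ (0, j))" "b = lin g (\<lambda>j. M $$ (1, j))"
    using ab unfolding translation_set_def by (elim imageE Pair_inject) (rule that)
  have "a ^ (p^2) = lin g (\<lambda>j. et * M $$ (0, j) ^ p + al * M $$ (0, j))"
    unfolding g lin_frobenius2[OF p] by (rule lin_cong) (rule r(1))
  then show "a ^ (p^2) = et * a ^ p + al * a"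
    by (simp only: lin_add lin_mult g lin_frobenius[OF p])
  have "b ^ (p^2) = lin g (\<lambda>j. u1 * M $$ (0, j) + u2 * M $$ (1, j) + u3 * M $$ (0, j) ^ p + u4 * M $$ (1, j) ^ p)"
    unfolding g lin_frobenius2[OF p] by (rule lin_cong) (rule r(2))
  then show "b ^ (p^2) = u1 * a + u2 * b + u3 * a ^ p + u4 * b ^ p"
    by (simp only: lin_add lin_mult g lin_frobenius[OF p])
qed

section \<open>Construction of the generators\<close>

definition cong_pow :: "'b::comm_ring_1 \<Rightarrow> nat \<Rightarrow> 'b \<Rightarrow> 'b \<Rightarrow> bool" where
  "cong_pow x n a b \<longleftrightarrow> x ^ n dvd a - b"

lemma cong_pow_refl: "cong_pow x n a a"
  by (simp add: cong_pow_def)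

lemma cong_pow_trans: "cong_pow x n a b \<Longrightarrow> cong_pow x n b c \<Longrightarrow> cong_pow x n a c"
  unfolding cong_pow_def by (metis diff_add_cancel dvd_add add_diff_eq)

lemma cong_pow_add: "cong_pow x n a b \<Longrightarrow> cong_pow x n c d \<Longrightarrow> cong_pow x n (a + c) (b + d)"
  unfolding cong_pow_def by (metis add_diff_add dvd_add)

lemma cong_pow_diff: "cong_pow x n a b \<Longrightarrow> cong_pow x n c d \<Longrightarrow> cong_pow x n (a - c) (b - d)"
proof -
  have "a - c - (b - d) = (a - b) - (c - d)" by simp
  then show "cong_pow x n a b \<Longrightarrow> cong_pow x n c d \<Longrightarrow> cong_pow x n (a - c) (b - d)"
    unfolding cong_pow_def by (metis dvd_diff)
qed

lemma cong_pow_mult: "cong_pow x n a b \<Longrightarrow> cong_pow x n c d \<Longrightarrow> cong_pow x n (a * c) (b * d)"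
proof -
  have "a * c - b * d = (a - b) * c + b * (c - d)" by (simp add: algebra_simps)
  then show "cong_pow x n a b \<Longrightarrow> cong_pow x n c d \<Longrightarrow> cong_pow x n (a * c) (b * d)"
    unfolding cong_pow_def by (metis dvd_add dvd_mult dvd_mult2)
qed

lemma cong_pow_power: "cong_pow x n a b \<Longrightarrow> cong_pow x n (a ^ k) (b ^ k)"
  by (induction k) (simp_all add: cong_pow_refl cong_pow_mult)

lemma cong_pow_weaken: "cong_pow x n a b \<Longrightarrow> m \<le> n \<Longrightarrow> cong_pow x m a b"
  unfolding cong_pow_def by (metis le_imp_power_dvd dvd_trans)

lemma cong_pow_scale: "cong_pow x n a b \<Longrightarrow> cong_pow x (k + n) (x ^ k * a) (x ^ k * b)"
  unfolding cong_pow_def by (metis mult_dvd_mono dvd_refl power_add right_diff_distrib)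

lemma frobenius_diff: "(x - y) ^ p = x ^ p - y ^ p"
  if "prime p" "CHAR('a) = p" for x y :: "'a::comm_ring_1"
proof -
  have "((x - y) + y) ^ p = (x - y) ^ p + y ^ p" by (rule frobenius_add[OF that])
  then show ?thesis by (simp add: eq_diff_eq)
qed

lemma cong_pow_frobenius:
  fixes a b :: "'b::comm_ring_1"
  assumes "prime p" "CHAR('b) = p" "cong_pow x n a b"
  shows "cong_pow x (n * p) (a ^ p) (b ^ p)"
  using assms(3) unfolding cong_pow_def frobenius_diff[OF assms(1,2), symmetric] power_mult
  by (rule dvd_power_same)

lemma char_mpoly: "CHAR(('v, 'a::field) mpoly) = CHAR('a)"
proof (rule CHAR_eqI)
  have of_nat: "(of_nat n :: ('v, 'a) mpoly) = mconst (of_nat n)" for n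
    by (induction n) (simp_all add: mconst_add)
  show "of_nat CHAR('a) = (0 :: ('v, 'a) mpoly)" by (simp add: of_nat)
  show "CHAR('a) dvd n" if "of_nat n = (0 :: ('v, 'a) mpoly)" for n
    using that by (simp add: of_nat of_nat_eq_0_iff_char_dvd)
qed

lemma homogI: "homog d f \<Longrightarrow> d = e \<Longrightarrow> homog e f"
  by simp

lemma homog_delta: "homog 2 (delta :: 'a::field pol)"
proof -
  have "homog 2 (py ^ 2 :: 'a pol)" using homog_power[OF homog_mvar, of 2 Y] by simp
  moreover have "homog 2 (px * pz :: 'a pol)"
    using homog_mult[OF homog_mvar homog_mvar, of X Z] by (simp add: numeral_2_eq_2)
  ultimately show ?thesis unfolding delta_def by (rule homog_diff)
qed

text \<open>\<open>W\<close> is the set of the translations \<open>(a, b)\<close>. The constants are the coefficients of rows five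
  and six of \<open>\<Gamma>\<close> as combinations of the first four rows; \<open>et\<close> and \<open>al\<close> are called \<open>\<eta>\<close> and \<open>\<alpha>\<close> in comments.\<close>

locale translation_group =
  fixes p :: nat and W :: "('a::field \<times> 'a) set" and et al u1 u2 u3 u4 :: 'a
  assumes prime: "prime p" and p2: "p > 2" and char: "CHAR('a) = p"
    and finite_W: "finite W" and card_fst: "card (fst ` W) = p^2"
    and card_fibre: "\<And>a. a \<in> fst ` W \<Longrightarrow> card {b. (a, b) \<in> W} = p^2"
    and W_add: "\<And>a b c d. (a, b) \<in> W \<Longrightarrow> (c, d) \<in> W \<Longrightarrow> (a + c, b + d) \<in> W"
    and rel_a: "\<And>a b. (a, b) \<in> W \<Longrightarrow> a ^ (p^2) = et * a ^ p + al * a"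
    and rel_b: "\<And>a b. (a, b) \<in> W \<Longrightarrow> b ^ (p^2) = u1 * a + u2 * b + u3 * a ^ p + u4 * b ^ p"
    and et: "et \<noteq> 0" and al: "al \<noteq> 0"
begin

lemma char_pol: "CHAR('a pol) = p"
  using char_mpoly[where ?'v = xyz and ?'a = 'a] char by simp

lemma frob_add: "(f + g) ^ p = f ^ p + g ^ p" for f g :: "'a pol"
  by (rule frobenius_add[OF prime char_pol])

lemma frob_diff: "(f - g) ^ p = f ^ p - g ^ p" for f g :: "'a pol"
  by (rule frobenius_diff[OF prime char_pol])

lemma frob2_add: "(f + g) ^ (p^2) = f ^ (p^2) + g ^ (p^2)" for f g :: "'a pol"
  by (simp only: power2_eq_square[of p] power_mult frob_add)

lemma frob2_diff: "(f - g) ^ (p^2) = f ^ (p^2) - g ^ (p^2)" for f g :: "'a pol"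
  by (simp only: power2_eq_square[of p] power_mult frob_diff)

lemma two: "(2 :: 'a) \<noteq> 0"
proof
  assume "(2 :: 'a) = 0"
  then have "of_nat 2 = (0 :: 'a)" by simp
  then have "p dvd 2" unfolding of_nat_eq_0_iff_char_dvd char .
  then show False using p2 by (auto dest: dvd_imp_le)
qed

lemma p_le: "p + (p + 1) \<le> p^2" "1 \<le> p" "p \<le> p^2"
proof -
  have "3 * p \<le> p * p" using p2 by (intro mult_right_mono) auto
  then show "p + (p + 1) \<le> p^2" "p \<le> p^2" using p2 unfolding power2_eq_square by linarith+
  show "1 \<le> p" using p2 by simp
qed

text \<open>With \<open>w\<close> and \<open>v\<close>, all powers of \<open>x\<close> that occur become monomials in \<open>w, v, x\<close>, and no
  differences of exponents are left in ring identities.\<close>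

definition w :: "'a pol" where "w = px ^ (p^2 - p)"
definition v :: "'a pol" where "v = px ^ (p - 1)"

lemma px_powers:
  "px ^ p = v * px" "px ^ (p^2) = w * (v * px)" "px ^ (p^2 - 1) = w * v"
  "px ^ (2 * p^2 - 2 * p) = w^2" "px ^ (2 * p^2 - p) = w^2 * v * px"
  "px ^ (2 * p^2 - 2) = w^2 * v^2" "px ^ (2 * p^2 - 1) = w^2 * v^2 * px"
proof -
  have eqs: "p = (p - 1) + 1" "p^2 = (p^2 - p) + ((p - 1) + 1)" "p^2 - 1 = (p^2 - p) + (p - 1)"
    "2 * p^2 - 2 * p = (p^2 - p) * 2" "2 * p^2 - p = (p^2 - p) * 2 + (p - 1) + 1"
    "2 * p^2 - 2 = (p^2 - p) * 2 + (p - 1) * 2" "2 * p^2 - 1 = (p^2 - p) * 2 + (p - 1) * 2 + 1"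
    using p_le by linarith+
  show "px ^ p = v * px" "px ^ (p^2) = w * (v * px)" "px ^ (p^2 - 1) = w * v"
    "px ^ (2 * p^2 - 2 * p) = w^2" "px ^ (2 * p^2 - p) = w^2 * v * px"
    "px ^ (2 * p^2 - 2) = w^2 * v^2" "px ^ (2 * p^2 - 1) = w^2 * v^2 * px"
    unfolding w_def v_def power_mult[symmetric]
    by (subst eqs, simp only: power_add power_one_right)+
qed

text \<open>The equations of the coordinates \<open>a\<close> and \<open>b\<close> of a translation, homogenized and evaluated at
  \<open>y\<close> and \<open>\<delta>\<close>.\<close>

definition N :: "'a pol" where
  "N = py ^ (p^2) - mconst et * w * py ^ p - mconst al * w * v * py"

definition D :: "'a pol" where
  "D = delta ^ (p^2) - mconst u4 * delta ^ p * w^2 + mconst u3 * w^2 * v * px * py ^ p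
     - mconst u2 * delta * w^2 * v^2 + mconst u1 * w^2 * v^2 * px * py"

text \<open>\<open>sg\<close> and \<open>ta\<close> are coefficients of \<open>f\<close>. The coefficient of \<open>f N\<^bsup>p - 1\<^esup> x\<^bsup>p\<^sup>2 - p\<^esup>\<close> in \<open>h3tilde\<close> is
  \<open>ka\<close>.\<close>

definition sg :: 'a where "sg = al / et"
definition ta :: 'a where "ta = 1 / (2 * et)"
definition ka :: 'a where "ka = et + sg ^ p"

definition f_lead :: "'a pol" where
  "f_lead = py ^ (p^2) * py ^ p + mconst sg * v * py ^ (p^2) * py - mconst ta * v * px * pz ^ (p^2)"

definition f_rest :: "'a pol" where
  "f_rest = mconst u3 * v * px * py ^ p - mconst u4 * delta ^ p - mconst u2 * delta * v^2
     + mconst u1 * v^2 * px * py - mconst et ^ 2 * (py ^ p)^2 - 2 * mconst et * mconst al * v * py ^ p * py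
     - mconst al ^ 2 * v^2 * py^2"

text \<open>\<open>f = (N\<^sup>2 - D) / (- 2 \<eta> x\<^bsup>p\<^sup>2 - p\<^esup>)\<close>, split so that \<open>f_lead\<close> is \<open>f\<close> modulo \<open>x\<^bsup>p + 1\<^esup>\<close>.\<close>

definition f :: "'a pol" where
  "f = f_lead + w * (mconst ta * f_rest)"

lemma delta_frob2: "delta ^ (p^2) = (py ^ (p^2))^2 - w * (v * px) * pz ^ (p^2)"
proof -
  have "delta ^ (p^2) = (py^2) ^ (p^2) - (px * pz :: 'a pol) ^ (p^2)"
    unfolding delta_def by (rule frob2_diff)
  also have "(py^2) ^ (p^2) = (py ^ (p^2) :: 'a pol)^2"
    by (simp flip: power_mult add: mult.commute)
  also have "(px * pz :: 'a pol) ^ (p^2) = w * (v * px) * pz ^ (p^2)"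
    by (simp only: power_mult_distrib px_powers)
  finally show ?thesis .
qed

lemma f_equation: "N^2 - D = mconst (- 2 * et) * (w * f)"
proof -
  have e: "2 * mconst et * mconst ta = (1 :: 'a pol)"
  proof -
    have "2 * mconst et * mconst ta = (mconst (2 * et * ta) :: 'a pol)"
      by (simp only: mconst_mult mconst_numeral)
    then show ?thesis using et two by (simp add: ta_def)
  qed
  have s: "mconst et * mconst sg = (mconst al :: 'a pol)"
    unfolding mconst_mult[symmetric] using et by (simp add: sg_def)
  have m: "mconst (- 2 * et) = (- 2 * mconst et :: 'a pol)"
    by (simp only: mconst_mult mconst_uminus mconst_numeral)
  have "- 2 * mconst et * (w * f) = - 2 * mconst et * w * (py ^ (p^2) * py ^ p)
      - 2 * (mconst et * mconst sg) * w * v * py ^ (p^2) * py + (2 * mconst et * mconst ta) * w * v * px * pz ^ (p^2)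
      - (2 * mconst et * mconst ta) * w^2 * f_rest"
    by (simp add: f_def f_lead_def algebra_simps power2_eq_square)
  also have "\<dots> = N^2 - D"
    unfolding e s N_def D_def delta_frob2 f_rest_def by (simp add: algebra_simps power2_eq_square)
  finally show ?thesis unfolding m ..
qed

lemma shift_w [simp]: "shift a b w = w" and shift_v [simp]: "shift a b v = v"
  by (simp_all add: w_def v_def shift_hom)

lemma shift_N: assumes "(a, b) \<in> W" shows "shift a b N = N"
proof -
  have r: "mconst a ^ (p^2) = mconst et * mconst a ^ p + mconst al * (mconst a :: 'a pol)"
    using rel_a[OF assms] by (metis mconst_add mconst_mult mconst_power)
  show ?thesis
    unfolding N_def
    by (simp only: shift_hom shift_simps shift_w shift_v frob_add frob2_add power_mult_distrib r px_powers)
       (simp add: algebra_simps)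
qed

lemma shift_D: assumes "(a, b) \<in> W" shows "shift a b D = D"
proof -
  have r: "mconst b ^ (p^2) = mconst u1 * mconst a + mconst u2 * mconst b + mconst u3 * mconst a ^ p
      + mconst u4 * (mconst b ^ p :: 'a pol)"
    using rel_b[OF assms] by (metis mconst_add mconst_mult mconst_power)
  have x: "(px^2) ^ p = (v * px)^2" "(px^2) ^ (p^2) = (w * (v * px))^2"
  proof -
    have "(px^2 :: 'a pol) ^ p = (px ^ p)^2" "(px^2 :: 'a pol) ^ (p^2) = (px ^ (p^2))^2"
      unfolding power_mult[symmetric] by (simp_all only: mult.commute)
    then show "(px^2) ^ p = (v * px)^2" "(px^2) ^ (p^2) = (w * (v * px))^2"
      by (simp_all only: px_powers)
  qed
  show ?thesis
    unfolding D_def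
    by (simp only: shift_hom shift_simps shift_w shift_v shift_delta frob_add frob_diff frob2_diff
          power_mult_distrib[of "mconst _"] r x px_powers)
       (simp add: algebra_simps power2_eq_square)
qed

lemma px_nonzero [simp]: "px \<noteq> (0 :: 'a pol)"
  using mconst_px_eq_iff[of 1 "0 :: 'a"] by auto

definition inv_ring :: "'a pol set" where
  "inv_ring = {g. \<forall>a b. (a, b) \<in> W \<longrightarrow> shift a b g = g}"

lemma subalgebra_inv_ring: "subalgebra inv_ring"
  by (auto simp: subalgebra_def inv_ring_def shift_hom)

lemma inv_ring_cancel_px: "px ^ n * g \<in> inv_ring \<Longrightarrow> g \<in> inv_ring"
  unfolding inv_ring_def by (simp add: shift_hom)

lemma inv_ring_cancel_mconst: "c \<noteq> 0 \<Longrightarrow> mconst c * g \<in> inv_ring \<Longrightarrow> g \<in> inv_ring"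
  unfolding inv_ring_def by (simp add: shift_hom)

lemma px_inv: "px \<in> inv_ring" and N_inv: "N \<in> inv_ring" and D_inv: "D \<in> inv_ring"
  using shift_N shift_D by (auto simp: inv_ring_def)

lemmas inv_closed = subalgebra_closed[OF subalgebra_inv_ring]

lemma f_inv: "f \<in> inv_ring"
proof (rule inv_ring_cancel_px[of "p^2 - p"], rule inv_ring_cancel_mconst)
  show "- 2 * et \<noteq> 0" using et two by simp
  show "mconst (- 2 * et) * (px ^ (p^2 - p) * f) \<in> inv_ring"
    unfolding w_def[symmetric] f_equation[symmetric] using N_inv D_inv by (intro inv_closed)
qed

lemma homog_px_power: "homog n (px ^ n :: 'a pol)" and homog_py_power: "homog n (py ^ n :: 'a pol)"
  by (rule homogI[OF homog_power[OF homog_mvar]]; simp)+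

lemma homog_w: "homog (p^2 - p) w" and homog_v: "homog (p - 1) v"
  unfolding w_def v_def by (rule homog_px_power)+

lemma homog_N: "homog (p^2) N"
  unfolding N_def
proof (intro homog_diff)
  show "homog (p^2) (py ^ (p^2) :: 'a pol)" by (rule homog_py_power)
  show "homog (p^2) (mconst et * w * py ^ p)"
    by (rule homogI[OF homog_mult[OF homog_mconst_mult[OF homog_w] homog_py_power]])
       (use p_le in linarith)
  show "homog (p^2) (mconst al * w * v * py)"
    by (rule homogI[OF homog_mult[OF homog_mult[OF homog_mconst_mult[OF homog_w] homog_v] homog_mvar]])
       (use p_le in linarith)
qed

lemma homog_D: "homog (2 * p^2) D"
  unfolding D_def
proof (intro homog_diff homog_add)
  have w2: "homog (2 * (p^2 - p)) (w^2)" and v2: "homog (2 * (p - 1)) (v^2)"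
    using homog_power[OF homog_w, of 2] homog_power[OF homog_v, of 2] by simp_all
  show "homog (2 * p^2) (delta ^ (p^2) :: 'a pol)"
    by (rule homogI[OF homog_power[OF homog_delta]]) simp
  show "homog (2 * p^2) (mconst u4 * delta ^ p * w^2)"
    by (rule homogI[OF homog_mult[OF homog_mconst_mult[OF homog_power[OF homog_delta]] w2]])
       (use p_le in linarith)
  show "homog (2 * p^2) (mconst u3 * w^2 * v * px * py ^ p)"
    by (rule homogI[OF homog_mult[OF homog_mult[OF homog_mult[OF homog_mconst_mult[OF w2] homog_v]
          homog_mvar] homog_py_power]]) (use p_le in linarith)
  show "homog (2 * p^2) (mconst u2 * delta * w^2 * v^2)"
    by (rule homogI[OF homog_mult[OF homog_mult[OF homog_mconst_mult[OF homog_delta] w2] v2]])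
       (use p_le in linarith)
  show "homog (2 * p^2) (mconst u1 * w^2 * v^2 * px * py)"
    by (rule homogI[OF homog_mult[OF homog_mult[OF homog_mult[OF homog_mconst_mult[OF w2] v2]
          homog_mvar] homog_mvar]]) (use p_le in linarith)
qed

lemma homog_f: "homog (p^2 + p) f"
proof (rule homog_cancel_px[of "p^2 - p"])
  have "homog (2 * p^2) (N^2 - D)"
    using homog_power[OF homog_N, of 2] by (intro homog_diff homog_D) simp
  then have "homog (2 * p^2) (mconst (inverse (- 2 * et)) * (mconst (- 2 * et) * (w * f)))"
    unfolding f_equation by (rule homog_mconst_mult)
  moreover have "inverse (- 2 * et) * (- 2 * et) = 1" using et two by (intro left_inverse) simp
  then have "mconst (inverse (- 2 * et)) * (mconst (- 2 * et) * (w * f)) = w * f"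
    by (simp only: mult.assoc[symmetric] mconst_mult[symmetric] mconst_1 mult_1)
  ultimately have "homog (2 * p^2) (px ^ (p^2 - p) * f)" by (simp only: w_def)
  then show "homog (p^2 - p + (p^2 + p)) (px ^ (p^2 - p) * f)"
    by (rule homogI) (use p_le in linarith)
qed

lemmas cong_intros = cong_pow_refl cong_pow_add cong_pow_diff cong_pow_mult cong_pow_power

text \<open>Here \<open>p > 2\<close> is needed: \<open>p\<^sup>2 - p \<ge> p + 1\<close>.\<close>

lemma w_dvd: "cong_pow px (p + 1) w 0"
  unfolding cong_pow_def w_def diff_0_right by (rule le_imp_power_dvd) (use p_le in linarith)

lemma cong_N: "cong_pow px (p + 1) N (py ^ (p^2))"
proof -
  have "cong_pow px (p + 1) N (py ^ (p^2) - mconst et * 0 * py ^ p - mconst al * 0 * v * py)"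
    unfolding N_def by (intro cong_intros w_dvd)
  then show ?thesis by simp
qed

lemma cong_f: "cong_pow px (p + 1) f f_lead"
proof -
  have "cong_pow px (p + 1) f (f_lead + 0 * (mconst ta * f_rest))"
    unfolding f_def by (intro cong_intros w_dvd)
  then show ?thesis by simp
qed

lemma cong_pow_frob: "cong_pow px n g h \<Longrightarrow> cong_pow px (n * p) (g ^ p) (h ^ p)" for g h :: "'a pol"
  by (rule cong_pow_frobenius[OF prime char_pol])

lemma v_power: "v ^ p = w"
proof -
  have "(p - 1) * p = p^2 - p" by (simp add: power2_eq_square diff_mult_distrib)
  then show ?thesis unfolding v_def w_def by (simp flip: power_mult)
qed

abbreviation Yq :: "'a pol" where "Yq \<equiv> py ^ (p^2)"
abbreviation Zq :: "'a pol" where "Zq \<equiv> pz ^ (p^2)"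

text \<open>The part of \<open>h\<close> that is linear in \<open>x\<close>, divided by \<open>x\<close>. It matters because its first term
  produces the monomial \<open>z\<^bsup>p\<^sup>4\<^esup>\<close> in \<open>k\<close>.\<close>

definition h_tail :: "'a pol" where
  "h_tail = mconst (ta ^ p / sg ^ (p + 1)) * Zq ^ p - mconst (ka * ta / sg ^ (p + 1)) * (Yq ^ (p - 1) * Zq)"

lemma sg: "sg \<noteq> 0"
  using et al by (simp add: sg_def)

text \<open>Modulo \<open>x\<^bsup>p\<^sup>2 + 1\<^esup>\<close>, the right-hand side of the first equation is found by raising the
  congruences for \<open>N\<close> and \<open>f\<close> to the \<open>p\<close>-th power. The terms with \<open>x\<^bsup>p\<^sup>2 - p\<^esup>\<close> cancel by the choice
  of \<open>ka\<close>, and \<open>\<alpha> = \<eta> sg\<close> gives the coefficient \<open>ka sg - \<alpha> = sg\<^bsup>p + 1\<^esup>\<close> at \<open>x\<^bsup>p\<^sup>2 - 1\<^esup> y\<^bsup>p\<^sup>3 + 1\<^esup>\<close>.\<close>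

lemma h_exists:
  obtains h where
    "mconst (sg ^ (p + 1)) * (px ^ (p^2 - 1) * h) = N ^ (p + 1) - f ^ p + mconst ka * f * N ^ (p - 1) * w"
    "cong_pow px 2 h (Yq ^ p * py + px * h_tail)"
proof -
  let ?Y = "Yq ^ p" and ?Z = "Zq ^ p" and ?S = "mconst (sg ^ (p + 1)) :: 'a pol"
  have pow: "Yq * Yq ^ (p - 1) = ?Y" using p_le(2) by (simp flip: power_Suc)
  have le: "p^2 + 1 \<le> (p + 1) * p" using p_le by (simp add: power2_eq_square)
  have fp: "cong_pow px (p^2 + 1) (f ^ p) (f_lead ^ p)"
    by (rule cong_pow_weaken[OF cong_pow_frob[OF cong_f] le])
  have Np: "cong_pow px (p^2 + 1) (N ^ p) ?Y"
    by (rule cong_pow_weaken[OF cong_pow_frob[OF cong_N] le])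
  have "cong_pow px ((p^2 - p) + (p + 1)) (w * (f * N ^ (p - 1))) (w * (f_lead * Yq ^ (p - 1)))"
    unfolding w_def by (intro cong_pow_scale cong_intros cong_f cong_N)
  then have fN: "cong_pow px (p^2 + 1) (w * (f * N ^ (p - 1))) (w * (f_lead * Yq ^ (p - 1)))"
    by (rule cong_pow_weaken) (use p_le in simp)
  let ?h = "N ^ (p + 1) - f ^ p + mconst ka * f * N ^ (p - 1) * w"
  have eq: "?h = N ^ p * N - f ^ p + mconst ka * (w * (f * N ^ (p - 1)))"
    by (simp add: mult_ac)
  have cong: "cong_pow px (p^2 + 1) ?h (?Y * N - f_lead ^ p + mconst ka * (w * (f_lead * Yq ^ (p - 1))))"
    unfolding eq by (intro cong_intros fp Np fN)
  have flp: "f_lead ^ p = ?Y * Yq + mconst (sg ^ p) * w * ?Y * py ^ p - mconst (ta ^ p) * w * (v * px) * ?Z"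
  proof -
    have "f_lead ^ p = Yq ^ p * (py ^ p) ^ p + mconst (sg ^ p) * v ^ p * Yq ^ p * py ^ p
        - mconst (ta ^ p) * v ^ p * px ^ p * Zq ^ p"
      unfolding f_lead_def by (simp only: frob_add frob_diff power_mult_distrib mconst_power)
    also have "(py ^ p) ^ p = Yq" by (simp add: power2_eq_square flip: power_mult)
    finally show ?thesis unfolding v_power px_powers(1) by simp
  qed
  have ks: "mconst ka * mconst sg - mconst al = ?S"
  proof -
    have "ka * sg - al = sg ^ (p + 1)" using et by (simp add: ka_def sg_def field_simps)
    then show ?thesis by (metis mconst_diff mconst_mult)
  qed
  have ke: "mconst ka = mconst et + (mconst (sg ^ p) :: 'a pol)"
    by (simp add: ka_def mconst_add)
  have st: "mconst (ta ^ p) * ?Z - mconst ka * mconst ta * Yq ^ (p - 1) * Zq = ?S * h_tail"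
  proof -
    have "mconst (sg ^ (p + 1)) * mconst (ta ^ p / sg ^ (p + 1)) = (mconst (ta ^ p) :: 'a pol)"
      "mconst (sg ^ (p + 1)) * mconst (ka * ta / sg ^ (p + 1)) = (mconst (ka * ta) :: 'a pol)"
      unfolding mconst_mult[symmetric] using sg by simp_all
    then show ?thesis
      unfolding h_tail_def right_diff_distrib mult.assoc[symmetric] by (simp only: mconst_mult)
  qed
  have "?Y * N - f_lead ^ p + mconst ka * (w * (f_lead * Yq ^ (p - 1))) =
    w * v * ((mconst ka * mconst sg - mconst al) * (?Y * py)
      + px * (mconst (ta ^ p) * ?Z - mconst ka * mconst ta * Yq ^ (p - 1) * Zq))"
  proof -
    have "mconst ka * (w * (f_lead * Yq ^ (p - 1))) =
      mconst ka * w * (?Y * py ^ p) + mconst ka * mconst sg * w * v * (?Y * py)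
        - mconst ka * mconst ta * w * v * px * Yq ^ (p - 1) * Zq"
      unfolding f_lead_def pow[symmetric] by (simp add: algebra_simps)
    then show ?thesis
      unfolding flp N_def ke by (simp add: algebra_simps)
  qed
  also have "\<dots> = w * v * (?S * (?Y * py + px * h_tail))"
    unfolding ks st by (simp add: algebra_simps)
  finally have "cong_pow px (p^2 + 1) ?h (w * v * (?S * (?Y * py + px * h_tail)))"
    using cong by simp
  then obtain r where r: "?h - w * v * (?S * (?Y * py + px * h_tail)) = px ^ (p^2 + 1) * r"
    unfolding cong_pow_def by (auto elim: dvdE)
  have "px ^ (p^2 + 1) = w * v * px ^ 2"
    using px_powers(2) by (simp add: power_add power2_eq_square mult_ac)
  with r have r: "?h = w * v * (?S * (?Y * py + px * h_tail) + px^2 * r)"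
    by (simp add: algebra_simps)
  let ?g = "?Y * py + px * h_tail + px^2 * (mconst (inverse (sg ^ (p + 1))) * r)"
  have "sg ^ (p + 1) * inverse (sg ^ (p + 1)) = 1"
    by (rule right_inverse) (use sg in simp)
  then have SS: "?S * mconst (inverse (sg ^ (p + 1))) = 1"
    unfolding mconst_mult[symmetric] by (simp only: mconst_1)
  have "?S * (px^2 * (mconst (inverse (sg ^ (p + 1))) * r)) = (?S * mconst (inverse (sg ^ (p + 1)))) * (px^2 * r)"
    by (simp only: mult_ac)
  then have "?S * ?g = ?S * (?Y * py + px * h_tail) + px^2 * r"
    unfolding SS mult_1 by (simp only: distrib_left)
  then have "?S * (px ^ (p^2 - 1) * ?g) = ?h"
    unfolding px_powers r by (simp only: mult_ac)
  moreover have "cong_pow px 2 ?g (?Y * py + px * h_tail)"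
    by (simp add: cong_pow_def)
  ultimately show thesis by (rule that)
qed

lemma homog_cancel_mconst: "c \<noteq> 0 \<Longrightarrow> homog d (mconst c * g) \<Longrightarrow> homog d g" for g :: "'a pol"
  unfolding homog_def by (simp add: in_keys_iff coef_mconst_mult)

lemma h_homog_inv:
  assumes "mconst (sg ^ (p + 1)) * (px ^ (p^2 - 1) * h) = N ^ (p + 1) - f ^ p + mconst ka * f * N ^ (p - 1) * w"
  shows "homog (p^3 + 1) h" "h \<in> inv_ring"
proof -
  have s: "sg ^ (p + 1) \<noteq> 0" using sg by simp
  have "p^2 + p^2 * (p - 1) = p^2 * p" using p_le(2) by (simp add: diff_mult_distrib2)
  then have e: "p^2 + p + (p - 1) * p^2 + (p^2 - p) = p^3 + p^2"
    using p_le by (simp add: power3_eq_cube power2_eq_square mult.commute)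
  have "homog (p^3 + p^2) (N ^ (p + 1))"
    by (rule homogI[OF homog_power[OF homog_N]]) (simp add: power3_eq_cube power2_eq_square)
  moreover have "homog (p^3 + p^2) (f ^ p)"
    by (rule homogI[OF homog_power[OF homog_f]]) (simp add: power3_eq_cube power2_eq_square algebra_simps)
  moreover have "homog (p^3 + p^2) (mconst ka * f * N ^ (p - 1) * w)"
    by (rule homogI[OF homog_mult[OF homog_mult[OF homog_mconst_mult[OF homog_f] homog_power[OF homog_N]] homog_w] e])
  ultimately have "homog (p^3 + p^2) (mconst (sg ^ (p + 1)) * (px ^ (p^2 - 1) * h))"
    unfolding assms by (intro homog_diff homog_add)
  then have "homog (p^3 + p^2) (px ^ (p^2 - 1) * h)" by (rule homog_cancel_mconst[OF s])
  then show "homog (p^3 + 1) h"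
    by (rule homog_cancel_px[of "p^2 - 1", OF homogI]) (use p_le in linarith)
  have "mconst (sg ^ (p + 1)) * (px ^ (p^2 - 1) * h) \<in> inv_ring"
    unfolding assms w_def by (intro inv_closed f_inv N_inv px_inv)
  then show "h \<in> inv_ring" using inv_ring_cancel_mconst[OF s] inv_ring_cancel_px by blast
qed

text \<open>In \<open>h\<^bsup>p\<^esup> - N\<^bsup>p\<^sup>2 - 1\<^esup> f\<close> the powers of \<open>y\<close> cancel, and the last summand removes the term with
  \<open>x\<^bsup>p - 1\<^esup>\<close>. All that is left is divisible by \<open>x\<^bsup>p\<^esup>\<close>; modulo \<open>x\<close> and \<open>y\<close>, the quotient is the \<open>p\<close>-th
  power of the first term of \<open>h_tail\<close>.\<close>

lemma k_exists:
  assumes h: "cong_pow px 2 h (Yq ^ p * py + px * h_tail)" "homog (p^3 + 1) h" "h \<in> inv_ring"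
  obtains k where "px ^ p * k = h ^ p - N ^ (p^2 - 1) * f + mconst sg * px ^ (p - 1) * N ^ (p^2 - p) * h"
    "homog (p^4) k" "k \<in> inv_ring" "\<exists>c A B. c \<noteq> 0 \<and> k = mconst c * pz ^ (p^4) + px * A + py * B"
proof -
  let ?H = "Yq ^ p * py + px * h_tail" and ?U = "Yq ^ (p^2 - p)" and ?V = "Yq ^ (p^2 - 1)"
  let ?k = "h ^ p - N ^ (p^2 - 1) * f + mconst sg * px ^ (p - 1) * N ^ (p^2 - p) * h"
  have hp: "cong_pow px (p + 1) (h ^ p) (?H ^ p)"
    by (rule cong_pow_weaken[OF cong_pow_frob[OF h(1)]]) (use p_le in simp)
  have "cong_pow px 2 (N ^ (p^2 - p) * h) (?U * ?H)"
    by (intro cong_intros h(1) cong_pow_weaken[OF cong_N]) (use p2 in simp)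
  then have "cong_pow px (p - 1 + 2) (v * (N ^ (p^2 - p) * h)) (v * (?U * ?H))"
    unfolding v_def by (rule cong_pow_scale)
  then have Nh: "cong_pow px (p + 1) (v * (N ^ (p^2 - p) * h)) (v * (?U * ?H))"
    by (rule cong_pow_weaken) (use p_le in simp)
  have eq: "?k = h ^ p - N ^ (p^2 - 1) * f + mconst sg * (v * (N ^ (p^2 - p) * h))"
    by (simp add: v_def mult_ac)
  have cong: "cong_pow px (p + 1) ?k (?H ^ p - ?V * f_lead + mconst sg * (v * (?U * ?H)))"
    unfolding eq by (intro cong_intros hp cong_f cong_N Nh)
  have "p^2 = p * p" by (rule power2_eq_square)
  have Hp: "?H ^ p = ?V * Yq * py ^ p + px ^ p * h_tail ^ p"
  proof -
    have "?V * Yq = Yq ^ (p^2)"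
      using p_le by (simp flip: power_Suc2)
    also have "\<dots> = (Yq ^ p) ^ p" by (simp add: power2_eq_square mult.assoc flip: power_mult)
    finally show ?thesis by (simp only: frob_add power_mult_distrib)
  qed
  have UV: "?U * Yq ^ p = ?V * Yq"
  proof -
    have "p^2 - p + p = p^2 - 1 + 1" using p_le by simp
    then have "Yq ^ (p^2 - p + p) = Yq ^ (p^2 - 1 + 1)" by (rule arg_cong)
    then show ?thesis unfolding power_add power_one_right .
  qed
  let ?K = "h_tail ^ p + mconst ta * ?V * Zq + mconst sg * ?U * h_tail"
  have "?H ^ p - ?V * f_lead + mconst sg * (v * (?U * ?H)) = px ^ p * ?K"
  proof -
    have "mconst sg * (v * (?U * ?H)) = mconst sg * v * (?U * Yq ^ p) * py + mconst sg * (v * px) * ?U * h_tail"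
      by (simp add: algebra_simps)
    then show ?thesis
      unfolding Hp UV f_lead_def px_powers(1) by (simp add: algebra_simps)
  qed
  with cong obtain r where r: "?k - px ^ p * ?K = px ^ (p + 1) * r"
    unfolding cong_pow_def by (auto elim: dvdE)
  define k where "k = ?K + px * r"
  have k: "px ^ p * k = ?k"
    using r by (simp add: k_def algebra_simps)
  have hom: "homog (p^4 + p) ?k"
  proof (intro homog_add homog_diff)
    have p4: "p^4 = p^2 * p^2" "p^4 = p * p^3" "p^3 = p^2 * p"
      by (simp_all add: power_numeral_reduce)
    show "homog (p^4 + p) (h ^ p)"
      by (rule homogI[OF homog_power[OF h(2)]]) (simp add: p4(2) algebra_simps)
    have "p^2 - 1 + 1 = p^2" using p_le by linarith
    then have "(p^2 - 1) * p^2 + p^2 = p^4"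
      unfolding p4(1) by (metis distrib_right mult_1)
    then show "homog (p^4 + p) (N ^ (p^2 - 1) * f)"
      by (intro homogI[OF homog_mult[OF homog_power[OF homog_N] homog_f]]) linarith
    have "(p^2 - p) * p^2 + p^3 = p^4"
    proof -
      have "p^2 - p + p = p^2" using p_le by linarith
      then show ?thesis
        unfolding p4(1,3) by (metis distrib_right mult.commute)
    qed
    then show "homog (p^4 + p) (mconst sg * px ^ (p - 1) * N ^ (p^2 - p) * h)"
      by (intro homogI[OF homog_mult[OF homog_mult[OF homog_mconst_mult[OF homog_px_power]
            homog_power[OF homog_N]] h(2)]]) (use p_le in linarith)
  qed
  have "homog (p^4) k"
    by (rule homog_cancel_px[of p], unfold k, rule homogI[OF hom]) (rule add.commute)
  moreover have "k \<in> inv_ring"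
  proof (rule inv_ring_cancel_px[of p])
    show "px ^ p * k \<in> inv_ring" unfolding k by (intro inv_closed f_inv N_inv px_inv h(3))
  qed
  moreover have "\<exists>c A B. c \<noteq> 0 \<and> k = mconst c * pz ^ (p^4) + px * A + py * B"
  proof -
    have ydvd: "py dvd Yq ^ n" if "n > 0" for n
    proof -
      have "p^2 * n > 0" using that p_le by simp
      then show ?thesis unfolding power_mult[symmetric] by (intro dvd_power) auto
    qed
    let ?c = "ta ^ p / sg ^ (p + 1)"
    let ?T = "mconst ta * ?V * Zq + mconst sg * ?U * h_tail
         - mconst (ka * ta / sg ^ (p + 1)) ^ p * ((Yq ^ (p - 1)) ^ p * Zq ^ p)"
    have z: "(Zq ^ p) ^ p = pz ^ (p^4)"
      by (simp flip: power_mult add: power_numeral_reduce power2_eq_square mult.assoc)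
    have htp: "h_tail ^ p = mconst (?c ^ p) * pz ^ (p^4) - mconst (ka * ta / sg ^ (p + 1)) ^ p * ((Yq ^ (p - 1)) ^ p * Zq ^ p)"
      unfolding h_tail_def by (simp only: frob_diff power_mult_distrib mconst_power z)
    have "k = mconst (?c ^ p) * pz ^ (p^4) + px * r +
       ?T"
      unfolding k_def htp by (simp only: algebra_simps)
    moreover have "py dvd ?T"
    proof (intro dvd_diff dvd_add)
      have "py dvd ?V" "py dvd ?U" using p_le by (auto intro!: ydvd)
      then show "py dvd mconst ta * ?V * Zq" "py dvd mconst sg * ?U * h_tail"
        by (simp_all only: dvd_mult dvd_mult2)
      have "py dvd (Yq ^ (p - 1)) ^ p"
        unfolding power_mult[symmetric, of Yq] by (rule ydvd) (use p2 in simp)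
      then show "py dvd mconst (ka * ta / sg ^ (p + 1)) ^ p * ((Yq ^ (p - 1)) ^ p * Zq ^ p)"
        by (intro dvd_mult[OF dvd_mult2])
    qed
    then obtain B where "?T = py * B"
      by (rule dvdE)
    moreover have "?c ^ p \<noteq> 0" using sg et two by (simp add: ta_def)
    ultimately have "?c ^ p \<noteq> 0 \<and> k = mconst (?c ^ p) * pz ^ (p^4) + px * r + py * B" by simp
    then show ?thesis by blast
  qed
  ultimately show thesis using that[OF k] by blast
qed

end

section \<open>Adjoining an integral element\<close>

text \<open>The module spanned by the powers of \<open>t\<close> below the \<open>n\<close>-th one. It is the ring \<open>C[t]\<close> as soon as
  it contains \<open>t\<^sup>n\<close>.\<close>

definition adjoin :: "'b::comm_ring_1 set \<Rightarrow> 'b \<Rightarrow> nat \<Rightarrow> 'b set" where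
  "adjoin C t n = {\<Sum>i<n. c i * t ^ i | c. \<forall>i. c i \<in> C}"

lemma adjoin_add:
  assumes C: "subalgebra C" and "f \<in> adjoin C t n" "g \<in> adjoin C t n"
  shows "f + g \<in> adjoin C t n"
proof -
  obtain c d where "f = (\<Sum>i<n. c i * t ^ i)" "g = (\<Sum>i<n. d i * t ^ i)" "\<forall>i. c i \<in> C" "\<forall>i. d i \<in> C"
    using assms(2,3) unfolding adjoin_def by blast
  then have "f + g = (\<Sum>i<n. (c i + d i) * t ^ i)" "\<forall>i. c i + d i \<in> C"
    using subalgebra_closed(4)[OF C] by (simp_all add: distrib_right sum.distrib)
  then show ?thesis unfolding adjoin_def by (intro CollectI exI[of _ "\<lambda>i. c i + d i"]) simp
qed

lemma adjoin_scale:
  assumes C: "subalgebra C" and "a \<in> C" "f \<in> adjoin C t n"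
  shows "a * f \<in> adjoin C t n"
proof -
  obtain c where "f = (\<Sum>i<n. c i * t ^ i)" "\<forall>i. c i \<in> C"
    using assms(3) unfolding adjoin_def by blast
  then have "a * f = (\<Sum>i<n. (a * c i) * t ^ i)" "\<forall>i. a * c i \<in> C"
    using subalgebra_closed(5)[OF C assms(2)] by (simp_all add: sum_distrib_left mult.assoc)
  then show ?thesis unfolding adjoin_def by (intro CollectI exI[of _ "\<lambda>i. a * c i"]) simp
qed

lemma adjoin_power:
  assumes C: "subalgebra C" and "i < n"
  shows "t ^ i \<in> adjoin C t n"
proof -
  have "t ^ i = (\<Sum>j<n. (if j = i then 1 else 0) * t ^ j)"
    using assms(2) by (simp add: if_distrib[of "\<lambda>x. x * _"] cong: if_cong)
  then show ?thesis
    unfolding adjoin_def using subalgebra_closed(2,3)[OF C]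
    by (intro CollectI exI[of _ "\<lambda>j. if j = i then 1 else 0"]) simp
qed

lemma adjoin_base:
  assumes C: "subalgebra C" and "0 < n" "a \<in> C"
  shows "a \<in> adjoin C t n"
  using adjoin_scale[OF C assms(3) adjoin_power[OF C assms(2)]] by simp

lemma adjoin_sum:
  assumes C: "subalgebra C" and n: "0 < n" and "\<And>i. i \<in> I \<Longrightarrow> f i \<in> adjoin C t n"
  shows "sum f I \<in> adjoin C t n"
  using assms(3)
proof (induction I rule: infinite_finite_induct)
  case (insert i I)
  then show ?case using adjoin_add[OF C] by simp
qed (simp_all add: adjoin_base[OF C n subalgebra_closed(2)[OF C]])

lemma subalgebra_adjoin:
  assumes C: "subalgebra C" and n: "0 < n" and int: "t ^ n \<in> adjoin C t n"
  shows "subalgebra (adjoin C t n)"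
proof -
  let ?S = "adjoin C t n"
  have t: "t * f \<in> ?S" if f: "f \<in> ?S" for f
  proof -
    obtain c where c: "f = (\<Sum>i<n. c i * t ^ i)" "\<forall>i. c i \<in> C"
      using f unfolding adjoin_def by blast
    have "c i * t ^ Suc i \<in> ?S" if "i < n" for i
    proof (cases "Suc i < n")
      case True
      then show ?thesis using adjoin_scale[OF C _ adjoin_power[OF C True]] c(2) by blast
    next
      case False
      then have "Suc i = n" using that by simp
      then show ?thesis using adjoin_scale[OF C _ int] c(2) by simp
    qed
    then have "(\<Sum>i<n. c i * t ^ Suc i) \<in> ?S" by (intro adjoin_sum[OF C n]) simp
    moreover have "t * f = (\<Sum>i<n. c i * t ^ Suc i)"
      unfolding c(1) sum_distrib_left by (simp add: mult_ac)
    ultimately show ?thesis by simp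
  qed
  have tp: "t ^ i * f \<in> ?S" if "f \<in> ?S" for f i
    using that by (induction i) (simp_all add: t mult.assoc)
  have "f * g \<in> ?S" if f: "f \<in> ?S" and g: "g \<in> ?S" for f g
  proof -
    obtain c where c: "f = (\<Sum>i<n. c i * t ^ i)" "\<forall>i. c i \<in> C"
      using f unfolding adjoin_def by blast
    have "c i * (t ^ i * g) \<in> ?S" for i
      using adjoin_scale[OF C _ tp[OF g]] c(2) by blast
    then have "(\<Sum>i<n. c i * (t ^ i * g)) \<in> ?S" by (intro adjoin_sum[OF C n]) simp
    then show ?thesis unfolding c(1) sum_distrib_right by (simp add: mult.assoc)
  qed
  moreover have "mconst c \<in> ?S" for c
    by (rule adjoin_base[OF C n subalgebra_closed(1)[OF C]])
  ultimately show ?thesis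
    unfolding subalgebra_def using adjoin_add[OF C] by blast
qed

text \<open>Below degree \<open>n\<close>, a polynomial is determined by its values at \<open>n\<close> points.\<close>

lemma coefficients_of_constant:
  fixes s :: "nat \<Rightarrow> 'b::idom"
  assumes "finite T" "card T = n" "0 < n" "\<And>t. t \<in> T \<Longrightarrow> (\<Sum>j<n. s j * t ^ j) = g"
  shows "s 0 = g"
proof -
  let ?P = "\<Sum>j<n. Polynomial.monom (s j) j"
  have "degree ?P \<le> n - 1"
    by (rule degree_sum_le) (auto intro: order_trans[OF degree_monom_le])
  then have "degree ?P < card T" using assms(2,3) by linarith
  moreover have "poly ?P t = poly [:g:] t" if "t \<in> T" for t
    using assms(4)[OF that] by (simp add: poly_sum poly_monom)
  ultimately have "?P = [:g:]"
    by (intro poly_eqI_degree[of T]) (use assms(2,3) in auto)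
  then have "coeff ?P 0 = g" by simp
  then show ?thesis using assms(3) by (simp add: coeff_sum)
qed

context translation_group
begin

section \<open>Orbit products\<close>

lemma minus_power_p: "(- g) ^ p = - (g ^ p)" for g :: "'a pol"
  using frob_diff[of 0 g] zero_power[of p, where ?'a = "'a pol"] p2 by simp

text \<open>As polynomials in \<open>y\<close>, both sides are monic of degree \<open>p\<^sup>2\<close>, and they agree at the \<open>p\<^sup>2\<close> points
  \<open>- a x\<close>.\<close>

lemma N_prod: "(\<Prod>a\<in>fst ` W. py + mconst a * px) = N"
proof -
  let ?A = "fst ` W"
  let ?Q = "\<Prod>a\<in>?A. [:mconst a * px :: 'a pol, 1:]"
  let ?R = "Polynomial.monom 1 (p^2) - (Polynomial.monom (mconst et * w) p + Polynomial.monom (mconst al * w * v) 1)"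
  let ?T = "(\<lambda>a. - (mconst a * px :: 'a pol)) ` ?A"
  have pp: "p < p^2" "1 < p^2" using p_le p2 by linarith+
  have deg2: "degree (Polynomial.monom (mconst et * w) p + Polynomial.monom (mconst al * w * v) 1) < p^2"
    using pp p_le by (intro le_less_trans[OF degree_add_le[of _ p]] order_trans[OF degree_monom_le]) auto
  have "?Q = ?R"
  proof (rule poly_eqI_degree_lead_coeff[where A = ?T and n = "p^2"])
    have inj: "inj_on (\<lambda>a. - (mconst a * px :: 'a pol)) ?A"
      by (rule inj_onI) (metis neg_equal_iff_equal mconst_px_eq_iff)
    show "p^2 \<le> card ?T" using card_image[OF inj] card_fst by simp
    have "degree ?Q = (\<Sum>a\<in>?A. degree [:mconst a * px :: 'a pol, 1:])"
      by (rule degree_prod_eq_sum_degree) simp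
    then have dQ: "degree ?Q = p^2" using card_fst by simp
    then show "degree ?Q \<le> p^2" by simp
    show "degree ?R \<le> p^2"
      using deg2 by (intro degree_diff_le degree_monom_le) simp
    have "lead_coeff ?Q = 1" by (simp add: lead_coeff_prod)
    then show "coeff ?Q (p^2) = coeff ?R (p^2)"
      unfolding dQ coeff_diff coeff_eq_0[OF deg2] by simp
    fix t assume "t \<in> ?T"
    then obtain a b where ab: "(a, b) \<in> W" "t = - (mconst a * px)" by auto
    have "poly [:mconst a * px, 1:] t = 0" by (simp add: ab(2))
    moreover have "a \<in> ?A" using ab(1) by force
    ultimately have "poly ?Q t = 0"
      unfolding poly_prod using finite_W by (intro prod_zero) blast+
    moreover have "poly ?R t = 0"
    proof -
      have r: "mconst a ^ (p^2) = mconst et * mconst a ^ p + mconst al * (mconst a :: 'a pol)"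
        using rel_a[OF ab(1)] by (metis mconst_add mconst_mult mconst_power)
      have tp: "t ^ p = - (mconst a ^ p * (v * px))"
        unfolding ab(2) minus_power_p power_mult_distrib px_powers ..
      have "t ^ (p^2) = (t ^ p) ^ p" by (simp add: power2_eq_square power_mult)
      also have "\<dots> = - (mconst a ^ (p^2) * (w * (v * px)))"
        unfolding ab(2) minus_power_p power_mult_distrib power2_eq_square power_mult[symmetric]
        unfolding power2_eq_square[symmetric] px_powers ..
      finally show ?thesis
        unfolding r by (simp add: poly_monom tp) (simp add: ab(2) algebra_simps)
    qed
    ultimately show "poly ?Q t = poly ?R t" by simp
  qed
  then have "poly ?Q py = poly ?R py" by simp
  then show ?thesis by (simp add: poly_prod poly_monom N_def add.commute)
qed

definition Nz :: "'a pol" where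
  "Nz = (\<Prod>(a, b)\<in>W. shift a b pz)"

lemma card_W: "card W = p^4"
proof -
  have "card (Sigma (fst ` W) (\<lambda>a. {b. (a, b) \<in> W})) = (\<Sum>a\<in>fst ` W. card {b. (a, b) \<in> W})"
  proof (rule card_SigmaI)
    show "finite (fst ` W)" using finite_W by simp
    show "\<forall>a\<in>fst ` W. finite {b. (a, b) \<in> W}"
    proof
      fix a assume "a \<in> fst ` W"
      then have "0 < card {b. (a, b) \<in> W}" using card_fibre p2 by simp
      then show "finite {b. (a, b) \<in> W}" by (rule card_ge_0_finite)
    qed
  qed
  moreover have "Sigma (fst ` W) (\<lambda>a. {b. (a, b) \<in> W}) = W" by force
  ultimately have "card W = (\<Sum>a\<in>fst ` W. p^2)" using card_fibre by simp
  then show ?thesis using card_fst by (simp flip: power_add)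
qed

lemma Nz_inv: "Nz \<in> inv_ring"
  unfolding inv_ring_def
proof (intro CollectI allI impI)
  fix a b assume ab: "(a, b) \<in> W"
  let ?t = "\<lambda>(c, d). (a + c, b + d)"
  have inj: "inj_on ?t W" by (auto intro!: inj_onI)
  have "?t ` W \<subseteq> W" using W_add[OF ab] by auto
  then have img: "?t ` W = W" by (rule endo_inj_surj[OF finite_W _ inj])
  have "shift a b Nz = (\<Prod>e\<in>W. (\<lambda>(c, d). shift c d pz) (?t e))"
    unfolding Nz_def shift_prod
    by (rule prod.cong) (auto simp: shift_shift simp del: shift_simps)
  also have "\<dots> = (\<Prod>e\<in>?t ` W. (\<lambda>(c, d). shift c d pz) e)"
    by (subst prod.reindex[OF inj]) simp
  also have "\<dots> = Nz" unfolding img Nz_def ..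
  finally show "shift a b Nz = Nz" .
qed

lemma Nz_leads: "leads Nz (single Z (p^4)) 1"
proof -
  have factor: "shift a b (pz :: 'a pol) = pz + px * mconst (a^2 + b) + py * (2 * mconst a)" for a b
    by (simp add: algebra_simps)
  have "homog 1 (shift a b (pz :: 'a pol))" for a b
  proof -
    have "homog 1 (pz + mconst (a^2 + b) * px + mconst (2 * a) * py :: 'a pol)"
      by (intro homog_add homog_mconst_mult homog_mvar)
    moreover have "pz + mconst (a^2 + b) * px + mconst (2 * a) * py = shift a b (pz :: 'a pol)"
      by (simp only: factor mconst_mult mconst_numeral mult_ac)
    ultimately show ?thesis by simp
  qed
  then have "homog (card W) Nz" unfolding Nz_def by (intro homog_prod) auto
  then have hom: "homog (p^4) Nz" by (simp only: card_W)
  have "\<exists>A B. (\<Prod>e\<in>S. shift (fst e) (snd e) pz) = pz ^ card S + px * A + py * (B :: 'a pol)"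
    if "finite S" for S :: "('a \<times> 'a) set"
    using that
  proof induction
    case empty
    show ?case by (auto intro!: exI[of _ 0])
  next
    case (insert e S)
    then obtain A B where "(\<Prod>e\<in>S. shift (fst e) (snd e) pz) = pz ^ card S + px * A + py * (B :: 'a pol)"
      by blast
    then have "(\<Prod>e\<in>insert e S. shift (fst e) (snd e) pz) = pz ^ card (insert e S)
      + px * (pz * A + mconst (fst e ^ 2 + snd e) * (pz ^ card S + px * A + py * B))
      + py * (pz * B + 2 * mconst (fst e) * (pz ^ card S + px * A + py * B))"
      using insert.hyps by (simp only: prod.insert card.insert factor) (simp add: algebra_simps)
    then show ?case by blast
  qed
  from this[OF finite_W] obtain A B where "(\<Prod>e\<in>W. shift (fst e) (snd e) pz) = pz ^ card W + px * A + py * (B :: 'a pol)"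
    by blast
  then have "Nz = mconst 1 * pz ^ (p^4) + px * A + py * B"
    by (simp add: Nz_def case_prod_unfold card_W del: shift_simps)
  then show ?thesis by (rule leads_z_power[OF hom]) simp
qed

section \<open>Localizing at \<open>x\<close>\<close>

lemma q_pos: "0 < p^2" "p < p^2" "1 < p^2"
  using p_le p2 by linarith+

context
  fixes C :: "'a pol set"
  assumes C: "subalgebra C" and C_inv: "C \<subseteq> inv_ring"
    and px_C: "px \<in> C" and N_C: "N \<in> C" and D_C: "D \<in> C"
begin

abbreviation "C_y \<equiv> adjoin C py (p^2)"
abbreviation "C_yd \<equiv> adjoin C_y delta (p^2)"

lemma wv_C: "w \<in> C" "v \<in> C"
  unfolding w_def v_def using subalgebra_closed(8)[OF C px_C] by blast+

lemma subalgebra_C_y: "subalgebra C_y"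
proof (rule subalgebra_adjoin[OF C q_pos(1)])
  note c = subalgebra_closed[OF C]
  have "mconst et * w * py ^ p \<in> C_y"
    by (intro adjoin_scale[OF C] adjoin_power[OF C] c wv_C q_pos)
  moreover have "mconst al * w * v * py ^ 1 \<in> C_y"
    by (intro adjoin_scale[OF C] adjoin_power[OF C] c wv_C q_pos)
  ultimately have "N + (mconst et * w * py ^ p + mconst al * w * v * py ^ 1) \<in> C_y"
    by (intro adjoin_add[OF C adjoin_base[OF C q_pos(1) N_C]] adjoin_add[OF C])
  then show "py ^ (p^2) \<in> C_y" by (simp add: N_def)
qed

lemma C_C_y: "a \<in> C \<Longrightarrow> a \<in> C_y"
  by (rule adjoin_base[OF C q_pos(1)])

lemma py_C_y: "py \<in> C_y"
  using adjoin_power[OF C q_pos(3), of py] by simp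

lemma subalgebra_C_yd: "subalgebra C_yd"
proof (rule subalgebra_adjoin[OF subalgebra_C_y q_pos(1)])
  note c = subalgebra_closed[OF subalgebra_C_y]
  have "(mconst u4 * w^2) * delta ^ p \<in> C_yd"
    by (intro adjoin_scale[OF subalgebra_C_y] adjoin_power[OF subalgebra_C_y] c C_C_y wv_C q_pos)
  moreover have "(mconst u2 * w^2 * v^2) * delta ^ 1 \<in> C_yd"
    by (intro adjoin_scale[OF subalgebra_C_y] adjoin_power[OF subalgebra_C_y] c C_C_y wv_C q_pos)
  moreover have "D - mconst u3 * w^2 * v * px * py ^ p - mconst u1 * w^2 * v^2 * px * py \<in> C_yd"
    by (intro adjoin_base[OF subalgebra_C_y] q_pos c C_C_y[OF wv_C(1)] C_C_y[OF wv_C(2)] C_C_y[OF px_C] C_C_y[OF D_C] py_C_y)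
  ultimately have "(mconst u4 * w^2) * delta ^ p + (mconst u2 * w^2 * v^2) * delta ^ 1
      + (D - mconst u3 * w^2 * v * px * py ^ p - mconst u1 * w^2 * v^2 * px * py) \<in> C_yd"
    by (intro adjoin_add[OF subalgebra_C_y])
  then show "delta ^ (p^2) \<in> C_yd" by (simp add: D_def algebra_simps)
qed

text \<open>Up to a power of \<open>x\<close>, every polynomial is one in \<open>x\<close>, \<open>y\<close> and \<open>\<delta>\<close>, because
  \<open>x z = y\<^sup>2 - \<delta>\<close>.\<close>

lemma px_power_in_C_yd: "\<exists>n. px ^ n * g \<in> C_yd"
proof (induction g rule: mpoly_induct)
  case (single m c)
  note cl = subalgebra_closed[OF subalgebra_C_yd]
  have base: "px \<in> C_yd" "py \<in> C_yd" "delta \<in> C_yd"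
    using adjoin_base[OF subalgebra_C_y q_pos(1)] C_C_y[OF px_C] py_C_y
      adjoin_power[OF subalgebra_C_y q_pos(3), of delta] by auto
  have fin: "finite (UNIV :: xyz set)" unfolding UNIV_xyz by simp
  have "mprod mvar m = (\<Prod>u\<in>UNIV. mvar u ^ expo m u :: 'a pol)"
    by (rule mprod_superset[OF fin]) simp
  then have m: "mprod mvar m = px ^ expo m X * py ^ expo m Y * (pz ^ expo m Z :: 'a pol)"
    unfolding UNIV_xyz by (simp add: mult.assoc)
  have "px ^ expo m Z * single m c =
     mconst c * (px ^ expo m X * py ^ expo m Y * (px * pz) ^ expo m Z)"
    unfolding single_eq_mprod m power_mult_distrib by (simp only: mult_ac)
  also have "px * pz = py^2 - (delta :: 'a pol)" by (simp add: delta_def)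
  also have "mconst c * (px ^ expo m X * py ^ expo m Y * (py^2 - delta) ^ expo m Z) \<in> C_yd"
    by (intro cl base)
  finally show ?case by blast
next
  case (add g h)
  obtain i j where ij: "px ^ i * g \<in> C_yd" "px ^ j * h \<in> C_yd" using add by blast
  note cl = subalgebra_closed[OF subalgebra_C_yd]
  have px: "px \<in> C_yd" using adjoin_base[OF subalgebra_C_y q_pos(1)] C_C_y[OF px_C] by blast
  have "px ^ j * (px ^ i * g) + px ^ i * (px ^ j * h) \<in> C_yd"
    using cl(4)[OF cl(5)[OF cl(8)[OF px] ij(1)] cl(5)[OF cl(8)[OF px] ij(2)]] .
  moreover have "px ^ j * (px ^ i * g) + px ^ i * (px ^ j * h) = px ^ (i + j) * (g + h)"
    by (simp add: power_add algebra_simps)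
  ultimately show ?case by metis
qed

text \<open>An invariant is a polynomial in \<open>y\<close> and \<open>\<delta>\<close> over \<open>C\<close> which takes the same value at all
  translates of \<open>(y, \<delta>)\<close>. For fixed \<open>a\<close> the \<open>p\<^sup>2\<close> translates \<open>\<delta> - b x\<^sup>2\<close> are too many for its degree
  in \<open>\<delta>\<close>, so its value is that of its constant term in \<open>\<delta>\<close>; then the \<open>p\<^sup>2\<close> translates \<open>y + a x\<close> are
  too many for the degree of that term in \<open>y\<close>.\<close>

lemma inv_C_yd:
  assumes "g \<in> C_yd" "g \<in> inv_ring"
  shows "g \<in> C"
proof -
  obtain d where d: "g = (\<Sum>j<p^2. d j * delta ^ j)" "\<forall>j. d j \<in> C_y"
    using assms(1) unfolding adjoin_def[of C_y] by blast
  obtain e where e: "d 0 = (\<Sum>i<p^2. e i * py ^ i)" "\<forall>i. e i \<in> C"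
    using d(2) unfolding adjoin_def by blast
  have d0: "shift a b (d 0) = (\<Sum>i<p^2. e i * (py + mconst a * px) ^ i)" if "(a, b) \<in> W" for a b
  proof -
    have "shift a b (e i) = e i" for i
      using e(2) C_inv that unfolding inv_ring_def by blast
    then show ?thesis unfolding e(1) shift_sum by (simp add: shift_hom)
  qed
  have dj: "shift a b (d j) = shift a b' (d j)" if "(a, b) \<in> W" "(a, b') \<in> W" for a b b' j
  proof -
    obtain e where e: "d j = (\<Sum>i<p^2. e i * py ^ i)" "\<forall>i. e i \<in> C"
      using d(2) unfolding adjoin_def by blast
    have "shift a b (e i) = e i" "shift a b' (e i) = e i" for i
      using e(2) C_inv that unfolding inv_ring_def by blast+
    then show ?thesis unfolding e(1) shift_sum by (simp add: shift_hom)
  qed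
  have "(\<Sum>i<p^2. e i * (py + mconst a * px) ^ i) = g" if a: "a \<in> fst ` W" for a
  proof -
    obtain b where b: "(a, b) \<in> W" using a by auto
    let ?F = "{b. (a, b) \<in> W}"
    let ?T = "(\<lambda>b. delta - mconst b * px^2 :: 'a pol) ` ?F"
    have fin: "finite ?F" using card_fibre[OF a] q_pos(1) card.infinite by force
    have inj: "inj_on (\<lambda>b. delta - mconst b * px^2 :: 'a pol) ?F"
    proof (rule inj_onI)
      fix b b' assume "delta - mconst b * px^2 = delta - mconst b' * (px^2 :: 'a pol)"
      then have "(mconst b * px) * px = (mconst b' * px) * (px :: 'a pol)"
        by (simp add: power2_eq_square mult.assoc)
      then have "mconst b * px = mconst b' * (px :: 'a pol)" by (simp only: mult_right_cancel[OF px_nonzero])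
      then show "b = b'" by (simp only: mconst_px_eq_iff)
    qed
    have "shift a b (d 0) = g"
    proof (rule coefficients_of_constant)
      show "finite ?T" using fin by simp
      show "card ?T = p^2" using card_image[OF inj] card_fibre[OF a] by simp
      show "0 < p^2" by (rule q_pos)
      fix t assume "t \<in> ?T"
      then obtain b' where b': "(a, b') \<in> W" "t = delta - mconst b' * px^2" by auto
      have "g = shift a b' g" using assms(2) b'(1) by (simp add: inv_ring_def)
      also have "\<dots> = (\<Sum>j<p^2. shift a b (d j) * t ^ j)"
        unfolding d(1) shift_sum by (simp add: shift_hom shift_delta b'(2) dj[OF b'(1) b])
      finally show "(\<Sum>j<p^2. shift a b (d j) * t ^ j) = g" ..
    qed
    then show ?thesis using d0[OF b] by simp
  qed
  moreover have "inj_on (\<lambda>a. py + mconst a * px :: 'a pol) (fst ` W)"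
    by (rule inj_onI) (metis mconst_px_eq_iff add_left_cancel)
  then have "card ((\<lambda>a. py + mconst a * px :: 'a pol) ` fst ` W) = p^2"
    by (simp add: card_image card_fst)
  ultimately have "e 0 = g"
    by (intro coefficients_of_constant[of "(\<lambda>a. py + mconst a * px) ` fst ` W" "p^2" e g])
       (use finite_W q_pos(1) in auto)
  then show ?thesis using e(2) by auto
qed

lemma inv_ring_localized: "g \<in> inv_ring \<Longrightarrow> \<exists>n. px ^ n * g \<in> C"
proof -
  assume g: "g \<in> inv_ring"
  obtain n where n: "px ^ n * g \<in> C_yd" using px_power_in_C_yd by blast
  have "px ^ n * g \<in> inv_ring" by (intro inv_closed g px_inv)
  then show ?thesis using inv_C_yd[OF n] by blast
qed

end

end

section \<open>The ring of invariants\<close>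

lemma gen_leads_single_minus:
  fixes Q :: "(nat, 'a::idom) mpoly"
  assumes "\<And>K. K \<in> keys Q \<Longrightarrow> gen_order p K < gen_order p L"
  shows "gen_leads p (single L 1 - Q) L"
  unfolding gen_leads_def
proof (intro conjI ballI impI)
  have "L \<notin> keys Q" using assms by blast
  then show "coef (single L 1 - Q) L = 1"
    by (simp add: lookup_minus in_keys_iff)
  fix K assume "K \<in> keys (single L 1 - Q)" "K \<noteq> L"
  then have "K \<in> keys Q" by (auto simp: in_keys_iff lookup_minus lookup_single)
  then show "gen_order p K < gen_order p L" by (rule assms)
qed

lemma gen_order_single:
  "gen_order p (single 0 n) = 0"
  "gen_order p (single 1 n) = (p^4 + p + 1) * (p^2 * n)"
  "gen_order p (single 2 n) = (p^4 + p + 1) * ((p^2 + p) * n) + n"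
  "gen_order p (single 3 n) = (p^4 + p + 1) * ((p^3 + 1) * n) + 2 * n"
  "gen_order p (single 4 n) = (p^4 + p + 1) * (p^4 * n)"
  by (simp_all add: gen_order_def gen_weight_def lookup_single)

lemma weighted_less:
  fixes a b c d e :: nat
  assumes "a < b" "c < d"
  shows "d * a + c < d * b + e"
proof -
  have "d * a + c < d * Suc a" using assms(2) by simp
  also have "\<dots> \<le> d * b" using assms(1) by (intro mult_left_mono) auto
  finally show ?thesis by simp
qed

context translation_group
begin

lemma leads_from_cong:
  assumes "homog d g" "cong_pow px n g (py ^ d)" "n > 0"
  shows "leads g (single Y d) 1"
proof -
  have "cong_pow px 1 g (py ^ d)" by (rule cong_pow_weaken[OF assms(2)]) (use assms(3) in simp)
  then have "px dvd g - py ^ d" by (simp add: cong_pow_def)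
  then obtain A where "g - py ^ d = px * A" by (rule dvdE)
  then have "g = py ^ d + px * A" by (simp add: algebra_simps)
  then show ?thesis by (rule leads_y_power[OF assms(1)])
qed

lemma N_leads: "leads N (single Y (p^2)) 1"
  by (rule leads_from_cong[OF homog_N cong_N]) simp

lemma f_leads: "leads f (single Y (p^2 + p)) 1"
proof (rule leads_from_cong[OF homog_f])
  have "cong_pow px 1 v 0"
    unfolding cong_pow_def v_def diff_0_right by (rule le_imp_power_dvd) (use p2 in simp)
  then have "cong_pow px 1 f_lead (py ^ (p^2) * py ^ p + mconst sg * 0 * py ^ (p^2) * py - mconst ta * 0 * px * pz ^ (p^2))"
    unfolding f_lead_def by (intro cong_intros)
  moreover have "cong_pow px 1 f f_lead" by (rule cong_pow_weaken[OF cong_f]) simp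
  ultimately have "cong_pow px 1 f (py ^ (p^2) * py ^ p + mconst sg * 0 * py ^ (p^2) * py - mconst ta * 0 * px * pz ^ (p^2))"
    using cong_pow_trans by blast
  then show "cong_pow px 1 f (py ^ (p^2 + p))" by (simp add: power_add)
qed simp

lemma h_leads:
  assumes "homog (p^3 + 1) h" "cong_pow px 2 h (Yq ^ p * py + px * h_tail)"
  shows "leads h (single Y (p^3 + 1)) 1"
proof (rule leads_from_cong[OF assms(1)])
  have y: "Yq ^ p * py = py ^ (p^3 + 1)"
    by (simp add: power_add power3_eq_cube power2_eq_square flip: power_mult)
  have "cong_pow px 1 (Yq ^ p * py + px * h_tail) (py ^ (p^3 + 1))"
    unfolding y by (simp add: cong_pow_def)
  moreover have "cong_pow px 1 h (Yq ^ p * py + px * h_tail)"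
    by (rule cong_pow_weaken[OF assms(2)]) simp
  ultimately show "cong_pow px 1 h (py ^ (p^3 + 1))" using cong_pow_trans by blast
qed simp

lemma px_leads: "leads (px :: 'a pol) (single X 1) 1"
  unfolding mvar_def by (rule leads_single) simp

lemma five_generatorsI:
  assumes "leads h (single Y (p^3 + 1)) 1" "leads k (single Z (p^4)) 1"
  shows "five_generators p [px, N, f, h, k]"
proof
  show "p > 2" by (rule p2)
  fix i :: nat assume "i < 5"
  then have "i = 0 \<or> i = 1 \<or> i = 2 \<or> i = 3 \<or> i = 4" by auto
  then show "leads ([px, N, f, h, k] ! i) (gen_LM p (single i 1)) 1"
    using px_leads N_leads f_leads assms by (elim disjE) (simp_all add: gen_LM_def lookup_single)
qed simp

text \<open>The generators are \<open>x, N, f, h\<close> and the element \<open>k\<close> with \<open>x\<^bsup>p\<^esup> k = h\<^bsup>p\<^esup> - N\<^bsup>p\<^sup>2 - 1\<^esup> f + \<dots>\<close> in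
  place of the norm of \<open>z\<close>, because for them both relations are explicit: the equations that define
  \<open>h\<close> and \<open>k\<close>.\<close>

lemma inv_ring_lead_monomials:
  assumes eq: "mconst (sg ^ (p + 1)) * (px ^ (p^2 - 1) * h) =
      N ^ (p + 1) - f ^ p + mconst ka * f * N ^ (p - 1) * w"
    and cong: "cong_pow px 2 h (Yq ^ p * py + px * h_tail)"
    and g: "g \<in> inv_ring" "g \<noteq> 0"
  shows "\<exists>K. keys K \<subseteq> {..<5} \<and> LM g = gen_LM p K"
proof -
  note h = h_homog_inv[OF eq]
  obtain k0 where k0: "px ^ p * k0 = h ^ p - N ^ (p^2 - 1) * f + mconst sg * px ^ (p - 1) * N ^ (p^2 - p) * h"
    "homog (p^4) k0" "k0 \<in> inv_ring" "\<exists>c A B. c \<noteq> 0 \<and> k0 = mconst c * pz ^ (p^4) + px * A + py * B"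
    by (rule k_exists[OF cong h])
  then obtain c A B where c: "c \<noteq> 0" "k0 = mconst c * pz ^ (p^4) + px * A + py * B" by blast
  \<comment> \<open>\<open>five_generators\<close> asks for lead coefficients \<open>1\<close>.\<close>
  define k where "k = mconst (inverse c) * k0"
  have lk0: "leads k0 (single Z (p^4)) c" by (rule leads_z_power[OF k0(2) c(2,1)])
  have "inverse c \<noteq> 0" using c(1) by simp
  then have "leads k (single Z (p^4)) (inverse c * c)"
    unfolding k_def by (rule leads_mconst_mult[OF lk0])
  then have lk: "leads k (single Z (p^4)) 1" using c(1) by simp
  have ck: "mconst c * k = k0"
    unfolding k_def mult.assoc[symmetric] mconst_mult[symmetric] using c(1) by simp
  let ?bs = "[px, N, f, h, k]"
  interpret F: five_generators p ?bs
    by (rule five_generatorsI[OF h_leads[OF h(1) cong] lk])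
  let ?s = "\<lambda>i n. single (i::nat) (n::nat)"
  define D' where "D' = p^4 + p + 1"
  have D': "2 < D'" using p2 by (simp add: D'_def)
  note ord = gen_order_add gen_order_single D'_def[symmetric]
  \<comment> \<open>\<open>K1, K2, K3\<close> are the monomials of the first relation below \<open>t\<^sub>2\<^bsup>p\<^esup>\<close>, and \<open>L1, L2, L3\<close> those of the
    second one below \<open>t\<^sub>3\<^bsup>p\<^esup>\<close>.\<close>
  define K1 where "K1 = ?s 1 (p + 1)"
  define K2 where "K2 = ?s 2 1 + ?s 1 (p - 1) + ?s 0 (p^2 - p)"
  define K3 where "K3 = ?s 0 (p^2 - 1) + ?s 3 1"
  define L1 where "L1 = ?s 1 (p^2 - 1) + ?s 2 1"
  define L2 where "L2 = ?s 0 (p - 1) + ?s 1 (p^2 - p) + ?s 3 1"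
  define L3 where "L3 = ?s 0 p + ?s 4 1"
  have keys: "keys K1 \<subseteq> {..<5}" "keys K2 \<subseteq> {..<5}" "keys K3 \<subseteq> {..<5}"
    "keys L1 \<subseteq> {..<5}" "keys L2 \<subseteq> {..<5}" "keys L3 \<subseteq> {..<5}"
    "keys (?s 2 p) \<subseteq> {..<5}" "keys (?s 3 p) \<subseteq> {..<5}"
    unfolding K1_def K2_def K3_def L1_def L2_def L3_def
    by (intro keys_add_subset keys_single_subset; simp)+

  define Q1 where "Q1 = single K1 1 + single K2 ka - single K3 (sg ^ (p + 1))"
  define Q2 where "Q2 = single L1 1 - single L2 sg + single L3 c"
  define r where "r = single (?s 2 p) 1 - Q1"
  define s where "s = single (?s 3 p) 1 - Q2"
  have p32: "p^3 = p^2 * p" "p^4 = p^2 * p^2" "p^4 = p * p^3" by (simp_all add: power_numeral_reduce)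
  have d: "a * (b - c) + a * c = a * b" if "c \<le> b" for a b c :: nat
    using that by (metis distrib_left le_add_diff_inverse2)
  have e1: "p^2 * (p - 1) + p^2 = p^3" using d[of 1 p "p^2"] p_le(2) by (simp add: p32(1))
  have e2: "p^2 * (p^2 - 1) + p^2 = p^4" using d[of 1 "p^2" "p^2"] q_pos(1) unfolding p32(2) by simp
  have e3: "p^2 * (p^2 - p) + p^3 = p^4" unfolding p32(1,2) by (rule d[OF p_le(3)])
  have p23: "p < p^2" "1 < p^2" "p^2 \<le> p^3" using q_pos p2 by (simp_all add: p32(1))
  have "gen_order p K < gen_order p (?s 2 p)" if "K \<in> {K1, K2, K3}" for K
  proof -
    have t: "gen_order p (?s 2 p) = D' * (p^3 + p^2) + p"
      unfolding ord by (simp add: p32(1) algebra_simps power2_eq_square)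
    have "gen_order p K1 = D' * (p^3 + p^2)"
      unfolding ord K1_def by (simp add: p32(1) algebra_simps)
    moreover have "gen_order p K2 = D' * (p^3 + p) + 1"
      unfolding ord K2_def e1[symmetric] by (simp add: algebra_simps)
    moreover have "gen_order p K3 = D' * (p^3 + 1) + 2"
      unfolding ord K3_def by simp
    moreover have "D' * (p^3 + p) + 1 < D' * (p^3 + p^2) + p"
      by (rule weighted_less) (use D' p23 in linarith)+
    moreover have "D' * (p^3 + 1) + 2 < D' * (p^3 + p^2) + p"
      by (rule weighted_less) (use D' p23 in linarith)+
    ultimately show ?thesis
      unfolding t using that p2 by (elim insertE emptyE) simp_all
  qed
  moreover have "K \<in> {K1, K2, K3}" if "K \<in> keys Q1" for K
    using that by (auto simp: Q1_def in_keys_iff lookup_minus lookup_add lookup_single when_def split: if_splits)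
  ultimately have r_lead: "gen_leads p r (?s 2 p)"
    unfolding r_def by (intro gen_leads_single_minus) blast
  have "gen_order p K < gen_order p (?s 3 p)" if "K \<in> {L1, L2, L3}" for K
  proof -
    have t: "gen_order p (?s 3 p) = D' * (p^4 + p) + 2 * p"
      unfolding ord by (simp add: p32(3) algebra_simps)
    have "gen_order p L1 = D' * (p^2 * (p^2 - 1) + (p^2 + p)) + 1"
      unfolding ord L1_def by (simp add: distrib_left)
    also have "p^2 * (p^2 - 1) + (p^2 + p) = p^4 + p" using e2 by linarith
    finally have "gen_order p L1 = D' * (p^4 + p) + 1" .
    moreover have "gen_order p L2 = D' * (p^4 + 1) + 2"
    proof -
      have "gen_order p L2 = D' * (p^2 * (p^2 - p) + (p^3 + 1)) + 2"
        unfolding ord L2_def by (simp add: distrib_left)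
      also have "p^2 * (p^2 - p) + (p^3 + 1) = p^4 + 1" using e3 by linarith
      finally show ?thesis .
    qed
    moreover have "gen_order p L3 = D' * p^4 + 0"
      unfolding ord L3_def by simp
    moreover have "D' * (p^4 + 1) + 2 < D' * (p^4 + p) + 2 * p"
      by (rule weighted_less) (use D' p2 in linarith)+
    moreover have "D' * p^4 + 0 < D' * (p^4 + p) + 2 * p"
      by (rule weighted_less) (use D' p2 in linarith)+
    ultimately show ?thesis
      unfolding t using that p2 by (elim insertE emptyE) simp_all
  qed
  moreover have "K \<in> {L1, L2, L3}" if "K \<in> keys Q2" for K
    using that by (auto simp: Q2_def in_keys_iff lookup_minus lookup_add lookup_single when_def split: if_splits)
  ultimately have s_lead: "gen_leads p s (?s 3 p)"
    unfolding s_def by (intro gen_leads_single_minus) blast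
  have R: "r \<in> F.R" "s \<in> F.R"
    unfolding r_def s_def Q1_def Q2_def
    by (intro mpoly_ring_diff mpoly_ring_add mpoly_ring_single keys)+
  have r0: "F.eval r = 0"
  proof -
    have "F.eval r = f ^ p - (N ^ (p + 1) + mconst ka * (f * N ^ (p - 1) * px ^ (p^2 - p))
        - mconst (sg ^ (p + 1)) * (px ^ (p^2 - 1) * h))"
      unfolding r_def Q1_def K1_def K2_def K3_def by (simp add: msubst_add msubst_diff mprod_add)
    then show ?thesis unfolding eq by (simp add: w_def mult.assoc)
  qed
  have s0: "F.eval s = 0"
  proof -
    have "F.eval s = h ^ p - (N ^ (p^2 - 1) * f - mconst sg * (px ^ (p - 1) * N ^ (p^2 - p) * h)
        + mconst c * (px ^ p * k))"
      unfolding s_def Q2_def L1_def L2_def L3_def by (simp add: msubst_add msubst_diff mprod_add)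
    also have "mconst c * (px ^ p * k) = px ^ p * k0"
      unfolding ck[symmetric] by (simp only: mult_ac)
    finally show ?thesis unfolding k0(1) by (simp add: mult.assoc)
  qed
  have k_inv: "k \<in> inv_ring" unfolding k_def by (intro inv_closed k0(3))
  let ?C = "F.eval ` F.R"
  have C: "subalgebra ?C" by (rule subalgebra_msubst_image)
  have bs_C: "?bs ! i \<in> ?C" if "i < 5" for i
    using mpoly_ring_mvar[OF that] by (intro image_eqI[of _ _ "mvar i"]) simp_all
  have C_inv: "?C \<subseteq> inv_ring"
  proof
    fix u assume "u \<in> ?C"
    then obtain P where P: "P \<in> F.R" "u = F.eval P" by blast
    have "?bs ! i \<in> inv_ring" if "i < 5" for i
    proof -
      have "i = 0 \<or> i = 1 \<or> i = 2 \<or> i = 3 \<or> i = 4" using that by auto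
      then show ?thesis using px_inv N_inv f_inv h(2) k_inv by (elim disjE) simp_all
    qed
    then show "u \<in> inv_ring" unfolding P(2) by (intro subalgebra_msubst[OF subalgebra_inv_ring P(1)])
  qed
  have px_C: "px \<in> ?C" and N_C: "N \<in> ?C" and f_C: "f \<in> ?C"
    using bs_C[of 0] bs_C[of 1] bs_C[of 2] by simp_all
  have D_C: "D \<in> ?C"
  proof -
    have "D = N^2 - mconst (- 2 * et) * (px ^ (p^2 - p) * f)"
      using f_equation by (simp add: w_def algebra_simps)
    then show ?thesis
      using subalgebra_closed(7)[OF C subalgebra_closed(8)[OF C N_C] subalgebra_closed(5)[OF C subalgebra_closed(1)[OF C]
            subalgebra_closed(5)[OF C subalgebra_closed(8)[OF C px_C] f_C]]] by simp
  qed
  obtain n where n: "px ^ n * g \<in> ?C" using inv_ring_localized[OF C C_inv px_C N_C D_C g(1)] by blast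
  have "g \<in> ?C" using n
  proof (induction n)
    case (Suc n)
    have "px * (px ^ n * g) \<in> ?C" using Suc.prems by (simp add: mult.assoc)
    from F.divide_by_x[OF R(1) r_lead r0 R(2) s_lead s0 _ this] have "px ^ n * g \<in> ?C" by simp
    then show ?case by (rule Suc.IH)
  qed simp
  then show ?thesis by (rule F.image_leads[OF R(1) r_lead r0 R(2) s_lead s0 _ g(2)])
qed

theorem invariants_structure:
  assumes eq: "mconst (sg ^ (p + 1)) * (px ^ (p^2 - 1) * h) =
      N ^ (p + 1) - f ^ p + mconst ka * f * N ^ (p - 1) * w"
    and cong: "cong_pow px 2 h (Yq ^ p * py + px * h_tail)"
  defines "bs \<equiv> [px, N, f, h, Nz]"
  shows "sagbi_basis inv_ring (set bs)" "complete_intersection inv_ring"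
    "complete_intersection_by_subduction inv_ring bs
       [(single 2 p, single 1 (p + 1)),
        (single 3 p, single 1 (p^2 - 1) + single 2 1)]"
proof -
  note h = h_homog_inv[OF eq]
  interpret F: five_generators p bs
    unfolding bs_def by (rule five_generatorsI[OF h_leads[OF h(1) cong] Nz_leads])
  have bs_inv: "bs ! i \<in> inv_ring" if "i < 5" for i
  proof -
    have "i = 0 \<or> i = 1 \<or> i = 2 \<or> i = 3 \<or> i = 4" using that by auto
    then show ?thesis unfolding bs_def using px_inv N_inv f_inv h(2) Nz_inv by (elim disjE) simp_all
  qed
  note A = subalgebra_inv_ring bs_inv inv_ring_lead_monomials[OF eq cong]
  show "sagbi_basis inv_ring (set bs)" by (rule F.sagbi[OF A])
  show "complete_intersection inv_ring"
    "complete_intersection_by_subduction inv_ring bs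
       [(single 2 p, single 1 (p + 1)),
        (single 3 p, single 1 (p^2 - 1) + single 2 1)]"
    using F.complete_intersection_by_subduction[OF A] by blast+
qed

end

theorem theorem9p4:
  fixes p :: nat and M :: "'a::field mat"
  assumes "prime p" and "p > 2" and "CHAR('a) = p"
    and "M \<in> carrier_mat 2 4"
    and "gam p M 1 2 3 4 \<noteq> 0"
    and "gam p M 1 2 3 5 = 0" and "gam p M 1 3 5 7 = 0"
    and "gam p M 1 2 4 5 \<noteq> 0"
  shows "sagbi_basis (invariants p M)
           {px, orbit_norm p M py, f2hat p M, h3 p M, orbit_norm p M pz} \<and>
         complete_intersection (invariants p M) \<and>
         complete_intersection_by_subduction (invariants p M)
           [px, orbit_norm p M py, f2hat p M, h3 p M, orbit_norm p M pz]
           [(Poly_Mapping.single 2 p, Poly_Mapping.single 1 (p + 1)),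
            (Poly_Mapping.single 3 p, Poly_Mapping.single 1 (p^2 - 1) + Poly_Mapping.single 2 1)]"
proof -
  define g where "g = gam p M 1 2 3 4"
  define g1245 where "g1245 = gam p M 1 2 4 5"
  define g2345 where "g2345 = gam p M 2 3 4 5"
  define et where "et = - g1245 / g"
  define al where "al = - g2345 / g"
  define u4 where "u4 = gam p M 1 2 3 6 / g"
  define u3 where "u3 = - gam p M 1 2 4 6 / g"
  define u2 where "u2 = gam p M 1 3 4 6 / g"
  define u1 where "u1 = - gam p M 2 3 4 6 / g"
  let ?W = "translation_set p M"
  have g0: "g \<noteq> 0" and g1245: "g1245 \<noteq> 0" using assms by (simp_all add: g_def g1245_def)
  have p1: "p > 1" "p > 0" using assms(2) by simp_all
  note rows = row_relations[OF assms(1,3,4,5,6,7)]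
  have row0: "M $$ (0, j) ^ (p^2) = et * M $$ (0, j) ^ p + al * M $$ (0, j)" if "j < 4" for j
    using rows(2)[OF that] by (simp add: et_def al_def g_def g1245_def g2345_def)
  have row1: "M $$ (1, j) ^ (p^2) = u1 * M $$ (0, j) + u2 * M $$ (1, j) + u3 * M $$ (0, j) ^ p + u4 * M $$ (1, j) ^ p"
    if "j < 4" for j
    using rows(3)[OF that] by (simp add: u1_def u2_def u3_def u4_def g_def)
  have W1: "a ^ (p^2) = et * a ^ p + al * a" if "(a, b) \<in> ?W" for a b
    by (rule translation_equations(1)[OF assms(1,3) _ _ that]) (fact row0, fact row1)
  have W2: "b ^ (p^2) = u1 * a + u2 * b + u3 * a ^ p + u4 * b ^ p" if "(a, b) \<in> ?W" for a b
    by (rule translation_equations(2)[OF assms(1,3) _ _ that]) (fact row0, fact row1)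
  have cardW: "card ?W = p^4" by (rule card_translation_set[OF assms(1,3,4,5)])
  have finW: "finite ?W" by (rule card_ge_0_finite) (use cardW p1 in simp)
  have counts: "card (fst ` ?W) = p^2"
    by (rule translation_counts(1)[OF p1(1) finW cardW]) (fact W1, fact W2)
  have counts2: "card {b. (a, b) \<in> ?W} = p^2" if "a \<in> fst ` ?W" for a
    by (rule translation_counts(2)[OF p1(1) finW cardW _ _ that]) (fact W1, fact W2)
  have al0: "al \<noteq> 0"
  proof (rule linear_coefficient_nonzero[OF assms(1,3) _ counts])
    show "finite (fst ` ?W)" using finW by simp
    show "a ^ (p^2) = et * a ^ p + al * a" if "a \<in> fst ` ?W" for a
      using that W1 by force
  qed
  interpret T: translation_group p ?W et al u1 u2 u3 u4
  proof
    show "et \<noteq> 0" using g0 g1245 by (simp add: et_def)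
    show "al \<noteq> 0" by (rule al0)
    show "card {b. (a, b) \<in> ?W} = p^2" if "a \<in> fst ` ?W" for a by (rule counts2[OF that])
    show "(a + c, b + d) \<in> ?W" if "(a, b) \<in> ?W" "(c, d) \<in> ?W" for a b c d
      by (rule translation_set_add[OF p1(2) assms(3) that])
    show "a ^ (p^2) = et * a ^ p + al * a" if "(a, b) \<in> ?W" for a b by (rule W1[OF that])
    show "b ^ (p^2) = u1 * a + u2 * b + u3 * a ^ p + u4 * b ^ p" if "(a, b) \<in> ?W" for a b
      by (rule W2[OF that])
  qed (fact assms finW counts)+
  obtain h where h: "mconst (T.sg ^ (p + 1)) * (px ^ (p^2 - 1) * h) =
      T.N ^ (p + 1) - T.f ^ p + mconst T.ka * T.f * T.N ^ (p - 1) * T.w"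
    "cong_pow px 2 h (T.Yq ^ p * py + px * T.h_tail)"
    by (rule T.h_exists)
  have c_et: "mconst g * mconst et = - (mconst g1245 :: 'a pol)"
    and c_al: "mconst g * mconst al = - (mconst g2345 :: 'a pol)"
    and c_u: "mconst g * mconst u4 = (mconst (gam p M 1 2 3 6) :: 'a pol)"
      "mconst g * mconst u3 = - (mconst (gam p M 1 2 4 6) :: 'a pol)"
      "mconst g * mconst u2 = (mconst (gam p M 1 3 4 6) :: 'a pol)"
      "mconst g * mconst u1 = - (mconst (gam p M 2 3 4 6) :: 'a pol)"
    unfolding mconst_mult[symmetric] mconst_uminus[symmetric]
    using g0 by (simp_all add: et_def al_def u1_def u2_def u3_def u4_def)
  have f1: "f1bar p M = mconst g * T.N"
  proof -
    have "mconst g * T.N = mconst g * py ^ (p^2) - (mconst g * mconst et) * T.w * py ^ p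
        - (mconst g * mconst al) * T.w * T.v * py"
      by (simp add: T.N_def algebra_simps)
    then show ?thesis
      unfolding f1bar_def T.px_powers T.w_def[symmetric] c_et c_al assms(6) rows(1)
      by (simp add: g_def g1245_def g2345_def algebra_simps)
  qed
  have f12346: "f12346bar p M = - (mconst g * T.D)"
  proof -
    have "mconst g * T.D = mconst g * delta ^ (p^2) - (mconst g * mconst u4) * delta ^ p * T.w^2
      + (mconst g * mconst u3) * T.w^2 * T.v * px * py ^ p - (mconst g * mconst u2) * delta * T.w^2 * T.v^2
      + (mconst g * mconst u1) * T.w^2 * T.v^2 * px * py"
      by (simp add: T.D_def algebra_simps)
    then show ?thesis
      unfolding f12346bar_def T.px_powers c_u by (simp add: g_def algebra_simps)
  qed
  have px0: "px \<noteq> (0 :: 'a pol)" by (rule T.px_nonzero)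
  have two: "(2 :: 'a pol) \<noteq> 0"
    using T.two mconst_eq_0_iff[of "2 :: 'a"] unfolding mconst_numeral by blast
  \<comment> \<open>\<open>N\<^sup>2 - D\<close> is divisible by \<open>x\<^bsup>p\<^sup>2 - p\<^esup>\<close>, and the definition of \<open>f2bar\<close> divides by \<open>x\<^bsup>p\<^sup>2 - 2p\<^esup>\<close>
    only; a factor \<open>x\<^bsup>p\<^esup>\<close> is left for \<open>f2hat\<close>.\<close>
  have f2bar: "f2bar p M = mconst (g * g1245) * px ^ p * T.f"
    unfolding f2bar_def
  proof (rule exact_quotI)
    have "px ^ (p^2 - 2 * p) * px ^ p = (T.w :: 'a pol)"
    proof -
      have "p^2 - 2 * p + p = p^2 - p" using T.p_le by linarith
      then show ?thesis unfolding T.w_def power_add[symmetric] by simp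
    qed
    then have "2 * px ^ (p^2 - 2 * p) * (mconst (g * g1245) * px ^ p * T.f)
        = 2 * mconst g * mconst g1245 * (T.w * T.f)"
      by (simp add: mconst_mult mult_ac)
    also have "\<dots> = (mconst g)^2 * (mconst (- 2 * et) * (T.w * T.f))"
    proof -
      have "mconst g * mconst (- 2 * et) = - 2 * (mconst g * mconst et :: 'a pol)"
        by (simp only: mconst_mult mconst_uminus mconst_numeral) (simp add: mult_ac)
      then have "mconst g * mconst (- 2 * et) = (2 * mconst g1245 :: 'a pol)"
        unfolding c_et by simp
      then have "(mconst g)^2 * mconst (- 2 * et) = (2 * mconst g * mconst g1245 :: 'a pol)"
        by (simp add: power2_eq_square mult_ac)
      then show ?thesis unfolding mult.assoc[of "(mconst g)^2", symmetric] by (simp only:)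
    qed
    also have "\<dots> = (f1bar p M)^2 + mconst (gam p M 1 2 3 4) * f12346bar p M"
      unfolding T.f_equation[symmetric] f1 f12346 g_def[symmetric]
      by (simp add: algebra_simps power2_eq_square)
    finally show "2 * px ^ (p^2 - 2 * p) * (mconst (g * g1245) * px ^ p * T.f)
        = (f1bar p M)^2 + mconst (gam p M 1 2 3 4) * f12346bar p M" .
    show "2 * px ^ (p^2 - 2 * p) \<noteq> (0 :: 'a pol)" using two px0 by simp
  qed
  have f2: "f2hat p M = T.f"
    unfolding f2hat_def f2bar g_def[symmetric] g1245_def[symmetric]
    by (rule exact_quotI) (use g0 g1245 px0 in simp_all)
  have Ny: "orbit_norm p M py = T.N"
    unfolding orbit_norm_y by (rule T.N_prod)
  have Nz: "orbit_norm p M pz = T.Nz"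
    unfolding orbit_norm_z[OF T.two] T.Nz_def ..
  have sg: "T.sg = g2345 / g1245"
    unfolding T.sg_def unfolding et_def al_def using g0 g1245 by simp
  have h3t: "h3tilde p M = mconst (T.sg ^ (p + 1)) * (px ^ (p^2 - 1) * h)"
  proof -
    have "g1245 / g - g2345 ^ p / g1245 ^ p = - T.ka"
      unfolding T.ka_def sg unfolding et_def by (simp add: power_divide)
    then show ?thesis
      unfolding h(1) h3tilde_def Ny f2 g_def[symmetric] g1245_def[symmetric] g2345_def[symmetric]
      by (simp add: mconst_uminus T.w_def)
  qed
  have g2345: "g2345 \<noteq> 0" using al0 by (simp add: al_def)
  have h3: "h3 p M = h"
    unfolding h3_def g1245_def[symmetric] g2345_def[symmetric] h3t
  proof (rule exact_quotI)
    have gs: "mconst (g1245 ^ (p + 1)) * mconst (T.sg ^ (p + 1)) = (mconst (g2345 ^ (p + 1)) :: 'a pol)"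
      unfolding mconst_mult[symmetric] power_mult_distrib[symmetric] sg using g1245 by simp
    show "px ^ (p^2 - 1) * mconst (g2345 ^ (p + 1)) * h =
        mconst (g1245 ^ (p + 1)) * (mconst (T.sg ^ (p + 1)) * (px ^ (p^2 - 1) * h))"
      unfolding gs[symmetric] by (simp only: mult_ac)
    show "px ^ (p^2 - 1) * mconst (g2345 ^ (p + 1)) \<noteq> (0 :: 'a pol)" using px0 g2345 by simp
  qed
  have inv: "invariants p M = T.inv_ring"
    unfolding invariants_eq T.inv_ring_def by blast
  show ?thesis
    unfolding inv Ny Nz f2 h3 using T.invariants_structure[OF h] by simp
qed

end
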